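(* Let $d\ge1$ be an integer and let $p\neq2$ satisfy $1\le p\le 2^\#$ if $d\ge2$, and $p\ge1$ if $d=1$. Let $$\gamma=\Big(\frac{d-1}{d+2}\Big)^2(p-1)\,(2^\#-p)\ \text{ if } d\ge2,\qquad \gamma=\frac{p-1}{3}\ \text{ if } d=1 .$$ If $\gamma\neq 2-p$, then $$\|\nabla u\|_2^2\ \ge\ \frac{d}{2-p-\gamma}\Big(\|u\|_2^2-\|u\|_p^{\,2-\frac{2\gamma}{2-p}}\,\|u\|_2^{\frac{2\gamma}{2-p}}\Big)\qquad\forall\,u\in \mathrm H^1(\mathbb S^d),$$ and if $\gamma=2-p$, then $$\|\nabla u\|_2^2\ \ge\ \frac{2d}{p-2}\,\|u\|_2^2\,\log\Big(\frac{\|u\|_2^2}{\|u\|_p^2}\Big)\qquad\forall\,u\in \mathrm H^1(\mathbb S^d).$$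
   Context: $\mathbb S^d\subset\mathbb R^{d+1}$ is the unit sphere endowed with the uniform probability measure $d\mu$; $\|u\|_q=\big(\int_{\mathbb S^d}|u|^q\,d\mu\big)^{1/q}$; $\nabla$ is the gradient on $\mathbb S^d$ and $\mathrm H^1(\mathbb S^d)=\mathrm H^1(\mathbb S^d,d\mu)$. The Bakry–Emery exponent is $2^\#=\frac{2d^2+1}{(d-1)^2}$ for $d\ge2$, with the convention $2^\#=+\infty$ if $d=1$. *)

theory Defs
  imports "HOL-Analysis.Analysis" "HOL-Probability.Probability"
begin

text \<open>Uniform probability measure on the unit sphere of real^'n (so d = CARD('n) - 1),
  realised as the image of the normalised Lebesgue measure on the unit ball under the
  radial projection x \<mapsto> x/|x| (the cone measure = normalised surface measure).
  The origin (a null set) is sent to 0.\<close>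
definition sphere_mu :: "(real^'n::finite) measure" where
  "sphere_mu = distr (uniform_measure lborel (ball 0 1)) borel (\<lambda>x. x /\<^sub>R norm x)"

definition Lnorm :: "'a measure \<Rightarrow> real \<Rightarrow> ('a \<Rightarrow> real) \<Rightarrow> real" where
  "Lnorm M q u = (\<integral>x. \<bar>u x\<bar> powr q \<partial>M) powr (1 / q)"

definition tang_grad :: "real^'n \<Rightarrow> real^'n \<Rightarrow> real^'n" where
  "tang_grad g x = g - (g \<bullet> x) *\<^sub>R x"

definition C1_on_sphere :: "(real^'n::finite \<Rightarrow> real) \<Rightarrow> (real^'n \<Rightarrow> real^'n) \<Rightarrow> bool" where
  "C1_on_sphere v dv \<longleftrightarrow>
     v \<in> borel_measurable borel \<and> dv \<in> borel_measurable borel \<and>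
     (\<forall>x\<in>sphere 0 1. (v has_derivative (\<lambda>h. dv x \<bullet> h)) (at x)) \<and>
     continuous_on (sphere 0 1) dv"

text \<open>u \<in> H^1(S^d, d\<mu>) with (weak) spherical gradient G:  H^1 is the completion of the
  C^1 functions for the norm (\<parallel>u\<parallel>_2^2 + \<parallel>\<nabla>u\<parallel>_2^2)^(1/2); G is the L^2 limit of the
  gradients of an approximating sequence.\<close>
definition H1_sphere :: "(real^'n::finite \<Rightarrow> real) \<Rightarrow> (real^'n \<Rightarrow> real^'n) \<Rightarrow> bool" where
  "H1_sphere u G \<longleftrightarrow>
     u \<in> borel_measurable borel \<and> G \<in> borel_measurable borel \<and>
     integrable sphere_mu (\<lambda>x. (u x)\<^sup>2) \<and> integrable sphere_mu (\<lambda>x. (norm (G x))\<^sup>2) \<and>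
     (\<exists>v dv. (\<forall>k. C1_on_sphere (v k) (dv k)) \<and>
        (\<lambda>k. \<integral>\<^sup>+ x. ennreal ((v k x - u x)\<^sup>2) \<partial>sphere_mu) \<longlonglongrightarrow> 0 \<and>
        (\<lambda>k. \<integral>\<^sup>+ x. ennreal ((norm (tang_grad (dv k x) x - G x))\<^sup>2) \<partial>sphere_mu) \<longlonglongrightarrow> 0)"

text \<open>Bakry--Emery exponent 2^# (for d \<ge> 2; for d = 1 it is +\<infinity>, handled separately).\<close>
definition BE_exp :: "real \<Rightarrow> real" where
  "BE_exp d = (2 * d\<^sup>2 + 1) / (d - 1)\<^sup>2"

definition BE_gamma :: "real \<Rightarrow> real \<Rightarrow> real" where
  "BE_gamma d p = (if d \<ge> 2 then ((d - 1) / (d + 2))\<^sup>2 * (p - 1) * (BE_exp d - p)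
                   else (p - 1) / 3)"

end

theory Submission
  imports Defs
begin

text \<open>The spherical Laplacian is half the sum of the squares of the rotation fields
  \<open>LD (i,j) = x\<^sub>i \<partial>\<^sub>j - x\<^sub>j \<partial>\<^sub>i\<close>, which commute with it and integrate to zero, so the whole
  carre du champ calculus can be carried out with these fields.  For a positive solution \<open>\<rho>\<close> of the heat
  equation put \<open>u = \<rho> powr (1/p)\<close>, \<open>i = \<parallel>\<nabla>u\<parallel>\<^sub>2\<^sup>2\<close> and \<open>y = \<parallel>u\<parallel>\<^sub>2\<^sup>2\<close>.  Then \<open>y' = 2 (p - 2) i\<close>, the norm
  \<open>\<parallel>u\<parallel>\<^sub>p\<close> is conserved, and the curvature-dimension condition applied to a suitable power of \<open>\<rho>\<close> yields
  \<open>i' \<le> - 2 d i - 2 \<gamma> \<integral> \<bar>\<nabla>u\<bar>\<^sup>4 / u\<^sup>2 \<le> - 2 d i - 2 \<gamma> i\<^sup>2 / y\<close>.  With \<open>\<kappa> = \<gamma> / (p - 2)\<close> the quantity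
  \<open>i y powr \<kappa> + d / (p - 2 + \<gamma>) y powr (\<kappa> + 1)\<close> is therefore nonincreasing, and comparing its initial
  value with its limit, where \<open>\<rho>\<close> is constant, gives the inequality.  On the circle the
  curvature-dimension condition degenerates and the Poincare inequality replaces it.

  To have an explicit flow, the initial datum is taken in the image of the convolution with the zonal
  kernel \<open>(1 + x \<bullet> y) ^ k\<close>: expanding the kernel into Gegenbauer polynomials gives a finite sum of
  eigenfunctions.  These convolutions commute with the rotation fields and form an approximate identity,
  and density arguments finish the proof.\<close>

section \<open>Partial derivatives and the rotation fields\<close>

text \<open>Only \<open>\<rho>\<close> solves a linear equation, so \<open>\<rho>\<close>, and not
  \<open>u\<close>, is kept polynomial. With \<open>z = 1 - 1/p\<close> one has
  \<open>u = \<rho> powr (1 - z)\<close>, and every functional is the integral of a polynomial in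
  \<open>\<rho>\<close> and its derivatives against a power of \<open>\<rho>\<close>. Integration by
  parts leaves few independent integrals, and for \<open>d > 1\<close> the power
  \<open>c + 1\<close> in the curvature-dimension condition is forced: only
  \<open>c = - z (2 d + 1) / (d + 2)\<close> balances the terms with
  \<open>Gam \<rho> \<rho> * Lap \<rho>\<close>. What then remains on the square of
  \<open>Gam \<rho> \<rho>\<close> is \<gamma> up to a positive factor, and its sign is the reason
  for the bound on \<open>p\<close>. By contrast \<open>p - 2\<close>, \<kappa> and
  \<open>d / (p - 2 + \<gamma>)\<close> may be negative, so the monotone quantity is never
  normalised by them. The sign also shapes the density argument: for \<open>p < 2\<close> the norm
  of \<open>u\<close> in L^p itself has to converge, which L^2 convergence ensures; for
  \<open>p > 2\<close> the constant is positive and lower semicontinuity suffices. Positivity,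
  needed for real powers, is kept by the flow through a minimum principle, and \<open>u\<close>
  itself is replaced by a smoothed absolute value.\<close>

definition PD :: "'n \<Rightarrow> (real^'n \<Rightarrow> real) \<Rightarrow> real^'n::finite \<Rightarrow> real" where
  "PD i f x = frechet_derivative f (at x) (axis i 1)"

definition LD :: "'n \<times> 'n \<Rightarrow> (real^'n \<Rightarrow> real) \<Rightarrow> real^'n::finite \<Rightarrow> real" where
  "LD a f x = x $ fst a * PD (snd a) f x - x $ snd a * PD (fst a) f x"

text \<open>The index runs over all ordered pairs, the diagonal ones contributing 0, so that sums
  range over \<open>UNIV\<close>. Every rotation plane is counted twice, which explains the factor
  1/2 here and in \<open>Lap\<close> and the factor 1/4 in \<open>Gam2\<close>.\<close>

definition Gam :: "(real^'n \<Rightarrow> real) \<Rightarrow> (real^'n \<Rightarrow> real) \<Rightarrow> real^'n::finite \<Rightarrow> real" where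
  "Gam f g x = (\<Sum>a\<in>UNIV. LD a f x * LD a g x) / 2"

definition Lap :: "(real^'n \<Rightarrow> real) \<Rightarrow> real^'n::finite \<Rightarrow> real" where
  "Lap f x = (\<Sum>a\<in>UNIV. LD a (LD a f) x) / 2"

text \<open>For polynomials this is the iterated carre du champ
  \<open>(Lap (Gam f f) - 2 * Gam f (Lap f)) / 2\<close>, by \<open>Bochner_Lap_Gam\<close>; written
  as a sum of squares it can be bounded below pointwise.\<close>

definition Gam2 :: "(real^'n \<Rightarrow> real) \<Rightarrow> real^'n::finite \<Rightarrow> real" where
  "Gam2 f x = (\<Sum>b\<in>UNIV. \<Sum>a\<in>UNIV. (LD b (LD a f) x)\<^sup>2) / 4"

abbreviation rpoly :: "(real^'n::finite \<Rightarrow> real) \<Rightarrow> bool" where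
  "rpoly \<equiv> real_polynomial_function"

lemmas rpoly_const = real_polynomial_function.intros(2)
  and rpoly_add = real_polynomial_function.intros(3)
  and rpoly_mult = real_polynomial_function.intros(4)

lemma PD_eqI: "(f has_derivative f') (at x) \<Longrightarrow> PD i f x = f' (axis i 1)"
  unfolding PD_def by (metis frechet_derivative_at)

lemma PD_const [simp]: "PD i (\<lambda>x. c) x = 0"
  by (rule PD_eqI[THEN trans]) (auto intro!: derivative_eq_intros)

lemma PD_linear: "bounded_linear f \<Longrightarrow> PD i f x = f (axis i 1)"
  by (rule PD_eqI) (rule bounded_linear_imp_has_derivative)

lemma PD_coord: "PD i (\<lambda>x. x $ j) x = (if i = j then 1 else 0)"
  by (subst PD_linear) (auto simp: bounded_linear_vec_nth axis_def)

lemma PD_add: "f differentiable at x \<Longrightarrow> g differentiable at x \<Longrightarrow>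
    PD i (\<lambda>x. f x + g x) x = PD i f x + PD i g x"
  by (rule PD_eqI[THEN trans, OF has_derivative_add])
     (auto simp: PD_def simp flip: frechet_derivative_works)

lemma PD_mult: "f differentiable at x \<Longrightarrow> g differentiable at x \<Longrightarrow>
    PD i (\<lambda>x. f x * g x) x = f x * PD i g x + PD i f x * g x"
  by (rule PD_eqI[THEN trans, OF has_derivative_mult])
     (auto simp: PD_def simp flip: frechet_derivative_works)

lemma PD_compose:
  assumes "f differentiable at x" "(h has_real_derivative h') (at (f x))"
  shows "PD i (\<lambda>x. h (f x)) x = h' * PD i f x"
proof -
  have "(f has_derivative frechet_derivative f (at x)) (at x)"
    using assms(1) frechet_derivative_works by blast
  then have "((\<lambda>x. h (f x)) has_derivative (\<lambda>v. frechet_derivative f (at x) v * h')) (at x)"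
    using has_derivative_compose[of f _ x UNIV h "(*) h'"] assms(2)
    by (simp add: has_field_derivative_def mult.commute)
  from PD_eqI[OF this] show ?thesis by (simp add: PD_def mult.commute)
qed

lemma frechet_derivative_rotation:
  assumes "f differentiable at x"
  shows "frechet_derivative f (at x) (x $ i *\<^sub>R axis j 1 - x $ j *\<^sub>R axis i 1) = LD (i, j) f x"
proof -
  have "bounded_linear (frechet_derivative f (at x))"
    using assms by (meson frechet_derivative_works has_derivative_bounded_linear)
  then show ?thesis
    by (simp add: bounded_linear.linear linear_diff linear_cmul PD_def LD_def)
qed

lemma LD_diag [simp]: "LD (i, i) f x = 0"
  by (simp add: LD_def)

lemma LD_swap: "LD (j, i) f x = - LD (i, j) f x"
  by (simp add: LD_def)

lemma LD_const [simp]: "LD a (\<lambda>x. c) x = 0"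
  by (simp add: LD_def)

lemma LD_coord: "LD (i, j) (\<lambda>x. x $ m) x = (if j = m then x $ i else 0) - (if i = m then x $ j else 0)"
  by (simp add: LD_def PD_coord)

lemma LD_add: "f differentiable at x \<Longrightarrow> g differentiable at x \<Longrightarrow>
    LD a (\<lambda>x. f x + g x) x = LD a f x + LD a g x"
  by (simp add: LD_def PD_add algebra_simps)

lemma LD_mult: "f differentiable at x \<Longrightarrow> g differentiable at x \<Longrightarrow>
    LD a (\<lambda>x. f x * g x) x = f x * LD a g x + LD a f x * g x"
  by (simp add: LD_def PD_mult algebra_simps)

lemma LD_cmult: "f differentiable at x \<Longrightarrow> LD a (\<lambda>x. c * f x) x = c * LD a f x"
  by (simp add: LD_mult)

lemma LD_uminus: "f differentiable at x \<Longrightarrow> LD a (\<lambda>x. - f x) x = - LD a f x"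
  using LD_cmult[of f x a "-1"] by simp

lemma LD_diff: "f differentiable at x \<Longrightarrow> g differentiable at x \<Longrightarrow>
    LD a (\<lambda>x. f x - g x) x = LD a f x - LD a g x"
  using LD_add[of f x "\<lambda>x. - g x" a] by (simp add: LD_uminus)

lemma LD_sum: "(\<And>k. k \<in> K \<Longrightarrow> f k differentiable at x) \<Longrightarrow>
    LD a (\<lambda>x. \<Sum>k\<in>K. f k x) x = (\<Sum>k\<in>K. LD a (f k) x)"
  by (induction K rule: infinite_finite_induct) (auto simp: LD_add)

lemma LD_compose:
  assumes "f differentiable at x" "(h has_real_derivative h') (at (f x))"
  shows "LD a (\<lambda>x. h (f x)) x = h' * LD a f x"
  by (simp add: LD_def PD_compose[OF assms] algebra_simps)

lemma LD_powr:
  assumes "f differentiable at x" "f x > 0"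
  shows "LD a (\<lambda>x. f x powr s) x = s * f x powr (s - 1) * LD a f x"
  by (rule LD_compose[OF assms(1)]) (use assms(2) in \<open>auto intro!: derivative_eq_intros\<close>)

lemma rpoly_diff [simp, intro]: "rpoly f \<Longrightarrow> f differentiable at x"
  by (rule differentiable_at_real_polynomial_function)

lemma rpoly_coord [intro]: "rpoly (\<lambda>x. x $ i)"
  by (intro real_polynomial_function.intros bounded_linear_vec_nth)

lemma rpoly_PD [intro]: "rpoly f \<Longrightarrow> rpoly (PD i f)"
proof (induction f rule: real_polynomial_function.induct)
  case (linear f)
  then have "PD i f = (\<lambda>x. f (axis i 1))" by (simp add: PD_linear fun_eq_iff)
  then show ?case by auto
next
  case (const c)
  have "PD i (\<lambda>x. c) = (\<lambda>x. 0)" by (simp add: fun_eq_iff)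
  then show ?case by auto
next
  case (add f g)
  then have "PD i (\<lambda>x. f x + g x) = (\<lambda>x. PD i f x + PD i g x)" by (simp add: PD_add fun_eq_iff)
  with add show ?case by auto
next
  case (mult f g)
  then have "PD i (\<lambda>x. f x * g x) = (\<lambda>x. f x * PD i g x + PD i f x * g x)"
    by (simp add: PD_mult fun_eq_iff)
  with mult show ?case by auto
qed

lemma rpoly_LD [simp, intro]: "rpoly f \<Longrightarrow> rpoly (LD a f)"
  using rpoly_PD unfolding LD_def[abs_def] by (auto intro!: real_polynomial_function_diff)

lemma rpoly_Gam [simp, intro]: "rpoly f \<Longrightarrow> rpoly g \<Longrightarrow> rpoly (Gam f g)"
  unfolding Gam_def[abs_def] by (intro real_polynomial_function_divide real_polynomial_function_sum finite rpoly_mult rpoly_LD)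

lemma rpoly_Lap [simp, intro]: "rpoly f \<Longrightarrow> rpoly (Lap f)"
  unfolding Lap_def[abs_def] by (auto intro!: real_polynomial_function_divide)

lemma rpoly_Gam2 [simp, intro]: "rpoly f \<Longrightarrow> rpoly (Gam2 f)"
  unfolding Gam2_def[abs_def]
  by (intro real_polynomial_function_divide real_polynomial_function_sum finite real_polynomial_function_power rpoly_LD)

lemma rpoly_continuous_on [intro]: "rpoly f \<Longrightarrow> continuous_on S f"
  by (simp add: continuous_on_polymonial_function real_polynomial_function_eq)

lemma PD_add_fun: "rpoly f \<Longrightarrow> rpoly g \<Longrightarrow> PD i (\<lambda>x. f x + g x) = (\<lambda>x. PD i f x + PD i g x)"
  by (simp add: PD_add fun_eq_iff)

lemma PD_mult_fun: "rpoly f \<Longrightarrow> rpoly g \<Longrightarrow> PD i (\<lambda>x. f x * g x) = (\<lambda>x. f x * PD i g x + PD i f x * g x)"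
  by (simp add: PD_mult fun_eq_iff)

text \<open>Symmetry of second derivatives is an induction over the construction of a polynomial;
  the commutation relations built on it are only ever applied to polynomials.\<close>

lemma PD_commute: "rpoly f \<Longrightarrow> PD i (PD j f) = PD j (PD i f)"
proof (induction f rule: real_polynomial_function.induct)
  case (linear f)
  then have "PD k f = (\<lambda>x. f (axis k 1))" for k by (simp add: PD_linear fun_eq_iff)
  then show ?case by (simp add: fun_eq_iff)
next
  case (const c)
  have "PD k (\<lambda>x. c) = (\<lambda>x. 0)" for k by (simp add: fun_eq_iff)
  then show ?case by (simp add: fun_eq_iff)
next
  case (add f g)
  then show ?case by (simp add: PD_add_fun rpoly_PD)
next
  case (mult f g)
  then have [simp]: "rpoly (PD i f)" "rpoly (PD j f)" "rpoly (PD i g)" "rpoly (PD j g)" by auto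
  from mult show ?case
    by (simp add: PD_mult_fun PD_add_fun real_polynomial_function.intros fun_eq_iff algebra_simps)
qed

lemma LD_LD:
  assumes "rpoly f"
  shows "LD (k, l) (LD (i, j) f) x =
     ((if l = i then x $ k else 0) - (if k = i then x $ l else 0)) * PD j f x
   - ((if l = j then x $ k else 0) - (if k = j then x $ l else 0)) * PD i f x
   + x $ i * (x $ k * PD l (PD j f) x - x $ l * PD k (PD j f) x)
   - x $ j * (x $ k * PD l (PD i f) x - x $ l * PD k (PD i f) x)"
proof -
  have "LD (i, j) f = (\<lambda>x. x $ i * PD j f x - x $ j * PD i f x)" by (simp add: LD_def fun_eq_iff)
  moreover have [simp]: "rpoly (PD i f)" "rpoly (PD j f)" using assms by auto
  moreover have [simp]: "(\<lambda>x. x $ m) differentiable at x" for m and x :: "real^'n" by auto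
  ultimately have "LD (k, l) (LD (i, j) f) x = x $ i * LD (k,l) (PD j f) x + LD (k,l) (\<lambda>x. x $ i) x * PD j f x
     - (x $ j * LD (k,l) (PD i f) x + LD (k,l) (\<lambda>x. x $ j) x * PD i f x)"
    by (simp add: LD_diff LD_mult)
  then show ?thesis
    unfolding LD_coord by (simp add: LD_def algebra_simps)
qed

text \<open>The second-order terms of \<open>LD_LD\<close> cancel by symmetry of the Hessian; what
  remains are the structure relations of the Lie algebra of rotations.\<close>

lemma LD_commutator:
  assumes "rpoly f"
  shows "LD (k, l) (LD (i, j) f) x - LD (i, j) (LD (k, l) f) x =
     (if l = i then LD (k, j) f x else 0) - (if k = i then LD (l, j) f x else 0)
   - (if l = j then LD (k, i) f x else 0) + (if k = j then LD (l, i) f x else 0)"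
  unfolding LD_LD[OF assms] using PD_commute[OF assms]
  by (simp add: LD_def algebra_simps)

section \<open>The normalised surface measure\<close>

text \<open>A Vitali covering exhausts \<open>U\<close>, up to a null set, by disjoint balls, and
  \<open>R\<close> maps each ball to one of the same radius. Only an inequality comes out, since
  nothing is known yet about the image of the null set; the reverse one is obtained by applying the
  result to the inverse of \<open>R\<close>.\<close>

lemma emeasure_orthogonal_image_open_ge:
  fixes R :: "'a::euclidean_space \<Rightarrow> 'a"
  assumes R: "orthogonal_transformation R" and U: "open U"
  shows "emeasure lborel U \<le> emeasure lborel (R ` U)"
proof -
  define K where "K = {(a, r). r > 0 \<and> ball a r \<subseteq> U}"
  have cov: "\<exists>i. i \<in> K \<and> x \<in> ball (fst i) (snd i) \<and> snd i < d" if "x \<in> U" "0 < d" for x d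
  proof -
    obtain e where e: "e > 0" "ball x e \<subseteq> U" using U \<open>x \<in> U\<close> open_contains_ball by blast
    have "(x, min e (d/2)) \<in> K" using e \<open>0 < d\<close> unfolding K_def by auto
    then show ?thesis using e \<open>0 < d\<close>
      by (intro exI[of _ "(x, min e (d/2))"]) auto
  qed
  obtain C where C: "countable C" "C \<subseteq> K"
     "pairwise (\<lambda>i j. disjnt (ball (fst i) (snd i)) (ball (fst j) (snd j))) C"
     "negligible (U - (\<Union>i \<in> C. ball (fst i) (snd i)))"
    using Vitali_covering_theorem_balls[of U K fst snd] cov by blast
  define W where "W = (\<Union>i\<in>C. ball (fst i) (snd i))"
  have R_ball: "R ` ball a r = ball (R a) r" for a r
    using R by (rule image_orthogonal_transformation_ball)
  have bij: "bij R" using R by (rule orthogonal_transformation_bij)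
  have [measurable]: "W \<in> sets lborel" unfolding W_def by (simp add: open_UN borel_open)
  have [measurable]: "U \<in> sets lborel" using U by simp
  have Null: "U - W \<in> null_sets lborel"
    using C(4) \<open>U \<in> sets lborel\<close> \<open>W \<in> sets lborel\<close>
    by (subst null_sets_completion_iff[symmetric]) (auto simp: negligible_iff_null_sets W_def)
  have "emeasure lborel U \<le> emeasure lborel (W \<union> (U - W))"
    by (intro emeasure_mono sets.Un sets.Diff) (simp_all only: \<open>W \<in> sets lborel\<close> \<open>U \<in> sets lborel\<close>, blast)
  also have "\<dots> \<le> emeasure lborel W"
    using Null by (subst emeasure_Un_null_set) (simp_all only: \<open>W \<in> sets lborel\<close> order_refl)
  also have "\<dots> = (\<integral>\<^sup>+i. emeasure lborel (ball (fst i) (snd i)) \<partial>count_space C)"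
    unfolding W_def using C
    by (intro emeasure_UN_countable) (auto simp: disjoint_family_on_def pairwise_def disjnt_def)
  also have "\<dots> = (\<integral>\<^sup>+i. emeasure lborel (R ` ball (fst i) (snd i)) \<partial>count_space C)"
  proof (intro nn_integral_cong)
    fix i assume "i \<in> space (count_space C)"
    then have "snd i > 0" using C(2) by (auto simp: K_def)
    then show "emeasure lborel (ball (fst i) (snd i)) = emeasure lborel (R ` ball (fst i) (snd i))"
      by (simp add: R_ball emeasure_ball)
  qed
  also have "\<dots> = emeasure lborel (\<Union>i\<in>C. R ` ball (fst i) (snd i))"
  proof (intro emeasure_UN_countable[symmetric])
    show "disjoint_family_on (\<lambda>i. R ` ball (fst i) (snd i)) C"
      using C(3) by (fastforce simp: disjoint_family_on_def pairwise_def disjnt_def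
             simp flip: image_Int[OF bij_is_inj[OF bij]])
  qed (use C(1) in \<open>auto simp: R_ball\<close>)
  also have "\<dots> \<le> emeasure lborel (R ` U)"
  proof (intro emeasure_mono)
    show "R ` U \<in> sets lborel"
      using U R by (simp add: borel_open open_surjective_linear_image orthogonal_transformation_linear orthogonal_transformation_surj)
  qed (use C(2) in \<open>fastforce simp: K_def\<close>)
  finally show ?thesis .
qed

text \<open>A measure that gives every box its volume is Lebesgue measure; the two inequalities for
  a box come from \<open>R\<close> on its preimage and from \<open>inv R\<close> on the box
  itself.\<close>

lemma distr_lborel_orthogonal:
  fixes R :: "'a::euclidean_space \<Rightarrow> 'a"
  assumes R: "orthogonal_transformation R"
  shows "distr lborel borel R = lborel"
proof (rule lborel_eqI[symmetric])
  fix l u :: 'a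
  assume lu: "\<And>b. b \<in> Basis \<Longrightarrow> l \<bullet> b \<le> u \<bullet> b"
  have bij: "bij R" using R by (rule orthogonal_transformation_bij)
  define B where "B = R -` box l u"
  have RB: "R ` B = box l u" unfolding B_def using bij by (simp add: bij_is_surj surj_image_vimage_eq)
  have B: "inv R ` box l u = B" unfolding B_def using bij by (simp add: bij_vimage_eq_inv_image)
  have cont: "continuous_on UNIV R"
    using R by (simp add: linear_continuous_on linear_linear orthogonal_transformation_linear)
  have [measurable]: "R \<in> borel_measurable borel"
    using cont by (rule borel_measurable_continuous_onI)
  have "open B" unfolding B_def using cont by (simp add: open_vimage open_box)
  then have "emeasure lborel B \<le> emeasure lborel (box l u)"
    using emeasure_orthogonal_image_open_ge[OF R] RB by metis
  moreover have "emeasure lborel (box l u) \<le> emeasure lborel B"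
    using emeasure_orthogonal_image_open_ge[OF orthogonal_transformation_inv[OF R], of "box l u"] B
    by (simp add: open_box)
  ultimately have "emeasure (distr lborel borel R) (box l u) = emeasure lborel (box l u)"
    by (simp add: emeasure_distr B_def)
  then show "emeasure (distr lborel borel R) (box l u) = (\<Prod>b\<in>Basis. (u - l) \<bullet> b)"
    using lu by (simp add: emeasure_lborel_box)
qed simp

section \<open>The cone measure on the sphere and its rotation invariance\<close>

lemma space_sphere_mu [simp]: "space sphere_mu = UNIV"
  and sets_sphere_mu [simp, measurable_cong]: "sets sphere_mu = sets borel"
  by (auto simp: sphere_mu_def)

lemma measurable_radial [measurable]:
  "(\<lambda>x::real^'n::finite. x /\<^sub>R norm x) \<in> borel_measurable borel"
  by measurable

lemma emeasure_unit_ball: "emeasure lborel (ball (0::real^'n::finite) 1) \<noteq> 0"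
   "emeasure lborel (ball (0::real^'n) 1) \<noteq> \<infinity>"
  using unit_ball_vol_pos[of "real CARD('n)"] by (auto simp: emeasure_ball simp del: unit_ball_vol_pos)

lemma emeasure_sphere_mu:
  fixes A :: "(real^'n::finite) set"
  assumes [measurable]: "A \<in> sets borel"
  shows "emeasure sphere_mu A =
    emeasure lborel (ball 0 1 \<inter> (\<lambda>x. x /\<^sub>R norm x) -` A) / emeasure lborel (ball (0::real^'n) 1)"
proof -
  have [measurable]: "(\<lambda>x. x /\<^sub>R norm x) -` A \<in> sets borel"
    using measurable_sets[OF measurable_radial assms] by simp
  show ?thesis
    unfolding sphere_mu_def by (simp add: emeasure_distr)
qed

interpretation sphere_mu: prob_space sphere_mu
  unfolding sphere_mu_def
  by (intro prob_space.prob_space_distr prob_space_uniform_measure emeasure_unit_ball) simp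

text \<open>The origin is the only point of the ball that radial projection does not send to the
  sphere.\<close>

lemma AE_sphere_mu: "AE x in sphere_mu. x \<in> sphere (0::real^'n::finite) 1"
proof (rule AE_I[where N = "- sphere 0 1"])
  have "(ball 0 1 \<inter> (\<lambda>x::real^'n. x /\<^sub>R norm x) -` (- sphere 0 1)) \<subseteq> {0}"
  proof
    fix x :: "real^'n" assume "x \<in> ball 0 1 \<inter> (\<lambda>x. x /\<^sub>R norm x) -` (- sphere 0 1)"
    then have "norm (x /\<^sub>R norm x) \<noteq> 1" by simp
    then show "x \<in> {0}" by (cases "x = 0") auto
  qed
  then have "emeasure lborel (ball 0 1 \<inter> (\<lambda>x::real^'n. x /\<^sub>R norm x) -` (- sphere 0 1)) \<le> emeasure lborel {0::real^'n}"
    by (intro emeasure_mono) auto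
  then show "emeasure sphere_mu (- sphere (0::real^'n) 1) = 0"
    by (subst emeasure_sphere_mu) (auto intro!: borel_closed borel_comp)
qed (auto intro!: borel_closed borel_comp)

text \<open>Radial projection commutes with \<open>R\<close>, so the claim reduces to the invariance
  of Lebesgue measure, applied to the part of the ball that projects into \<open>A\<close>.\<close>

lemma distr_sphere_mu_orthogonal:
  fixes R :: "real^'n::finite \<Rightarrow> real^'n"
  assumes R: "orthogonal_transformation R"
  shows "distr sphere_mu borel R = sphere_mu"
proof (rule measure_eqI)
  have lin: "linear R" using R by (rule orthogonal_transformation_linear)
  have [measurable]: "R \<in> borel_measurable borel"
    using lin by (intro borel_measurable_continuous_onI) (simp add: linear_continuous_on linear_linear)
  fix A assume "A \<in> sets (distr sphere_mu borel R)"
  then have A [measurable]: "A \<in> sets borel" by simp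
  have RA [measurable]: "R -` A \<in> sets borel"
    using measurable_sets[of R borel borel A] by simp
  define B where "B = ball 0 1 \<inter> (\<lambda>x. x /\<^sub>R norm x) -` A"
  have [measurable]: "(\<lambda>x::real^'n. x /\<^sub>R norm x) -` A \<in> sets borel"
    using measurable_sets[OF measurable_radial A] by simp
  have B: "B \<in> sets borel" unfolding B_def by measurable
  have "ball 0 1 \<inter> (\<lambda>x. x /\<^sub>R norm x) -` (R -` A) = R -` B"
    using R lin by (auto simp: B_def orthogonal_transformation_norm linear_cmul)
  then have "emeasure lborel (ball 0 1 \<inter> (\<lambda>x. x /\<^sub>R norm x) -` (R -` A)) = emeasure (distr lborel borel R) B"
    using B by (simp add: emeasure_distr)
  also have "\<dots> = emeasure lborel B" by (simp add: distr_lborel_orthogonal[OF R])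
  finally show "emeasure (distr sphere_mu borel R) A = emeasure sphere_mu A"
    by (simp add: emeasure_distr emeasure_sphere_mu RA B_def)
qed simp

text \<open>On \<open>sphere_mu\<close>, whose space is everything, hypotheses stated on the sphere
  hold only almost everywhere. After restriction they hold at every point of
  \<open>space smeas\<close>, and continuity on the sphere alone gives measurability and
  integrability.\<close>

definition smeas :: "(real^'n::finite) measure" where
  "smeas = restrict_space sphere_mu (sphere 0 1)"

lemma space_smeas [simp]: "space smeas = sphere (0::real^'n::finite) 1"
  by (simp add: smeas_def space_restrict_space)

lemma sets_smeas: "sets (smeas::(real^'n::finite) measure) = sets (restrict_space borel (sphere 0 1))"
  unfolding smeas_def by (intro sets_restrict_space_cong) simp

interpretation smeas: prob_space smeas
  unfolding smeas_def
proof (rule prob_space_restrict_space)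
  show "emeasure sphere_mu (sphere (0::real^'n) 1) = 1"
    using AE_sphere_mu by (intro sphere_mu.emeasure_eq_1_AE) (auto intro: borel_closed)
qed (auto intro: borel_closed)

section \<open>Integration of continuous functions over the sphere\<close>

lemma measurable_smeas_continuous:
  fixes f :: "real^'n::finite \<Rightarrow> real"
  shows "continuous_on (sphere 0 1) f \<Longrightarrow> f \<in> borel_measurable smeas"
  using borel_measurable_continuous_on_restrict[of "sphere 0 1" f]
  by (simp add: measurable_cong_sets[OF sets_smeas refl])

lemma continuous_sphere_bounded:
  fixes f :: "real^'n::finite \<Rightarrow> real"
  assumes "continuous_on (sphere 0 1) f"
  obtains B where "\<And>x. x \<in> sphere 0 1 \<Longrightarrow> \<bar>f x\<bar> \<le> B" "B > 0"
proof -
  have "bounded (f ` sphere 0 1)"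
    using assms by (intro compact_imp_bounded compact_continuous_image) auto
  then obtain B where "B > 0" "\<forall>y\<in>f ` sphere 0 1. norm y \<le> B" using bounded_pos by blast
  then show thesis using that[of B] by auto
qed

lemma integrable_smeas_continuous [intro]:
  fixes f :: "real^'n::finite \<Rightarrow> real"
  assumes "continuous_on (sphere 0 1) f"
  shows "integrable smeas f"
proof -
  obtain B where "\<And>x. x \<in> sphere 0 1 \<Longrightarrow> \<bar>f x\<bar> \<le> B" using continuous_sphere_bounded[OF assms] by blast
  then show ?thesis
    by (intro smeas.integrable_const_bound[where B = B]) (auto simp: measurable_smeas_continuous assms)
qed

lemma integral_smeas:
  fixes f :: "real^'n::finite \<Rightarrow> real"
  assumes [measurable]: "f \<in> borel_measurable borel"
  shows "(\<integral>x. f x \<partial>smeas) = (\<integral>x. f x \<partial>sphere_mu)"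
    and "integrable smeas f \<longleftrightarrow> integrable sphere_mu f"
proof -
  have [measurable]: "sphere (0::real^'n) 1 \<in> sets borel" by (simp add: borel_closed)
  have ae: "AE x in sphere_mu. indicator (sphere 0 1) x *\<^sub>R f x = f x"
    using AE_sphere_mu by eventually_elim auto
  have "(\<integral>x. f x \<partial>smeas) = (\<integral>x. indicator (sphere 0 1) x *\<^sub>R f x \<partial>sphere_mu)"
    unfolding smeas_def by (subst integral_restrict_space) auto
  also have "\<dots> = (\<integral>x. f x \<partial>sphere_mu)"
    by (intro integral_cong_AE ae) measurable
  finally show "(\<integral>x. f x \<partial>smeas) = (\<integral>x. f x \<partial>sphere_mu)" .
  have "integrable smeas f \<longleftrightarrow> integrable sphere_mu (\<lambda>x. indicator (sphere 0 1) x *\<^sub>R f x)"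
    unfolding smeas_def by (subst integrable_restrict_space) auto
  also have "\<dots> \<longleftrightarrow> integrable sphere_mu f"
    by (intro integrable_cong_AE ae) measurable
  finally show "integrable smeas f \<longleftrightarrow> integrable sphere_mu f" .
qed

lemma integral_smeas_orthogonal:
  fixes R :: "real^'n::finite \<Rightarrow> real^'n" and f :: "real^'n \<Rightarrow> real"
  assumes R: "orthogonal_transformation R" and f: "continuous_on (sphere 0 1) f"
  shows "(\<integral>x. f (R x) \<partial>smeas) = (\<integral>x. f x \<partial>smeas)"
proof -
  have [measurable]: "R \<in> borel_measurable borel"
    using R by (intro borel_measurable_continuous_onI)
      (simp add: linear_continuous_on linear_linear orthogonal_transformation_linear)
  \<comment> \<open>Continuity on the sphere does not make \<open>f\<close> Borel on the whole
    space; cutting it off does, so that \<open>integral_smeas\<close> applies.\<close>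
  define g where "g = (\<lambda>x. indicator (sphere 0 1) x *\<^sub>R f x)"
  have [measurable]: "g \<in> borel_measurable borel" unfolding g_def using f
    by (intro borel_measurable_continuous_on_indicator borel_closed) auto
  have "(\<integral>x. f (R x) \<partial>smeas) = (\<integral>x. g (R x) \<partial>smeas)"
    using R by (intro Bochner_Integration.integral_cong) (auto simp: g_def orthogonal_transformation_norm)
  also have "\<dots> = (\<integral>x. g (R x) \<partial>sphere_mu)" by (rule integral_smeas(1)) measurable
  also have "\<dots> = (\<integral>x. g x \<partial>distr sphere_mu borel R)" by (subst integral_distr) auto
  also have "\<dots> = (\<integral>x. g x \<partial>sphere_mu)" by (simp add: distr_sphere_mu_orthogonal[OF R])
  also have "\<dots> = (\<integral>x. g x \<partial>smeas)" by (rule integral_smeas(1)[symmetric]) measurable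
  also have "\<dots> = (\<integral>x. f x \<partial>smeas)"
    by (intro Bochner_Integration.integral_cong) (auto simp: g_def)
  finally show ?thesis .
qed

text \<open>Only one-sided differentiability is required at the endpoints of \<open>T\<close>, so that the rule
  also applies at the initial time of an evolution.\<close>

lemma has_real_derivative_integral:
  fixes F :: "real \<Rightarrow> 'a \<Rightarrow> real"
  assumes fin: "finite_measure M" and T: "convex T" "t \<in> T"
    and der: "\<And>s x. s \<in> T \<Longrightarrow> x \<in> space M \<Longrightarrow> ((\<lambda>s. F s x) has_real_derivative F' s x) (at s within T)"
    and int: "\<And>s. s \<in> T \<Longrightarrow> integrable M (F s)"
    and meas: "F' t \<in> borel_measurable M"
    and bound: "\<And>s x. s \<in> T \<Longrightarrow> x \<in> space M \<Longrightarrow> \<bar>F' s x\<bar> \<le> B"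
  shows "((\<lambda>s. \<integral>x. F s x \<partial>M) has_real_derivative (\<integral>x. F' t x \<partial>M)) (at t within T)"
proof -
  interpret finite_measure M by fact
  have "((\<lambda>s. ((\<integral>x. F s x \<partial>M) - (\<integral>x. F t x \<partial>M)) / (s - t)) \<longlongrightarrow> (\<integral>x. F' t x \<partial>M)) (at t within T)"
  proof (subst tendsto_at_iff_sequentially, intro allI impI)
    fix X :: "nat \<Rightarrow> real"
    assume X: "\<forall>i. X i \<in> T - {t}" and lim: "X \<longlonglongrightarrow> t"
    have "(\<lambda>n. \<integral>x. (F (X n) x - F t x) / (X n - t) \<partial>M) \<longlonglongrightarrow> (\<integral>x. F' t x \<partial>M)"
    proof (rule integral_dominated_convergence[where w = "\<lambda>_. B"])
      show "AE x in M. (\<lambda>n. (F (X n) x - F t x) / (X n - t)) \<longlonglongrightarrow> F' t x"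
      proof (rule AE_I2)
        fix x assume "x \<in> space M"
        then have "((\<lambda>s. (F s x - F t x) / (s - t)) \<longlongrightarrow> F' t x) (at t within T)"
          using der T by (simp add: has_field_derivative_iff)
        then show "(\<lambda>n. (F (X n) x - F t x) / (X n - t)) \<longlonglongrightarrow> F' t x"
          using X lim unfolding tendsto_at_iff_sequentially by (auto simp: o_def)
      qed
      show "AE x in M. norm ((F (X n) x - F t x) / (X n - t)) \<le> B" for n
      proof (rule AE_I2)
        fix x assume x: "x \<in> space M"
        \<comment> \<open>The mean value inequality on the convex set \<open>T\<close> bounds the
          difference quotients by the bound on the derivative, which gives the dominating
          constant.\<close>
        have "norm (F (X n) x - F t x) \<le> B * norm (X n - t)"
          using X T x der bound by (intro field_differentiable_bound[of T "\<lambda>s. F s x" "\<lambda>s. F' s x"]) auto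
        then show "norm ((F (X n) x - F t x) / (X n - t)) \<le> B"
          using X by (auto simp: divide_simps)
      qed
    qed (use X T int meas in \<open>auto intro!: borel_measurable_divide borel_measurable_diff\<close>)
    moreover have "(\<integral>x. (F (X n) x - F t x) / (X n - t) \<partial>M) = ((\<integral>x. F (X n) x \<partial>M) - (\<integral>x. F t x \<partial>M)) / (X n - t)" for n
    proof -
    have "(\<integral>x. F (X n) x - F t x \<partial>M) = (\<integral>x. F (X n) x \<partial>M) - (\<integral>x. F t x \<partial>M)"
      using X T int by (intro Bochner_Integration.integral_diff) auto
    then show ?thesis by simp
  qed
    ultimately show "((\<lambda>s. ((\<integral>x. F s x \<partial>M) - (\<integral>x. F t x \<partial>M)) / (s - t)) \<circ> X) \<longlonglongrightarrow> (\<integral>x. F' t x \<partial>M)"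
      unfolding o_def by (simp only:)
  qed
  then show ?thesis by (simp add: has_field_derivative_iff)
qed

section \<open>Integration by parts on the sphere\<close>

text \<open>The rotation by the angle \<open>t\<close> in the plane of the axes \<open>i\<close> and
  \<open>j\<close>, for \<open>i \<noteq> j\<close>. Written as a perturbation of the identity it is
  visibly linear in \<open>x\<close> and differentiable in \<open>t\<close>.\<close>

definition rot :: "'n \<Rightarrow> 'n \<Rightarrow> real \<Rightarrow> real^'n \<Rightarrow> real^'n::finite" where
  "rot i j t x = x + (cos t - 1) *\<^sub>R (x $ i *\<^sub>R axis i 1 + x $ j *\<^sub>R axis j 1)
                   + sin t *\<^sub>R (x $ i *\<^sub>R axis j 1 - x $ j *\<^sub>R axis i 1)"

lemma rot_0 [simp]: "rot i j 0 x = x"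
  by (simp add: rot_def)

lemma rot_nth:
  assumes "i \<noteq> j"
  shows "rot i j t x $ k = (if k = i then cos t * x $ i - sin t * x $ j
     else if k = j then cos t * x $ j + sin t * x $ i else x $ k)"
  using assms by (auto simp: rot_def axis_def algebra_simps)

lemma orthogonal_transformation_rot:
  assumes "i \<noteq> j"
  shows "orthogonal_transformation (rot i j t)"
  unfolding orthogonal_transformation_def
proof (intro conjI allI)
  show "linear (rot i j t)"
    by (rule linearI) (simp_all add: rot_def algebra_simps)
next
  fix v w :: "real^'a"
  have *: "(\<Sum>k\<in>UNIV. f k) = f i + f j + (\<Sum>k\<in>UNIV - {i, j}. f k)" for f :: "'a \<Rightarrow> real"
    using assms by (subst sum.subset_diff[of "{i, j}" UNIV f]) auto
  have "(\<Sum>k\<in>UNIV - {i, j}. rot i j t v $ k * rot i j t w $ k) = (\<Sum>k\<in>UNIV - {i, j}. v $ k * w $ k)"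
    using assms by (intro sum.cong) (auto simp: rot_nth)
  moreover have "rot i j t v $ i * rot i j t w $ i + rot i j t v $ j * rot i j t w $ j
     = v $ i * w $ i + v $ j * w $ j"
  proof -
    have "(c * a - s * b) * (c * a' - s * b') + (c * b + s * a) * (c * b' + s * a') = a * a' + b * b'"
      if "s\<^sup>2 + c\<^sup>2 = 1" for c s a b a' b' :: real
    proof -
      have "(c * a - s * b) * (c * a' - s * b') + (c * b + s * a) * (c * b' + s * a')
          = (s\<^sup>2 + c\<^sup>2) * (a * a' + b * b')"
        by (simp only: power2_eq_square) (simp add: algebra_simps)
      then show ?thesis by (simp add: that)
    qed
    from this[OF sin_cos_squared_add[of t], of "v $ i" "v $ j" "w $ i" "w $ j"] show ?thesis
      unfolding rot_nth[OF assms] using assms by (simp only: refl if_True if_False assms[symmetric])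
  qed
  ultimately have "(\<Sum>k\<in>UNIV. rot i j t v $ k * rot i j t w $ k) = (\<Sum>k\<in>UNIV. v $ k * w $ k)"
    by (simp only: *[of "\<lambda>k. rot i j t v $ k * rot i j t w $ k"] *[of "\<lambda>k. v $ k * w $ k"])
  then show "rot i j t v \<bullet> rot i j t w = v \<bullet> w"
    by (simp only: inner_vec_def inner_real_def)
qed

lemma rot_in_sphere: "i \<noteq> j \<Longrightarrow> x \<in> sphere 0 1 \<Longrightarrow> rot i j t x \<in> sphere 0 1"
  using orthogonal_transformation_rot[of i j t] by (simp add: orthogonal_transformation_norm)

lemma rot_deriv:
  assumes "i \<noteq> j"
  shows "((\<lambda>t. rot i j t x) has_vector_derivative
      (rot i j t x $ i *\<^sub>R axis j 1 - rot i j t x $ j *\<^sub>R axis i 1)) (at t)"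
proof -
  have "((\<lambda>t. rot i j t x) has_vector_derivative
      ((- sin t) *\<^sub>R (x $ i *\<^sub>R axis i 1 + x $ j *\<^sub>R axis j 1)
                   + cos t *\<^sub>R (x $ i *\<^sub>R axis j 1 - x $ j *\<^sub>R axis i 1))) (at t)"
    unfolding rot_def by (auto intro!: derivative_eq_intros)
  then show ?thesis using assms by (simp add: rot_nth algebra_simps)
qed

text \<open>\<open>LD (i, j)\<close> generates the rotations in the plane of the axes
  \<open>i\<close> and \<open>j\<close>: it differentiates along their orbits at every angle, not
  just at 0.\<close>

lemma rot_derivative_LD:
  assumes ij: "i \<noteq> j" and f: "f differentiable at (rot i j t x)"
  shows "((\<lambda>t. f (rot i j t x)) has_real_derivative LD (i, j) f (rot i j t x)) (at t)"
proof -
  let ?y = "rot i j t x"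
  let ?v = "?y $ i *\<^sub>R axis j 1 - ?y $ j *\<^sub>R axis i 1"
  have "(f has_derivative frechet_derivative f (at ?y)) (at ?y)"
    using f frechet_derivative_works by blast
  moreover have "((\<lambda>t. rot i j t x) has_derivative (\<lambda>h. h *\<^sub>R ?v)) (at t)"
    using rot_deriv[OF ij] by (simp add: has_vector_derivative_def)
  ultimately have "((\<lambda>t. f (rot i j t x)) has_derivative (\<lambda>h. frechet_derivative f (at ?y) (h *\<^sub>R ?v))) (at t)"
    using has_derivative_compose[of "\<lambda>t. rot i j t x" "\<lambda>h. h *\<^sub>R ?v" t UNIV f] by simp
  moreover have "frechet_derivative f (at ?y) (h *\<^sub>R ?v) = h * LD (i, j) f ?y" for h
  proof -
    have "linear (frechet_derivative f (at ?y))" using f by (rule linear_frechet_derivative)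
    then have "frechet_derivative f (at ?y) (h *\<^sub>R ?v) = h * frechet_derivative f (at ?y) ?v"
      by (simp only: linear_cmul real_scaleR_def)
    then show ?thesis using frechet_derivative_rotation[OF f] by simp
  qed
  moreover have "(\<lambda>h. h * LD (i, j) f ?y) = (*) (LD (i, j) f ?y)"
    by (simp add: fun_eq_iff)
  ultimately show ?thesis
    by (simp add: has_field_derivative_def)
qed

text \<open>Orbits of rotations stay on the sphere, so rotation derivatives see only the values
  there. An equation that holds on the sphere alone may thus be differentiated.\<close>

lemma LD_cong_sphere:
  assumes f: "f differentiable at x" and g: "g differentiable at x"
    and eq: "\<And>y. y \<in> sphere 0 1 \<Longrightarrow> f y = g y" and x: "x \<in> sphere 0 1"
  shows "LD a f x = LD a g x"
proof (cases a)
  case (Pair i j)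
  show ?thesis
  proof (cases "i = j")
    case False
    have "(\<lambda>t. f (rot i j t x)) = (\<lambda>t. g (rot i j t x))"
      using eq rot_in_sphere[OF False x] by (simp add: fun_eq_iff)
    moreover have "((\<lambda>t. f (rot i j t x)) has_real_derivative LD (i, j) f x) (at 0)"
      using rot_derivative_LD[OF False, of f 0 x] f by simp
    moreover have "((\<lambda>t. g (rot i j t x)) has_real_derivative LD (i, j) g x) (at 0)"
      using rot_derivative_LD[OF False, of g 0 x] g by simp
    ultimately show ?thesis using DERIV_unique Pair by metis
  qed (simp add: Pair)
qed

text \<open>Differentiability is meant in the ambient space, at points of the sphere; continuity is
  asked only of the rotation derivatives, since the radial derivative never enters.\<close>

definition C1S :: "(real^'n::finite \<Rightarrow> real) \<Rightarrow> bool" where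
  "C1S f \<longleftrightarrow> (\<forall>x\<in>sphere 0 1. f differentiable at x) \<and> (\<forall>a. continuous_on (sphere 0 1) (LD a f))"

section \<open>Calculus of C1 functions on the sphere\<close>

lemma C1S_diff [dest]: "C1S f \<Longrightarrow> x \<in> sphere 0 1 \<Longrightarrow> f differentiable at x"
  by (simp add: C1S_def)

lemma C1S_diff_norm [simp]: "C1S f \<Longrightarrow> norm x = 1 \<Longrightarrow> f differentiable at x"
  by (rule C1S_diff) simp_all

lemma C1S_cont_LD: "C1S f \<Longrightarrow> continuous_on (sphere 0 1) (LD a f)"
  unfolding C1S_def by (elim conjE allE)

lemma C1S_cont: "C1S f \<Longrightarrow> continuous_on (sphere 0 1) f"
  by (intro continuous_at_imp_continuous_on ballI differentiable_imp_continuous_within C1S_diff)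

lemma C1S_rpoly [intro]: "rpoly f \<Longrightarrow> C1S f"
  unfolding C1S_def by (intro conjI ballI allI rpoly_diff rpoly_continuous_on rpoly_LD)

lemma C1S_add [intro]:
  assumes "C1S f" "C1S g" shows "C1S (\<lambda>x. f x + g x)"
  unfolding C1S_def
proof (intro conjI ballI allI)
  fix a
  have "continuous_on (sphere 0 1) (\<lambda>x. LD a f x + LD a g x)"
    using assms by (intro continuous_intros C1S_cont_LD)
  then show "continuous_on (sphere 0 1) (LD a (\<lambda>x. f x + g x))"
    using assms by (subst continuous_on_cong[OF refl LD_add]) auto
qed (use assms in \<open>blast intro: differentiable_add differentiable_mult\<close>)

lemma C1S_mult [intro]:
  assumes "C1S f" "C1S g" shows "C1S (\<lambda>x. f x * g x)"
  unfolding C1S_def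
proof (intro conjI ballI allI)
  fix a
  have "continuous_on (sphere 0 1) (\<lambda>x. f x * LD a g x + LD a f x * g x)"
    using assms by (intro continuous_intros C1S_cont_LD C1S_cont)
  then show "continuous_on (sphere 0 1) (LD a (\<lambda>x. f x * g x))"
    using assms by (subst continuous_on_cong[OF refl LD_mult]) auto
qed (use assms in \<open>blast intro: differentiable_add differentiable_mult\<close>)

lemma C1S_compose:
  assumes f: "C1S f" and h: "\<And>x. x \<in> sphere 0 1 \<Longrightarrow> (h has_real_derivative h' (f x)) (at (f x))"
    and h': "continuous_on (f ` sphere 0 1) h'"
  shows "C1S (\<lambda>x. h (f x))"
  unfolding C1S_def
proof (intro conjI ballI allI)
  fix a
  have "continuous_on (sphere 0 1) (\<lambda>x. h' (f x) * LD a f x)"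
    using f by (intro continuous_intros C1S_cont_LD continuous_on_compose2[OF h' C1S_cont]) auto
  then show "continuous_on (sphere 0 1) (LD a (\<lambda>x. h (f x)))"
    using f h by (subst continuous_on_cong[OF refl LD_compose]) auto
next
  fix x assume "x \<in> sphere (0::real^'a) 1"
  then show "(\<lambda>x. h (f x)) differentiable at x"
  proof -
    assume x: "x \<in> sphere (0::real^'a) 1"
    obtain f' where "(f has_derivative f') (at x)"
      using C1S_diff[OF f x] unfolding differentiable_def by blast
    then have "((\<lambda>x. h (f x)) has_derivative (\<lambda>v. h' (f x) * f' v)) (at x)"
      by (rule has_derivative_compose) (use h[OF x] in \<open>simp add: has_field_derivative_def\<close>)
    then show ?thesis unfolding differentiable_def by blast
  qed
qed

lemma C1S_powr:
  assumes f: "C1S f" and pos: "\<And>x. x \<in> sphere 0 1 \<Longrightarrow> f x > 0"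
  shows "C1S (\<lambda>x. f x powr s)"
proof (rule C1S_compose[OF f, where h' = "\<lambda>r. s * r powr (s - 1)"])
  show "continuous_on (f ` sphere 0 1) (\<lambda>r. s * r powr (s - 1))"
  proof (intro continuous_intros)
    show "\<forall>r\<in>f ` sphere 0 1. r \<noteq> 0" using pos by fastforce
  qed
qed (use pos in \<open>auto intro!: derivative_eq_intros\<close>)

text \<open>By rotation invariance the integral of \<open>f\<close> composed with a rotation does
  not depend on the angle; differentiating under the integral at angle 0 gives the claim.\<close>

lemma integral_LD_eq_0:
  assumes f: "C1S f"
  shows "(\<integral>x. LD a f x \<partial>smeas) = 0"
proof (cases a)
  case (Pair i j)
  show ?thesis
  proof (cases "i = j")
    case ij: False
    obtain B where B: "\<And>x. x \<in> sphere 0 1 \<Longrightarrow> \<bar>LD (i,j) f x\<bar> \<le> B"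
      using continuous_sphere_bounded[OF C1S_cont_LD[OF f]] by blast
    have cont: "continuous_on (sphere 0 1) (rot i j s)" for s
      using orthogonal_transformation_rot[OF ij, of s]
      by (simp add: linear_continuous_on linear_linear orthogonal_transformation_linear)
    have comp: "continuous_on (sphere 0 1) (\<lambda>x. g (rot i j s x))"
      if "continuous_on (sphere 0 1) g" for g :: "real^'a \<Rightarrow> real" and s
      by (rule continuous_on_compose2[OF that cont]) (use rot_in_sphere[OF ij] in auto)
    have "((\<lambda>s. \<integral>x. f (rot i j s x) \<partial>smeas) has_real_derivative
         (\<integral>x. LD (i,j) f (rot i j 0 x) \<partial>smeas)) (at 0 within UNIV)"
    proof (rule has_real_derivative_integral[where B = B])
      show "((\<lambda>s. f (rot i j s x)) has_real_derivative LD (i,j) f (rot i j s x)) (at s within UNIV)"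
        if "x \<in> space smeas" for s x
        using that f rot_in_sphere[OF ij] by (intro rot_derivative_LD ij) auto
      show "(\<lambda>x. LD (i,j) f (rot i j 0 x)) \<in> borel_measurable smeas"
        by (intro measurable_smeas_continuous comp C1S_cont_LD f)
      show "integrable smeas (\<lambda>x. f (rot i j s x))" for s
        by (intro integrable_smeas_continuous comp C1S_cont f)
      show "\<bar>LD (i,j) f (rot i j s x)\<bar> \<le> B" if "x \<in> space smeas" for s x
        using that rot_in_sphere[OF ij] by (intro B) auto
    qed (auto simp: smeas.finite_measure_axioms)
    moreover have "(\<lambda>s. \<integral>x. f (rot i j s x) \<partial>smeas) = (\<lambda>s. \<integral>x. f x \<partial>smeas)"
      using f ij by (intro ext integral_smeas_orthogonal orthogonal_transformation_rot C1S_cont)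
    ultimately have "(\<integral>x. LD (i,j) f x \<partial>smeas) = 0"
      using DERIV_unique[OF _ DERIV_const] by simp
    then show ?thesis by (simp add: Pair)
  qed (simp add: Pair)
qed

lemma integral_LD_by_parts:
  assumes "C1S f" "C1S g"
  shows "(\<integral>x. f x * LD a g x \<partial>smeas) = - (\<integral>x. LD a f x * g x \<partial>smeas)"
proof -
  have "0 = (\<integral>x. LD a (\<lambda>x. f x * g x) x \<partial>smeas)"
    using assms by (simp add: integral_LD_eq_0 C1S_mult)
  also have "\<dots> = (\<integral>x. f x * LD a g x + LD a f x * g x \<partial>smeas)"
    using assms by (intro Bochner_Integration.integral_cong refl) (auto simp: LD_mult)
  also have "\<dots> = (\<integral>x. f x * LD a g x \<partial>smeas) + (\<integral>x. LD a f x * g x \<partial>smeas)"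
    by (intro Bochner_Integration.integral_add integrable_smeas_continuous continuous_on_mult
        C1S_cont_LD[OF assms(1)] C1S_cont_LD[OF assms(2)] C1S_cont[OF assms(1)] C1S_cont[OF assms(2)])
  finally show ?thesis by simp
qed

lemma continuous_Gam: "C1S f \<Longrightarrow> C1S g \<Longrightarrow> continuous_on (sphere 0 1) (Gam f g)"
  unfolding Gam_def[abs_def] by (intro continuous_intros C1S_cont_LD) auto

lemma integral_Lap_by_parts:
  assumes f: "C1S f" and g: "\<And>a. C1S (LD a g)"
  shows "(\<integral>x. f x * Lap g x \<partial>smeas) = - (\<integral>x. Gam f g x \<partial>smeas)"
proof -
  have int1: "integrable smeas (\<lambda>x. f x * LD a (LD a g) x / 2)" for a
    using f g by (intro integrable_smeas_continuous continuous_on_divide continuous_on_mult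
        continuous_on_const C1S_cont C1S_cont_LD) auto
  have int2: "integrable smeas (\<lambda>x. LD a f x * LD a g x / 2)" for a
    using f g by (intro integrable_smeas_continuous continuous_on_divide continuous_on_mult
        continuous_on_const C1S_cont_LD[OF f] C1S_cont[OF g]) auto
  have "(\<integral>x. f x * Lap g x \<partial>smeas) = (\<integral>x. (\<Sum>a\<in>UNIV. f x * LD a (LD a g) x / 2) \<partial>smeas)"
    by (simp add: Lap_def sum_distrib_left sum_divide_distrib)
  also have "\<dots> = (\<Sum>a\<in>UNIV. (\<integral>x. f x * LD a (LD a g) x / 2 \<partial>smeas))"
    by (rule Bochner_Integration.integral_sum) (rule int1)
  also have "\<dots> = (\<Sum>a\<in>UNIV. - (\<integral>x. LD a f x * LD a g x / 2 \<partial>smeas))"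
    by (rule sum.cong) (simp_all add: integral_LD_by_parts[OF f g])
  also have "\<dots> = - (\<Sum>a\<in>UNIV. \<integral>x. LD a f x * LD a g x / 2 \<partial>smeas)"
    by (rule sum_negf)
  also have "(\<Sum>a\<in>UNIV. \<integral>x. LD a f x * LD a g x / 2 \<partial>smeas) = (\<integral>x. (\<Sum>a\<in>UNIV. LD a f x * LD a g x / 2) \<partial>smeas)"
    by (rule Bochner_Integration.integral_sum[symmetric]) (rule int2)
  also have "\<dots> = (\<integral>x. Gam f g x \<partial>smeas)"
    by (simp add: Gam_def sum_divide_distrib)
  finally show ?thesis .
qed

lemma Gam_commute: "Gam f g x = Gam g f x"
  by (simp add: Gam_def mult.commute)

lemma Gam_self_nonneg: "Gam f f x \<ge> 0"
  unfolding Gam_def by (intro divide_nonneg_nonneg sum_nonneg) auto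

lemma Gam_mult_left:
  assumes "f differentiable at x" "g differentiable at x"
  shows "Gam (\<lambda>x. f x * g x) h x = f x * Gam g h x + g x * Gam f h x"
  by (simp add: Gam_def LD_mult assms sum_distrib_left sum.distrib algebra_simps add_divide_distrib)

lemma Gam_compose_left:
  assumes "f differentiable at x" "(h has_real_derivative h') (at (f x))"
  shows "Gam (\<lambda>x. h (f x)) g x = h' * Gam f g x"
  by (simp add: Gam_def LD_compose[OF assms] sum_distrib_left algebra_simps)

lemma Gam_powr_left:
  assumes "f differentiable at x" "f x > 0"
  shows "Gam (\<lambda>x. f x powr s) g x = s * f x powr (s - 1) * Gam f g x"
  by (rule Gam_compose_left[OF assms(1)]) (use assms(2) in \<open>auto intro!: derivative_eq_intros\<close>)

section \<open>Commutation relations and the curvature-dimension condition\<close>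

lemma sum_UNIV_pair: "(\<Sum>a\<in>UNIV. h a) = (\<Sum>i\<in>UNIV. \<Sum>j\<in>UNIV. h (i::'n::finite, j::'n))"
  by (subst UNIV_Times_UNIV[symmetric], subst sum.cartesian_product) simp

lemma sum_of_bool_eq:
  "(\<Sum>k\<in>UNIV. of_bool (k = i) * h k) = (h (i::'n::finite) :: real)"
  "(\<Sum>k\<in>UNIV. of_bool (i = k) * h k) = (h (i::'n::finite) :: real)"
  by (simp_all add: sum_of_bool_mult_eq Int_def)

lemma LD_commutator_of_bool:
  assumes "rpoly f"
  shows "LD (k, l) (LD (i, j) f) x - LD (i, j) (LD (k, l) f) x =
     of_bool (l = i) * LD (k, j) f x - of_bool (k = i) * LD (l, j) f x
   - of_bool (l = j) * LD (k, i) f x + of_bool (k = j) * LD (l, i) f x"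
  using LD_commutator[OF assms] by (auto split: if_splits)

lemma LD_combination4:
  assumes "rpoly f1" "rpoly f2" "rpoly f3" "rpoly f4"
  shows "LD a (\<lambda>x. c1 * f1 x - c2 * f2 x - c3 * f3 x + c4 * f4 x) x
    = c1 * LD a f1 x - c2 * LD a f2 x - c3 * LD a f3 x + c4 * LD a f4 x"
proof -
  have m: "rpoly (\<lambda>x. c * f x)" if "rpoly f" for c and f :: "real^'a \<Rightarrow> real"
    using that by (intro rpoly_mult) auto
  show ?thesis
    using assms m by (simp add: LD_add LD_diff LD_cmult differentiable_diff)
qed

text \<open>Up to normalisation \<open>Lap\<close> is the Casimir operator of the rotation algebra.
  Writing \<open>X\<^sup>2 Y - Y X\<^sup>2 = X [X, Y] + [X, Y] X\<close> and summing over all fields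
  \<open>X\<close>, the commutator terms cancel by the antisymmetry \<open>LD_swap\<close>.\<close>

lemma Lap_LD_commute:
  assumes f: "rpoly f"
  shows "Lap (LD a f) x = LD a (Lap f) x"
proof (cases a)
  case (Pair i j)
  have [simp]: "rpoly (LD b f)" for b using f by auto
  have [simp]: "(\<lambda>x. c * LD b f x) differentiable at x" for b x c
    using f by (intro differentiable_mult) auto
  let ?D = "\<lambda>k l x. of_bool (l = i) * LD (k, j) f x - of_bool (k = i) * LD (l, j) f x
   - of_bool (l = j) * LD (k, i) f x + of_bool (k = j) * LD (l, i) f x"
  have D: "LD (k,l) (LD (k,l) (LD (i,j) f)) x - LD (i,j) (LD (k,l) (LD (k,l) f)) x
     = of_bool (l = i) * (LD (k,l) (LD (k, j) f) x) - of_bool (k = i) * (LD (k,l) (LD (l, j) f) x)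
   - of_bool (l = j) * (LD (k,l) (LD (k, i) f) x) + of_bool (k = j) * (LD (k,l) (LD (l, i) f) x)
   + of_bool (l = i) * (LD (k,j) (LD (k, l) f) x) - of_bool (k = i) * (LD (l,j) (LD (k, l) f) x)
   - of_bool (l = j) * (LD (k,i) (LD (k, l) f) x) + of_bool (k = j) * (LD (l,i) (LD (k, l) f) x)" for k l
  proof -
    have "LD (k,l) (LD (k,l) (LD (i,j) f)) x - LD (k,l) (LD (i,j) (LD (k,l) f)) x
      = LD (k,l) (\<lambda>x. LD (k,l) (LD (i,j) f) x - LD (i,j) (LD (k,l) f) x) x"
      by (simp add: LD_diff)
    also have "\<dots> = LD (k,l) (?D k l) x"
      unfolding LD_commutator_of_bool[OF f] ..
    also have "\<dots> = of_bool (l = i) * (LD (k,l) (LD (k, j) f) x) - of_bool (k = i) * (LD (k,l) (LD (l, j) f) x)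
   - of_bool (l = j) * (LD (k,l) (LD (k, i) f) x) + of_bool (k = j) * (LD (k,l) (LD (l, i) f) x)"
      by (rule LD_combination4) (use f in auto)
    finally show ?thesis using LD_commutator_of_bool[of "LD (k,l) f" k l i j x, OF rpoly_LD[OF f]] by linarith
  qed
  have sw: "LD (j', i') = (\<lambda>f x. - LD (i', j') f x)" for i' j' :: 'a
    by (intro ext) (rule LD_swap)
  have neg: "LD b (\<lambda>x. - LD c f x) x = - LD b (LD c f) x" for b c
    by (simp add: LD_uminus)
  have "(\<Sum>k\<in>UNIV. \<Sum>l\<in>UNIV. LD (k,l) (LD (k,l) (LD (i,j) f)) x - LD (i,j) (LD (k,l) (LD (k,l) f)) x)
    = (\<Sum>k\<in>UNIV. LD (k,i) (LD (k,j) f) x - LD (i,k) (LD (k,j) f) x - LD (k,j) (LD (k,i) f) x + LD (j,k) (LD (k,i) f) x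
     + LD (k,j) (LD (k,i) f) x - LD (k,j) (LD (i,k) f) x - LD (k,i) (LD (k,j) f) x + LD (k,i) (LD (j,k) f) x)"
  proof -
    have a: "(\<Sum>k\<in>UNIV. \<Sum>l\<in>UNIV. of_bool (l = c) * F k l) = (\<Sum>k\<in>UNIV. F k c)" for F :: "'a \<Rightarrow> 'a \<Rightarrow> real" and c
      by (simp only: sum_of_bool_eq)
    have b: "(\<Sum>k\<in>UNIV. \<Sum>l\<in>UNIV. of_bool (k = c) * F k l) = (\<Sum>l\<in>UNIV. F c l)" for F :: "'a \<Rightarrow> 'a \<Rightarrow> real" and c
      by (simp only: sum_of_bool_eq flip: sum_distrib_left)
    show ?thesis
      unfolding D by (simp only: sum.distrib sum_subtractf a b)
  qed
  also have "\<dots> = 0"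
  proof (intro sum.neutral ballI)
    fix k
    have 1: "LD (i, k) = (\<lambda>f x. - LD (k, i) f x)" and 2: "LD (j, k) = (\<lambda>f x. - LD (k, j) f x)"
      by (rule sw)+
    show "LD (k,i) (LD (k,j) f) x - LD (i,k) (LD (k,j) f) x - LD (k,j) (LD (k,i) f) x + LD (j,k) (LD (k,i) f) x
     + LD (k,j) (LD (k,i) f) x - LD (k,j) (LD (i,k) f) x - LD (k,i) (LD (k,j) f) x + LD (k,i) (LD (j,k) f) x = 0"
      unfolding 1 2 neg by simp
  qed
  finally have eq: "(\<Sum>b\<in>UNIV. LD b (LD b (LD a f)) x) = (\<Sum>b\<in>UNIV. LD a (LD b (LD b f)) x)"
    by (simp add: Pair sum_UNIV_pair sum_subtractf)
  have "LD a (Lap f) x = LD a (\<lambda>x. (1/2) * (\<Sum>b\<in>UNIV. LD b (LD b f) x)) x"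
    by (simp add: Lap_def[abs_def])
  also have "\<dots> = (1/2) * (\<Sum>b\<in>UNIV. LD a (LD b (LD b f)) x)"
    using f by (subst LD_cmult) (auto simp: LD_sum intro!: differentiable_sum)
  finally show ?thesis by (simp add: eq Lap_def)
qed

section \<open>The Bochner formula for the rotation fields\<close>

lemma LD_Gam:
  assumes "rpoly f" "rpoly g"
  shows "LD a (Gam f g) x = (\<Sum>b\<in>UNIV. LD a (LD b f) x * LD b g x + LD b f x * LD a (LD b g) x) / 2"
proof -
  have d: "(\<lambda>x. LD b f x * LD b g x) differentiable at x" for b
    using assms by (intro differentiable_mult) auto
  have "LD a (Gam f g) x = LD a (\<lambda>x. (1/2) * (\<Sum>b\<in>UNIV. LD b f x * LD b g x)) x"
    by (simp add: Gam_def[abs_def])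
  also have "\<dots> = (1/2) * (\<Sum>b\<in>UNIV. LD a (\<lambda>x. LD b f x * LD b g x) x)"
    using d by (subst LD_cmult) (auto simp: LD_sum intro!: differentiable_sum)
  finally show ?thesis using assms by (simp add: LD_mult algebra_simps)
qed

text \<open>The third-order terms become \<open>Gam f (Lap f)\<close> by commuting
  \<open>Lap\<close> with the fields, so no curvature term appears here; the Ricci term emerges only
  when \<open>Gam2\<close> is bounded below.\<close>

lemma Bochner_Lap_Gam:
  assumes f: "rpoly f"
  shows "Lap (Gam f f) x = 2 * Gam f (Lap f) x + 2 * Gam2 f x"
proof -
  have pm: "rpoly (\<lambda>x. LD a (LD b f) x * LD b f x)" for a b
    using f by (intro rpoly_mult rpoly_LD)
  have LG: "LD a (Gam f f) = (\<lambda>x. \<Sum>b\<in>UNIV. LD a (LD b f) x * LD b f x)" for a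
    using f by (simp add: LD_Gam fun_eq_iff mult.commute sum_distrib_left[symmetric] flip: mult_2)
  have "LD a (LD a (Gam f f)) x
      = (\<Sum>b\<in>UNIV. LD a (LD a (LD b f)) x * LD b f x + (LD a (LD b f) x)\<^sup>2)" for a
    unfolding LG using f pm by (subst LD_sum) (auto simp: LD_mult power2_eq_square algebra_simps)
  then have "Lap (Gam f f) x = (\<Sum>a\<in>UNIV. \<Sum>b\<in>UNIV. LD a (LD a (LD b f)) x * LD b f x) / 2
      + (\<Sum>a\<in>UNIV. \<Sum>b\<in>UNIV. (LD a (LD b f) x)\<^sup>2) / 2"
    by (simp add: Lap_def sum.distrib add_divide_distrib)
  also have "(\<Sum>a\<in>UNIV. \<Sum>b\<in>UNIV. LD a (LD a (LD b f)) x * LD b f x)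
      = (\<Sum>b\<in>UNIV. \<Sum>a\<in>UNIV. LD a (LD a (LD b f)) x * LD b f x)"
    by (rule sum.swap)
  also have "\<dots> = (\<Sum>b\<in>UNIV. 2 * Lap (LD b f) x * LD b f x)"
    by (simp add: Lap_def sum_distrib_right)
  also have "\<dots> = 4 * Gam f (Lap f) x"
    by (simp add: Lap_LD_commute[OF f] Gam_def sum_distrib_left mult.commute mult.left_commute)
  finally show ?thesis by (simp add: Gam2_def)
qed

text \<open>The Binet-Cauchy identity; the factor 2 comes from summing over ordered pairs.\<close>

lemma wedge_inner:
  fixes a b c e :: "real^'n::finite"
  shows "(\<Sum>i\<in>UNIV. \<Sum>j\<in>UNIV. (a$i * b$j - a$j * b$i) * (c$i * e$j - c$j * e$i))
     = 2 * ((a \<bullet> c) * (b \<bullet> e) - (a \<bullet> e) * (b \<bullet> c))"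
proof -
  have *: "(u \<bullet> v) * (w \<bullet> z) = (\<Sum>i\<in>UNIV. \<Sum>j\<in>UNIV. (u$i * v$i) * (w$j * z$j))" for u v w z :: "real^'n"
    by (simp add: inner_vec_def sum_product)
  have 1: "(a \<bullet> c) * (b \<bullet> e) = (\<Sum>i\<in>UNIV. \<Sum>j\<in>UNIV. (a$i * c$i) * (b$j * e$j))" by (rule *)
  have 2: "(a \<bullet> c) * (b \<bullet> e) = (\<Sum>i\<in>UNIV. \<Sum>j\<in>UNIV. (b$i * e$i) * (a$j * c$j))"
    by (subst mult.commute) (rule *)
  have 3: "(a \<bullet> e) * (b \<bullet> c) = (\<Sum>i\<in>UNIV. \<Sum>j\<in>UNIV. (a$i * e$i) * (b$j * c$j))" by (rule *)
  have 4: "(a \<bullet> e) * (b \<bullet> c) = (\<Sum>i\<in>UNIV. \<Sum>j\<in>UNIV. (b$i * c$i) * (a$j * e$j))"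
    by (subst mult.commute) (rule *)
  have "2 * ((a \<bullet> c) * (b \<bullet> e) - (a \<bullet> e) * (b \<bullet> c))
    = (a \<bullet> c) * (b \<bullet> e) + (a \<bullet> c) * (b \<bullet> e) - (a \<bullet> e) * (b \<bullet> c) - (a \<bullet> e) * (b \<bullet> c)" by simp
  also have "\<dots> = (\<Sum>i\<in>UNIV. \<Sum>j\<in>UNIV. (a$i * c$i) * (b$j * e$j)) + (\<Sum>i\<in>UNIV. \<Sum>j\<in>UNIV. (b$i * e$i) * (a$j * c$j))
     - (\<Sum>i\<in>UNIV. \<Sum>j\<in>UNIV. (a$i * e$i) * (b$j * c$j)) - (\<Sum>i\<in>UNIV. \<Sum>j\<in>UNIV. (b$i * c$i) * (a$j * e$j))"
    using 1 2 3 4 by linarith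
  also have "\<dots> = (\<Sum>i\<in>UNIV. \<Sum>j\<in>UNIV. (a$i * b$j - a$j * b$i) * (c$i * e$j - c$j * e$i))"
    unfolding sum.distrib[symmetric] sum_subtractf[symmetric]
    by (intro sum.cong refl) (simp add: algebra_simps)
  finally show ?thesis ..
qed

text \<open>The wedge products \<open>p \<and> g\<close> and \<open>x \<and> s\<close> are
  orthogonal because \<open>x\<close> is orthogonal to \<open>p\<close> and to \<open>g\<close>, so
  only the two squared lengths remain.\<close>

lemma wedge_norm_orthogonal:
  fixes p g x s :: "real^'n::finite"
  assumes x: "x \<bullet> x = 1" "p \<bullet> x = 0" "s \<bullet> x = 0" "g \<bullet> x = 0"
  shows "(\<Sum>i\<in>UNIV. \<Sum>j\<in>UNIV. ((p$i * g$j - p$j * g$i) + (x$i * s$j - x$j * s$i))\<^sup>2)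
     = 2 * ((p \<bullet> p) * (g \<bullet> g) - (p \<bullet> g)\<^sup>2 + s \<bullet> s)"
proof -
  have "(\<Sum>i\<in>UNIV. \<Sum>j\<in>UNIV. ((p$i * g$j - p$j * g$i) + (x$i * s$j - x$j * s$i))\<^sup>2)
    = (\<Sum>i\<in>UNIV. \<Sum>j\<in>UNIV. (p$i * g$j - p$j * g$i) * (p$i * g$j - p$j * g$i))
    + 2 * (\<Sum>i\<in>UNIV. \<Sum>j\<in>UNIV. (p$i * g$j - p$j * g$i) * (x$i * s$j - x$j * s$i))
    + (\<Sum>i\<in>UNIV. \<Sum>j\<in>UNIV. (x$i * s$j - x$j * s$i) * (x$i * s$j - x$j * s$i))"
    unfolding sum_distrib_left sum.distrib[symmetric]
    by (intro sum.cong refl) (simp add: power2_eq_square algebra_simps)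
  then show ?thesis
    unfolding wedge_inner using x by (simp add: power2_eq_square inner_commute)
qed

text \<open>Lagrange's identity for \<open>x\<close> and the ambient gradient of
  \<open>f\<close>.\<close>

lemma Gam_eq:
  "Gam f f x = (x \<bullet> x) * ((\<chi> i. PD i f x) \<bullet> (\<chi> i. PD i f x)) - (x \<bullet> (\<chi> i. PD i f x))\<^sup>2"
proof -
  have "Gam f f x = (\<Sum>i\<in>UNIV. \<Sum>j\<in>UNIV.
     (x$i * (\<chi> i. PD i f x)$j - x$j * (\<chi> i. PD i f x)$i) * (x$i * (\<chi> i. PD i f x)$j - x$j * (\<chi> i. PD i f x)$i)) / 2"
    by (simp add: Gam_def sum_UNIV_pair LD_def)
  then show ?thesis unfolding wedge_inner by (simp add: power2_eq_square inner_commute)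
qed

lemma Gam_eq_sphere:
  assumes "norm x = 1"
  shows "Gam f f x = ((\<chi> i. PD i f x) - ((\<chi> i. PD i f x) \<bullet> x) *\<^sub>R x) \<bullet> ((\<chi> i. PD i f x) - ((\<chi> i. PD i f x) \<bullet> x) *\<^sub>R x)"
proof -
  have xx: "x \<bullet> x = 1" using assms by (simp add: norm_eq_1)
  show ?thesis
    unfolding Gam_eq inner_diff_left inner_diff_right inner_scaleR_left inner_scaleR_right xx
    by (simp add: power2_eq_square inner_commute)
qed

lemma Gam2_eq_sum_Gam: "Gam2 f x = (\<Sum>a\<in>UNIV. Gam (LD a f) (LD a f) x) / 2"
  unfolding Gam2_def Gam_def
  by (subst sum.swap) (simp add: power2_eq_square flip: sum_divide_distrib)

lemma PD_LD:
  assumes "rpoly f"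
  shows "PD m (LD (i, j) f) x = axis m 1 $ i * PD j f x + x $ i * PD m (PD j f) x
     - (axis m 1 $ j * PD i f x + x $ j * PD m (PD i f) x)"
proof -
  have [simp]: "rpoly (PD i f)" "rpoly (PD j f)" using assms by auto
  have [simp]: "(\<lambda>x. x $ m) differentiable at x" for m and x :: "real^'a" by auto
  have "PD m (LD (i, j) f) x = PD m (\<lambda>x. x $ i * PD j f x + - 1 * (x $ j * PD i f x)) x"
    by (simp add: LD_def[abs_def])
  also have "\<dots> = PD m (\<lambda>x. x $ i * PD j f x) x - PD m (\<lambda>x. x $ j * PD i f x) x"
    by (subst PD_add; (subst PD_mult)?) (auto intro!: differentiable_mult)
  finally show ?thesis
    by (simp add: PD_mult PD_coord axis_def)
qed

text \<open>For \<open>h = LD a f\<close> the value of \<open>Gam h h\<close>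
  is the squared length of the tangential part of the gradient of \<open>h\<close>; summed over \<open>a\<close> it splits
  orthogonally into \<open>p\<^sub>m \<and> \<nabla>f\<close>, which produces the Ricci term, and \<open>x \<and> s\<^sub>m\<close>, where \<open>s\<^sub>m\<close> is the
  \<open>m\<close>-th row of the covariant Hessian.\<close>

lemma curvature_dimension_sphere:
  fixes f :: "real^'n::finite \<Rightarrow> real"
  assumes f: "rpoly f" and x: "norm x = 1" and n: "CARD('n) \<ge> 2"
  shows "Gam2 f x \<ge> (real CARD('n) - 2) * Gam f f x + (Lap f x)\<^sup>2 / (real CARD('n) - 1)"
proof -
  define g :: "real^'n" where "g = (\<chi> i. PD i f x)"
  define H where "H = (\<lambda>i j. PD i (PD j f) x)"
  define e where "e = g \<bullet> x"
  define gT where "gT = g - e *\<^sub>R x"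
  define p :: "'n \<Rightarrow> real^'n" where "p = (\<lambda>m. axis m 1 - x $ m *\<^sub>R x)"
  \<comment> \<open>\<open>q m\<close> is the tangential projection of the ambient Hessian in its
    first index; \<open>s m\<close> projects the second index as well and subtracts the contribution
    of the second fundamental form of the sphere, weighted by the radial derivative
    \<open>e\<close>.\<close>
  define q :: "'n \<Rightarrow> real^'n" where "q = (\<lambda>m. \<chi> j. H m j - x $ m * (\<Sum>k\<in>UNIV. x $ k * H k j))"
  define s where "s = (\<lambda>m. q m - (q m \<bullet> x) *\<^sub>R x - e *\<^sub>R p m)"
  define tr where "tr = (\<Sum>i\<in>UNIV. H i i)"
  define xHx where "xHx = (\<Sum>i\<in>UNIV. \<Sum>j\<in>UNIV. x $ i * x $ j * H i j)"
  define N where "N = real CARD('n)"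
  have Hsym: "H i j = H j i" for i j unfolding H_def using PD_commute[OF f] by metis
  have xx: "x \<bullet> x = 1" using x by (simp add: norm_eq_1)
  then have xx': "(\<Sum>i\<in>UNIV. x $ i * x $ i) = 1" by (simp add: inner_vec_def)
  have px: "p m \<bullet> x = 0" for m by (simp add: p_def inner_diff_left xx inner_axis')
  have sx: "s m \<bullet> x = 0" for m by (simp add: s_def inner_diff_left xx px)
  have gx: "gT \<bullet> x = 0" by (simp add: gT_def inner_diff_left xx e_def)
  have e: "e = (\<Sum>i\<in>UNIV. x $ i * g $ i)" by (simp add: e_def inner_vec_def mult.commute)
  have pp: "p m \<bullet> p m = 1 - x $ m * x $ m" for m
    by (simp add: p_def inner_diff_left inner_diff_right xx inner_axis' inner_axis)
  have sum_pp: "(\<Sum>m\<in>UNIV. p m \<bullet> p m) = N - 1"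
    unfolding pp by (simp add: sum_subtractf xx' N_def)
  have pg: "p m \<bullet> gT = gT $ m" for m
    using gx by (simp add: p_def inner_diff_left inner_axis' inner_commute[of x])
  have sum_pg: "(\<Sum>m\<in>UNIV. (p m \<bullet> gT)\<^sup>2) = gT \<bullet> gT"
    unfolding pg by (simp add: inner_vec_def power2_eq_square)
  have GamT: "Gam f f x = gT \<bullet> gT"
    unfolding Gam_eq_sphere[OF x] gT_def e_def g_def ..

  have v: "((\<chi> m. PD m (LD (i,j) f) x) - ((\<chi> m. PD m (LD (i,j) f) x) \<bullet> x) *\<^sub>R x) $ m
     = (p m $ i * gT $ j - p m $ j * gT $ i) + (x $ i * s m $ j - x $ j * s m $ i)" for i j m
  proof -
    have P: "PD k (LD (i,j) f) x = axis k 1 $ i * g $ j + x $ i * H k j - (axis k 1 $ j * g $ i + x $ j * H k i)" for k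
      by (simp add: PD_LD[OF f] g_def H_def)
    have ax: "(\<Sum>k\<in>UNIV. axis k 1 $ i' * c * x $ k) = c * x $ i'" for i' c
      by (simp add: axis_def if_distrib[of "\<lambda>z. z * _"] cong: if_cong)
    have "(\<chi> m. PD m (LD (i,j) f) x) \<bullet> x = (\<Sum>k\<in>UNIV. (axis k 1 $ i * g $ j + x $ i * H k j - (axis k 1 $ j * g $ i + x $ j * H k i)) * x $ k)"
      by (simp add: inner_vec_def P)
    also have "\<dots> = (\<Sum>k\<in>UNIV. axis k 1 $ i * g $ j * x $ k) + x $ i * (\<Sum>k\<in>UNIV. x $ k * H k j)
       - (\<Sum>k\<in>UNIV. axis k 1 $ j * g $ i * x $ k) - x $ j * (\<Sum>k\<in>UNIV. x $ k * H k i)"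
      unfolding sum_distrib_left sum.distrib[symmetric] sum_subtractf[symmetric]
      by (intro sum.cong refl) (simp add: algebra_simps)
    also have "\<dots> = g $ j * x $ i + x $ i * (\<Sum>k\<in>UNIV. x $ k * H k j) - g $ i * x $ j - x $ j * (\<Sum>k\<in>UNIV. x $ k * H k i)"
      unfolding ax ..
    finally have vx: "(\<chi> m. PD m (LD (i,j) f) x) \<bullet> x
      = g $ j * x $ i + x $ i * (\<Sum>k\<in>UNIV. x $ k * H k j) - g $ i * x $ j - x $ j * (\<Sum>k\<in>UNIV. x $ k * H k i)" .
    show ?thesis
      unfolding vector_minus_component vector_scaleR_component vx
      by (simp add: P p_def gT_def s_def q_def algebra_simps)
  qed
  have "Gam2 f x = (\<Sum>i\<in>UNIV. \<Sum>j\<in>UNIV. \<Sum>m\<in>UNIV.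
      ((p m $ i * gT $ j - p m $ j * gT $ i) + (x $ i * s m $ j - x $ j * s m $ i))\<^sup>2) / 2"
  proof -
    have nv: "w \<bullet> w = (\<Sum>m\<in>UNIV. (w $ m)\<^sup>2)" for w :: "real^'n"
      by (simp add: inner_vec_def power2_eq_square)
    show ?thesis unfolding Gam2_eq_sum_Gam sum_UNIV_pair Gam_eq_sphere[OF x] nv v ..
  qed
  also have "(\<Sum>i\<in>UNIV. \<Sum>j\<in>UNIV. \<Sum>m\<in>UNIV.
      ((p m $ i * gT $ j - p m $ j * gT $ i) + (x $ i * s m $ j - x $ j * s m $ i))\<^sup>2)
    = (\<Sum>i\<in>UNIV. \<Sum>m\<in>UNIV. \<Sum>j\<in>UNIV.
      ((p m $ i * gT $ j - p m $ j * gT $ i) + (x $ i * s m $ j - x $ j * s m $ i))\<^sup>2)"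
    by (intro sum.cong refl sum.swap)
  also have "\<dots> = (\<Sum>m\<in>UNIV. \<Sum>i\<in>UNIV. \<Sum>j\<in>UNIV.
      ((p m $ i * gT $ j - p m $ j * gT $ i) + (x $ i * s m $ j - x $ j * s m $ i))\<^sup>2)"
    by (rule sum.swap)
  also have "\<dots> = (\<Sum>m\<in>UNIV. 2 * ((p m \<bullet> p m) * (gT \<bullet> gT) - (p m \<bullet> gT)\<^sup>2 + s m \<bullet> s m))"
    unfolding wedge_norm_orthogonal[OF xx px sx gx] ..
  also have "\<dots> = 2 * ((\<Sum>m\<in>UNIV. p m \<bullet> p m) * (gT \<bullet> gT) - (\<Sum>m\<in>UNIV. (p m \<bullet> gT)\<^sup>2) + (\<Sum>m\<in>UNIV. s m \<bullet> s m))"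
    unfolding sum_distrib_left[symmetric] by (simp add: sum.distrib sum_subtractf sum_distrib_right)
  \<comment> \<open>The Ricci constant \<open>N - 2\<close> of the unit sphere is the trace
    \<open>N - 1\<close> of the tangential projection minus the 1 coming from
    \<open>sum_pg\<close>.\<close>
  finally have G2: "Gam2 f x = (N - 2) * Gam f f x + (\<Sum>m\<in>UNIV. s m \<bullet> s m)"
    unfolding sum_pp sum_pg GamT by (simp add: algebra_simps)

  have "(\<Sum>i\<in>UNIV. \<Sum>j\<in>UNIV. LD (i,j) (LD (i,j) f) x)
      = (\<Sum>i\<in>UNIV. \<Sum>j\<in>UNIV. of_bool (j = i) * (x $ i * g $ j + x $ j * g $ i) - x $ j * g $ j - x $ i * g $ i
         + (x $ i * x $ i) * H j j + (x $ j * x $ j) * H i i - x $ i * x $ j * H i j - x $ i * x $ j * H i j)"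
  proof (intro sum.cong refl)
    fix i j
    show "LD (i,j) (LD (i,j) f) x = of_bool (j = i) * (x $ i * g $ j + x $ j * g $ i) - x $ j * g $ j - x $ i * g $ i
         + (x $ i * x $ i) * H j j + (x $ j * x $ j) * H i i - x $ i * x $ j * H i j - x $ i * x $ j * H i j"
      using Hsym[of i j] unfolding LD_LD[OF f] H_def g_def by (cases "i = j") (simp_all add: algebra_simps)
  qed
  also have "\<dots> = 2 * e - N * e - N * e + tr + tr - xHx - xHx"
    unfolding sum.distrib sum_subtractf sum_of_bool_eq
    by (simp add: e tr_def xHx_def N_def sum_distrib_left[symmetric] sum_distrib_right[symmetric] xx' flip: mult_2)
  finally have Lap: "Lap f x = tr - xHx - (N - 1) * e"
    unfolding Lap_def sum_UNIV_pair by (simp add: algebra_simps)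

  have sp: "s m \<bullet> p m = H m m - x $ m * (\<Sum>k\<in>UNIV. x $ k * H k m)
      - ((\<Sum>j\<in>UNIV. H m j * x $ j) - x $ m * xHx) * x $ m - e * (1 - x $ m * x $ m)" for m
  proof -
    have "q m \<bullet> x = (\<Sum>j\<in>UNIV. H m j * x $ j) - x $ m * (\<Sum>j\<in>UNIV. \<Sum>k\<in>UNIV. x $ k * x $ j * H k j)"
    proof -
      have "q m \<bullet> x = (\<Sum>j\<in>UNIV. (H m j - x $ m * (\<Sum>k\<in>UNIV. x $ k * H k j)) * x $ j)"
        by (simp add: q_def inner_vec_def)
      also have "\<dots> = (\<Sum>j\<in>UNIV. H m j * x $ j - x $ m * (\<Sum>k\<in>UNIV. x $ k * x $ j * H k j))"
        by (intro sum.cong refl) (simp add: algebra_simps sum_distrib_left)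
      finally show ?thesis by (simp add: sum_subtractf sum_distrib_left)
    qed
    also have "(\<Sum>j\<in>UNIV. \<Sum>k\<in>UNIV. x $ k * x $ j * H k j) = xHx"
      unfolding xHx_def by (rule sum.swap)
    finally have qx: "q m \<bullet> x = (\<Sum>j\<in>UNIV. H m j * x $ j) - x $ m * xHx" .
    have "s m \<bullet> p m = s m $ m"
      using sx[of m] by (simp add: p_def inner_diff_right inner_axis)
    also have "\<dots> = q m $ m - (q m \<bullet> x) * x $ m - e * (1 - x $ m * x $ m)"
      by (simp add: s_def p_def axis_def)
    finally show ?thesis unfolding qx by (simp add: q_def)
  qed
  have T: "(\<Sum>m\<in>UNIV. s m \<bullet> p m) = Lap f x"
  proof -
    have "(\<Sum>m\<in>UNIV. x $ m * (\<Sum>k\<in>UNIV. x $ k * H k m)) = xHx"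
      unfolding xHx_def sum_distrib_left by (subst sum.swap) (simp add: mult_ac)
    moreover have "(\<Sum>m\<in>UNIV. ((\<Sum>j\<in>UNIV. H m j * x $ j) - x $ m * xHx) * x $ m) = xHx - xHx"
    proof -
      have "(\<Sum>m\<in>UNIV. ((\<Sum>j\<in>UNIV. H m j * x $ j) - x $ m * xHx) * x $ m)
        = (\<Sum>m\<in>UNIV. (\<Sum>j\<in>UNIV. H m j * x $ j) * x $ m) - (\<Sum>m\<in>UNIV. x $ m * x $ m) * xHx"
        unfolding sum_distrib_right[of _ _ xHx] sum_subtractf[symmetric]
        by (intro sum.cong refl) (simp add: algebra_simps)
      also have "(\<Sum>m\<in>UNIV. (\<Sum>j\<in>UNIV. H m j * x $ j) * x $ m) = xHx"
        unfolding xHx_def sum_distrib_right by (intro sum.cong refl) (simp add: mult_ac)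
      finally show ?thesis unfolding xx' by simp
    qed
    moreover have "(\<Sum>m\<in>UNIV. e * (1 - x $ m * x $ m)) = e * (N - 1)"
      by (simp add: sum_distrib_left[symmetric] sum_subtractf xx' N_def)
    ultimately show ?thesis
      unfolding sp sum_subtractf Lap by (simp add: tr_def algebra_simps)
  qed
  have N1: "N - 1 > 0" using n by (simp add: N_def)
  \<comment> \<open>Cauchy-Schwarz between the covariant Hessian and the tangential projection,
    whose inner product is \<open>Lap f x\<close> by \<open>T\<close> and whose squared norms are
    the sum of \<open>s m \<bullet> s m\<close> and \<open>N - 1\<close>, in the form of a
    nonnegative sum of squares.\<close>
  have "0 \<le> (\<Sum>m\<in>UNIV. ((N - 1) *\<^sub>R s m - Lap f x *\<^sub>R p m) \<bullet> ((N - 1) *\<^sub>R s m - Lap f x *\<^sub>R p m))"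
    by (intro sum_nonneg) auto
  also have "\<dots> = (\<Sum>m\<in>UNIV. (N - 1)\<^sup>2 * (s m \<bullet> s m) - 2 * (N - 1) * Lap f x * (s m \<bullet> p m) + (Lap f x)\<^sup>2 * (p m \<bullet> p m))"
    by (intro sum.cong refl) (simp add: inner_diff_left inner_diff_right inner_commute power2_eq_square algebra_simps)
  also have "\<dots> = (N - 1)\<^sup>2 * (\<Sum>m\<in>UNIV. s m \<bullet> s m) - 2 * (N - 1) * Lap f x * (\<Sum>m\<in>UNIV. s m \<bullet> p m)
       + (Lap f x)\<^sup>2 * (\<Sum>m\<in>UNIV. p m \<bullet> p m)"
    by (simp add: sum.distrib sum_subtractf sum_distrib_left)
  also have "\<dots> = (N - 1) * ((N - 1) * (\<Sum>m\<in>UNIV. s m \<bullet> s m) - (Lap f x)\<^sup>2)"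
    unfolding T sum_pp by (simp add: power2_eq_square algebra_simps)
  finally have "(N - 1) * (\<Sum>m\<in>UNIV. s m \<bullet> s m) \<ge> (Lap f x)\<^sup>2"
    using N1 by (simp add: zero_le_mult_iff)
  then have "(\<Sum>m\<in>UNIV. s m \<bullet> s m) \<ge> (Lap f x)\<^sup>2 / (N - 1)"
    using N1 by (simp add: divide_simps mult.commute)
  then show ?thesis unfolding G2 N_def by simp
qed

text \<open>Apply the curvature-dimension condition to \<open>f + (c/2) (f - f x)\<^sup>2\<close>.\<close>

lemma curvature_dimension_sphere_improved:
  fixes f :: "real^'n::finite \<Rightarrow> real"
  assumes f: "rpoly f" and x: "norm x = 1" and n: "CARD('n) \<ge> 2"
  shows "Gam2 f x + c * Gam f (Gam f f) x + c\<^sup>2 * (Gam f f x)\<^sup>2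
     \<ge> (real CARD('n) - 2) * Gam f f x + (Lap f x + c * Gam f f x)\<^sup>2 / (real CARD('n) - 1)"
proof -
  \<comment> \<open>To second order at \<open>x\<close> this polynomial agrees with a function of
    \<open>f\<close> that has first derivative 1 and second derivative \<open>c\<close> at the value
    \<open>f x\<close>. A real power of \<open>f\<close> can thus be tested without leaving the
    polynomials.\<close>
  define h where "h = (\<lambda>y. f y + c / 2 * ((f y - f x) * (f y - f x)))"
  have df: "rpoly (\<lambda>y. f y - f x)" using f by (intro real_polynomial_function_diff) auto
  have df2: "rpoly (\<lambda>y. (f y - f x) * (f y - f x))" using df by (rule rpoly_mult[OF _ df])
  have h: "rpoly h" unfolding h_def using f df2 by (intro rpoly_add rpoly_mult) auto
  have L1: "LD a (\<lambda>y. f y - f x) = LD a f" for a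
    using f by (simp add: fun_eq_iff LD_diff)
  have Lh: "LD a h = (\<lambda>y. LD a f y + c * ((f y - f x) * LD a f y))" for a
  proof
    fix y
    have "LD a h y = LD a f y + c / 2 * LD a (\<lambda>y. (f y - f x) * (f y - f x)) y"
      unfolding h_def using f df2 by (subst LD_add; (subst LD_cmult)?) (auto intro!: differentiable_mult)
    also have "LD a (\<lambda>y. (f y - f x) * (f y - f x)) y = 2 * ((f y - f x) * LD a f y)"
      using df by (subst LD_mult) (auto simp: L1)
    finally show "LD a h y = LD a f y + c * ((f y - f x) * LD a f y)" by simp
  qed
  have m: "rpoly (\<lambda>y. (f y - f x) * LD a f y)" for a using f df by (intro rpoly_mult) auto
  have LLh: "LD b (LD a h) x = LD b (LD a f) x + c * (LD b f x * LD a f x)" for a b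
    unfolding Lh using f m df
    by (subst LD_add; (subst LD_cmult)?; (subst LD_mult)?) (auto intro!: differentiable_mult simp: L1)
  have Lx: "LD a h x = LD a f x" for a by (simp add: Lh)
  have G: "Gam h h x = Gam f f x" by (simp add: Gam_def Lx)
  have L: "Lap h x = Lap f x + c * Gam f f x"
    by (simp add: Lap_def LLh Gam_def sum.distrib add_divide_distrib sum_distrib_left)
  have "Gam2 h x = (\<Sum>b\<in>UNIV. \<Sum>a\<in>UNIV. (LD b (LD a f) x)\<^sup>2) / 4
      + 2 * c * (\<Sum>b\<in>UNIV. \<Sum>a\<in>UNIV. LD b (LD a f) x * (LD b f x * LD a f x)) / 4
      + c\<^sup>2 * (\<Sum>b\<in>UNIV. \<Sum>a\<in>UNIV. (LD b f x)\<^sup>2 * (LD a f x)\<^sup>2) / 4"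
    unfolding Gam2_def LLh sum_distrib_left add_divide_distrib[symmetric] sum.distrib[symmetric]
    by (simp add: power2_eq_square algebra_simps)
  also have "(\<Sum>b\<in>UNIV. \<Sum>a\<in>UNIV. (LD b f x)\<^sup>2 * (LD a f x)\<^sup>2) = 4 * (Gam f f x)\<^sup>2"
    by (simp add: sum_product[symmetric] Gam_def power2_eq_square)
  also have "(\<Sum>b\<in>UNIV. \<Sum>a\<in>UNIV. LD b (LD a f) x * (LD b f x * LD a f x)) = 2 * Gam f (Gam f f) x"
    unfolding Gam_def[of f "Gam f f"] LD_Gam[OF f f] sum_divide_distrib sum_distrib_left
    by (intro sum.cong refl) (simp add: algebra_simps)
  finally have "Gam2 h x = Gam2 f x + c * Gam f (Gam f f) x + c\<^sup>2 * (Gam f f x)\<^sup>2"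
    by (simp add: Gam2_def)
  then show ?thesis using curvature_dimension_sphere[OF h x n] by (simp add: G L)
qed

section \<open>The entropy dissipation inequality\<close>

text \<open>The variables stand for the weighted integrals of \<open>entropy_dissipation\<close>.
  Once \<open>X1\<close>, \<open>X4\<close> and \<open>X6\<close> are eliminated, \<open>P\<close>
  relates \<open>G\<close>, \<open>X2\<close>, \<open>X3\<close> and \<open>X5\<close>;
  \<open>c\<close> is the one value for which \<open>G\<close> and \<open>X2\<close> occur in the
  same proportion as in the conclusion, and the constant in front of \<open>X3\<close> is what this
  choice leaves.\<close>

lemma entropy_arith_high:
  fixes d z X1 X2 X3 X4 X5 X6 G :: real
  defines "c \<equiv> - z * (2 * d + 1) / (d + 2)"
  assumes d: "d > 1"
    and X6: "X6 = - X2 - (- 2 * z - 1) * X3"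
    and G: "2 * G + 2 * X4 = 2 * z * X6"
    and X1: "X1 = - G + 2 * z * X2"
    and P: "(d - 1) * X5 + (X1 + 2 * c * X2 + c\<^sup>2 * X3) / d \<le> X4 + c * X6 + c\<^sup>2 * X3"
  shows "- 2 * z * X2 + 2 * G \<le> - 2 * d * X5 - 2 * (z * (1 - z) * d / (d + 2) - z\<^sup>2 * (d - 1)\<^sup>2 / (d + 2)\<^sup>2) * X3"
proof -
  have G': "G = z * X6 - X4" using G by simp
  define K where "K = z * (1 - z) * d / (d + 2) - z\<^sup>2 * (d - 1)\<^sup>2 / (d + 2)\<^sup>2"
  have c: "c * (d + 2) = - z * (2 * d + 1)" unfolding c_def using d by simp
  have K: "K * (d + 2)\<^sup>2 = z * (1 - z) * d * (d + 2) - z\<^sup>2 * (d - 1)\<^sup>2"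
  proof -
    have "K * (d + 2)\<^sup>2 = (z * (1 - z) * d / (d + 2)) * (d + 2)\<^sup>2 - (z\<^sup>2 * (d - 1)\<^sup>2 / (d + 2)\<^sup>2) * (d + 2)\<^sup>2"
      unfolding K_def by (simp add: left_diff_distrib)
    also have "(z * (1 - z) * d / (d + 2)) * (d + 2)\<^sup>2 = z * (1 - z) * d * (d + 2)"
      using d by (simp add: power2_eq_square)
    finally show ?thesis using d by simp
  qed
  have "2 * (d * (X4 + c * X6 + c\<^sup>2 * X3) - d * (d - 1) * X5 - (X1 + 2 * c * X2 + c\<^sup>2 * X3)) \<ge> 0"
    using P d by (simp add: field_simps)
  \<comment> \<open>The factor \<open>d - 1\<close> that splits off is what makes this argument
    collapse on the circle.\<close>
  also have "2 * (d * (X4 + c * X6 + c\<^sup>2 * X3) - d * (d - 1) * X5 - (X1 + 2 * c * X2 + c\<^sup>2 * X3))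
     = (d - 1) * (- 2 * d * X5 - 2 * K * X3 - (- 2 * z * X2 + 2 * G))"
  proof -
    have "(d + 2)\<^sup>2 * (2 * (d * (X4 + c * X6 + c\<^sup>2 * X3) - d * (d - 1) * X5 - (X1 + 2 * c * X2 + c\<^sup>2 * X3)))
     = (d + 2)\<^sup>2 * ((d - 1) * (- 2 * d * X5 - 2 * K * X3 - (- 2 * z * X2 + 2 * G)))"
      using c K unfolding X1 G' X6 by algebra
    then show ?thesis using d by simp
  qed
  finally have "- 2 * d * X5 - 2 * K * X3 - (- 2 * z * X2 + 2 * G) \<ge> 0"
    using d by (simp add: zero_le_mult_iff)
  then show ?thesis unfolding K_def by simp
qed

text \<open>For \<open>d = 1\<close> the curvature term is absent and the terms in
  \<open>c\<^sup>2\<close> cancel, so \<open>P\<close> is affine in \<open>c\<close>; holding for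
  all \<open>c\<close>, it forces an identity between \<open>X2\<close> and \<open>X6\<close>. The
  spectral gap then enters through \<open>Q\<close>.\<close>

lemma entropy_arith_one:
  fixes z X1 X2 X3 X4 X5 X6 G :: real
  assumes X6: "X6 = - X2 - (- 2 * z - 1) * X3"
    and X1: "X1 = - G + 2 * z * X2"
    and P: "\<And>c. X1 + 2 * c * X2 + c\<^sup>2 * X3 \<le> X4 + c * X6 + c\<^sup>2 * X3"
    and Q: "X5 \<le> X1 - 2 * z * X2 + z\<^sup>2 * X3"
  shows "- 2 * z * X2 + 2 * G \<le> - 2 * X5 - 2 * (z * (1 - z) / 3) * X3"
proof -
  have "X6 = 2 * X2"
  proof (rule ccontr)
    assume "X6 \<noteq> 2 * X2"
    \<comment> \<open>With this \<open>c\<close> the inequality \<open>P\<close> would read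
      \<open>X1 \<le> X1 - 1\<close> after cancellation.\<close>
    define c where "c = (X1 - X4 - 1) / (X6 - 2 * X2)"
    have "c * (X6 - 2 * X2) = X1 - X4 - 1" unfolding c_def using \<open>X6 \<noteq> 2 * X2\<close> by simp
    then have "c * X6 = 2 * c * X2 + (X1 - X4 - 1)" by (simp add: algebra_simps)
    with P[of c] show False by linarith
  qed
  then have "X2 = (2 * z + 1) * X3 / 3" using X6 by (simp add: algebra_simps)
  then have "- 2 * z * X2 + 2 * G + 2 * X5 + 2 * (z * (1 - z) / 3) * X3 = 2 * (X5 - (X1 - 2 * z * X2 + z\<^sup>2 * X3))"
    unfolding X1 by (simp only:) (simp add: power2_eq_square field_simps)
  moreover have "a \<le> - 2 * X5 - b" if "a + 2 * X5 + b = 2 * (X5 - R)" "X5 \<le> R" for a b R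
    using that by argo
  ultimately show ?thesis using Q by blast
qed

text \<open>With \<open>z = 1 - 1 / p\<close> the weight \<open>r powr (- 2 * z)\<close> is that of
  the squared gradient of \<open>r powr (1 / p)\<close>, and the left side is the time derivative of
  the integral of \<open>r powr (- 2 * z) * Gam r r\<close> when \<open>r\<close> evolves by
  \<open>Lap r\<close>. On the circle \<open>Q\<close> supplies the spectral gap for
  \<open>r powr (1 - z)\<close>.\<close>

lemma entropy_dissipation:
  fixes r :: "real^'n::finite \<Rightarrow> real" and z :: real
  defines "d \<equiv> real (CARD('n) - 1)"
  assumes r: "rpoly r" and pos: "\<And>x. x \<in> sphere 0 1 \<Longrightarrow> r x > 0" and n: "CARD('n) \<ge> 2"
    and Q: "CARD('n) = 2 \<Longrightarrow> (\<integral>x. r x powr (- 2 * z) * Gam r r x \<partial>smeas)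
      \<le> (\<integral>x. r x powr (- 2 * z) * (Lap r x)\<^sup>2 \<partial>smeas)
         - 2 * z * (\<integral>x. r x powr (- 2 * z - 1) * (Gam r r x * Lap r x) \<partial>smeas)
         + z\<^sup>2 * (\<integral>x. r x powr (- 2 * z - 2) * (Gam r r x)\<^sup>2 \<partial>smeas)"
  shows "- 2 * z * (\<integral>x. r x powr (- 2 * z - 1) * (Gam r r x * Lap r x) \<partial>smeas)
       + 2 * (\<integral>x. r x powr (- 2 * z) * Gam r (Lap r) x \<partial>smeas)
     \<le> - 2 * d * (\<integral>x. r x powr (- 2 * z) * Gam r r x \<partial>smeas)
       - 2 * (z * (1 - z) * d / (d + 2) - z\<^sup>2 * (d - 1)\<^sup>2 / (d + 2)\<^sup>2)
         * (\<integral>x. r x powr (- 2 * z - 2) * (Gam r r x)\<^sup>2 \<partial>smeas)"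
proof -
  let ?t = "- 2 * z"
  define X1 where "X1 = (\<integral>x. r x powr ?t * (Lap r x)\<^sup>2 \<partial>smeas)"
  define X2 where "X2 = (\<integral>x. r x powr (?t - 1) * (Gam r r x * Lap r x) \<partial>smeas)"
  define X3 where "X3 = (\<integral>x. r x powr (?t - 2) * (Gam r r x)\<^sup>2 \<partial>smeas)"
  define X4 where "X4 = (\<integral>x. r x powr ?t * Gam2 r x \<partial>smeas)"
  define X5 where "X5 = (\<integral>x. r x powr ?t * Gam r r x \<partial>smeas)"
  define X6 where "X6 = (\<integral>x. r x powr (?t - 1) * Gam r (Gam r r) x \<partial>smeas)"
  define G where "G = (\<integral>x. r x powr ?t * Gam r (Lap r) x \<partial>smeas)"
  have int: "integrable smeas (\<lambda>x. r x powr s * q x)" if "rpoly q" for s q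
    using that r pos
    by (intro integrable_smeas_continuous continuous_on_mult C1S_cont[OF C1S_powr] rpoly_continuous_on C1S_rpoly)
  have polys: "rpoly (Lap r)" "rpoly (Gam r r)" "rpoly (Gam2 r)" "rpoly (Gam r (Gam r r))" "rpoly (Gam r (Lap r))"
    using r by auto
  have polys2: "rpoly (\<lambda>x. Gam r r x * Lap r x)" "rpoly (\<lambda>x. (Lap r x)\<^sup>2)" "rpoly (\<lambda>x. (Gam r r x)\<^sup>2)"
    using polys by (auto intro!: rpoly_mult real_polynomial_function_power)
  have C1w: "C1S (\<lambda>x. r x powr s)" for s using r pos by (intro C1S_powr C1S_rpoly)
  have C1L: "C1S (LD a q)" if "rpoly q" for a q using that by (intro C1S_rpoly rpoly_LD)
  have dw: "(\<lambda>x. r x powr s) differentiable at x" if "x \<in> sphere 0 1" for s x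
    using C1w that by auto

  \<comment> \<open>Integrating by parts against \<open>Lap r\<close> twice and against the Bochner
    formula once expresses \<open>X1\<close>, \<open>X4\<close> and \<open>X6\<close> through
    \<open>G\<close>, \<open>X2\<close> and \<open>X3\<close>.\<close>
  have X6: "X6 = - X2 - (?t - 1) * X3"
  proof -
    have "X2 = (\<integral>x. (r x powr (?t - 1) * Gam r r x) * Lap r x \<partial>smeas)"
      unfolding X2_def by (simp add: mult.assoc)
    also have "\<dots> = - (\<integral>x. Gam (\<lambda>x. r x powr (?t - 1) * Gam r r x) r x \<partial>smeas)"
      by (intro integral_Lap_by_parts C1S_mult C1w C1S_rpoly[OF polys(2)] C1L r)
    also have "(\<integral>x. Gam (\<lambda>x. r x powr (?t - 1) * Gam r r x) r x \<partial>smeas)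
       = (\<integral>x. r x powr (?t - 1) * Gam r (Gam r r) x + (?t - 1) * (r x powr (?t - 2) * (Gam r r x)\<^sup>2) \<partial>smeas)"
    proof (intro Bochner_Integration.integral_cong refl)
      fix x :: "real^'n" assume "x \<in> space smeas"
      then have x: "x \<in> sphere 0 1" by simp
      have "Gam (\<lambda>x. r x powr (?t - 1) * Gam r r x) r x
          = r x powr (?t - 1) * Gam (Gam r r) r x + Gam r r x * ((?t - 1) * r x powr (?t - 2) * Gam r r x)"
      proof -
        have e: "?t - 1 - 1 = ?t - 2" by simp
        show ?thesis
          unfolding Gam_mult_left[OF dw[OF x] rpoly_diff[OF polys(2)]] Gam_powr_left[OF rpoly_diff[OF r] pos[OF x]] e ..
      qed
      then show "Gam (\<lambda>x. r x powr (?t - 1) * Gam r r x) r x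
          = r x powr (?t - 1) * Gam r (Gam r r) x + (?t - 1) * (r x powr (?t - 2) * (Gam r r x)\<^sup>2)"
        by (simp add: Gam_commute[of _ "Gam r r"] power2_eq_square)
    qed
    also have "\<dots> = X6 + (?t - 1) * X3"
      unfolding X6_def X3_def
      using int[OF polys(4), of "?t - 1"] int[OF polys2(3), of "?t - 2"]
      by (subst Bochner_Integration.integral_add) auto
    finally show ?thesis by simp
  qed
  have X1: "X1 = - G - ?t * X2"
  proof -
    have "X1 = (\<integral>x. (r x powr ?t * Lap r x) * Lap r x \<partial>smeas)"
      unfolding X1_def by (simp add: mult.assoc power2_eq_square)
    also have "\<dots> = - (\<integral>x. Gam (\<lambda>x. r x powr ?t * Lap r x) r x \<partial>smeas)"
      by (intro integral_Lap_by_parts C1S_mult C1w C1S_rpoly[OF polys(1)] C1L r)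
    also have "(\<integral>x. Gam (\<lambda>x. r x powr ?t * Lap r x) r x \<partial>smeas)
       = (\<integral>x. r x powr ?t * Gam r (Lap r) x + ?t * (r x powr (?t - 1) * (Gam r r x * Lap r x)) \<partial>smeas)"
    proof (intro Bochner_Integration.integral_cong refl)
      fix x :: "real^'n" assume "x \<in> space smeas"
      then have x: "x \<in> sphere 0 1" by simp
      show "Gam (\<lambda>x. r x powr ?t * Lap r x) r x
          = r x powr ?t * Gam r (Lap r) x + ?t * (r x powr (?t - 1) * (Gam r r x * Lap r x))"
        unfolding Gam_mult_left[OF dw[OF x] rpoly_diff[OF polys(1)]] Gam_powr_left[OF rpoly_diff[OF r] pos[OF x]]
          Gam_commute[of "Lap r" r] by (simp add: mult_ac)
    qed
    also have "\<dots> = G + ?t * X2"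
      unfolding G_def X2_def
      using int[OF polys(5), of ?t] int[OF polys2(1), of "?t - 1"]
      by (subst Bochner_Integration.integral_add) auto
    finally show ?thesis by simp
  qed
  have GX4: "2 * G + 2 * X4 = - ?t * X6"
  proof -
    have "2 * G + 2 * X4 = (\<integral>x. 2 * (r x powr ?t * Gam r (Lap r) x) + 2 * (r x powr ?t * Gam2 r x) \<partial>smeas)"
      unfolding G_def X4_def
      using int[OF polys(5), of ?t] int[OF polys(3), of ?t]
      by (subst Bochner_Integration.integral_add) auto
    also have "\<dots> = (\<integral>x. r x powr ?t * Lap (Gam r r) x \<partial>smeas)"
      by (simp add: Bochner_Lap_Gam[OF r] algebra_simps)
    also have "\<dots> = - (\<integral>x. Gam (\<lambda>x. r x powr ?t) (Gam r r) x \<partial>smeas)"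
      by (intro integral_Lap_by_parts C1w C1L polys)
    also have "(\<integral>x. Gam (\<lambda>x. r x powr ?t) (Gam r r) x \<partial>smeas) = (\<integral>x. ?t * (r x powr (?t - 1) * Gam r (Gam r r) x) \<partial>smeas)"
      using r pos by (intro Bochner_Integration.integral_cong refl) (simp add: Gam_powr_left)
    also have "\<dots> = ?t * X6" by (simp add: X6_def)
    finally show ?thesis by simp
  qed
  \<comment> \<open>The pointwise inequality is used with the parameter \<open>c / r x\<close>,
    which amounts to testing the curvature-dimension condition on a power of \<open>r\<close> with
    exponent \<open>c + 1\<close> (on the logarithm if \<open>c = - 1\<close>).\<close>
  have P: "(d - 1) * X5 + (X1 + 2 * c * X2 + c\<^sup>2 * X3) / d \<le> X4 + c * X6 + c\<^sup>2 * X3" for c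
  proof -
    have i1: "integrable smeas (\<lambda>x. (d - 1) * (r x powr ?t * Gam r r x))"
      "integrable smeas (\<lambda>x. (r x powr ?t * (Lap r x)\<^sup>2) / d)"
      "integrable smeas (\<lambda>x. (2 * c / d) * (r x powr (?t - 1) * (Gam r r x * Lap r x)))"
      "integrable smeas (\<lambda>x. (c\<^sup>2 / d) * (r x powr (?t - 2) * (Gam r r x)\<^sup>2))"
      "integrable smeas (\<lambda>x. r x powr ?t * Gam2 r x)"
      "integrable smeas (\<lambda>x. c * (r x powr (?t - 1) * Gam r (Gam r r) x))"
      "integrable smeas (\<lambda>x. c\<^sup>2 * (r x powr (?t - 2) * (Gam r r x)\<^sup>2))"
      using int[OF polys(2), of ?t] int[OF polys2(2), of ?t] int[OF polys2(1), of "?t - 1"]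
        int[OF polys2(3), of "?t - 2"] int[OF polys(3), of ?t] int[OF polys(4), of "?t - 1"]
      by auto
    have "(d - 1) * X5 + (X1 + 2 * c * X2 + c\<^sup>2 * X3) / d
      = (\<integral>x. (d - 1) * (r x powr ?t * Gam r r x) + ((r x powr ?t * (Lap r x)\<^sup>2) / d
          + (2 * c / d) * (r x powr (?t - 1) * (Gam r r x * Lap r x)) + (c\<^sup>2 / d) * (r x powr (?t - 2) * (Gam r r x)\<^sup>2)) \<partial>smeas)"
      using i1 by (simp add: X1_def X2_def X3_def X5_def add_divide_distrib)
    also have "\<dots> \<le> (\<integral>x. r x powr ?t * Gam2 r x + c * (r x powr (?t - 1) * Gam r (Gam r r) x)
          + c\<^sup>2 * (r x powr (?t - 2) * (Gam r r x)\<^sup>2) \<partial>smeas)"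
    proof (intro Bochner_Integration.integral_mono Bochner_Integration.integrable_add i1)
      fix x :: "real^'n" assume "x \<in> space smeas"
      then have x: "x \<in> sphere 0 1" "norm x = 1" by simp_all
      define w where "w = r x powr ?t"
      have w: "w \<ge> 0" by (simp add: w_def)
      have "?t - 1 = ?t + - 1" "?t - 2 = ?t + - 2" by simp_all
      then have w1: "r x powr (?t - 1) = w / r x" "r x powr (?t - 2) = w / (r x)\<^sup>2"
        using pos[OF x(1)] unfolding w_def powr_add powr_diff
        by (simp_all add: powr_minus_divide powr_numeral powr_minus divide_simps)
      have "w * ((d - 1) * Gam r r x + (Lap r x + c / r x * Gam r r x)\<^sup>2 / d)
          \<le> w * (Gam2 r x + (c / r x) * Gam r (Gam r r) x + (c / r x)\<^sup>2 * (Gam r r x)\<^sup>2)"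
        using curvature_dimension_sphere_improved[OF r x(2) n, of "c / r x"] n
        by (intro mult_left_mono w) (simp add: d_def of_nat_diff)
      then show "(d - 1) * (r x powr ?t * Gam r r x) + ((r x powr ?t * (Lap r x)\<^sup>2) / d
          + (2 * c / d) * (r x powr (?t - 1) * (Gam r r x * Lap r x)) + (c\<^sup>2 / d) * (r x powr (?t - 2) * (Gam r r x)\<^sup>2))
          \<le> r x powr ?t * Gam2 r x + c * (r x powr (?t - 1) * Gam r (Gam r r) x)
          + c\<^sup>2 * (r x powr (?t - 2) * (Gam r r x)\<^sup>2)"
        unfolding w1 w_def[symmetric]
        by (simp add: power2_eq_square add_divide_distrib algebra_simps)
    qed
    also have "\<dots> = X4 + c * X6 + c\<^sup>2 * X3"
      using i1 by (simp add: X4_def X6_def X3_def)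
    finally show ?thesis .
  qed
  have "- 2 * z * X2 + 2 * G \<le> - 2 * d * X5 - 2 * (z * (1 - z) * d / (d + 2) - z\<^sup>2 * (d - 1)\<^sup>2 / (d + 2)\<^sup>2) * X3"
  proof (cases "CARD('n) = 2")
    case True
    then have d1: "d = 1" by (simp add: d_def)
    have "X5 \<le> X1 - 2 * z * X2 + z\<^sup>2 * X3"
      using Q[OF True] by (simp add: X1_def X2_def X3_def X5_def)
    then have "- 2 * z * X2 + 2 * G \<le> - 2 * X5 - 2 * (z * (1 - z) / 3) * X3"
      using X6 X1 P unfolding d1 by (intro entropy_arith_one[of X6 X2 z X3 X1 G X4 X5]) auto
    then show ?thesis unfolding d1 by simp
  next
    case False
    then have "d > 1" using n by (auto simp: d_def)
    moreover have "X1 = - G + 2 * z * X2" "2 * G + 2 * X4 = 2 * z * X6" using X1 GX4 by simp_all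
    ultimately show ?thesis using X6 P by (intro entropy_arith_high)
  qed
  then show ?thesis unfolding X2_def G_def X5_def X3_def .
qed

section \<open>Zonal kernels and their spectral decomposition\<close>

text \<open>Finite sums of products \<open>p x * q y\<close>. For such kernels the integral in
  \<open>y\<close> is a polynomial in \<open>x\<close>, and differentiation under the integral sign
  needs nothing but linearity.\<close>

inductive sep :: "(real^'n::finite \<Rightarrow> real^'n \<Rightarrow> real) \<Rightarrow> bool" where
  sep_prod: "rpoly p \<Longrightarrow> rpoly q \<Longrightarrow> sep (\<lambda>x y. p x * q y)"
| sep_add: "sep K \<Longrightarrow> sep L \<Longrightarrow> sep (\<lambda>x y. K x y + L x y)"

lemma sep_const: "sep (\<lambda>x y. c)"
  using sep_prod[of "\<lambda>x. c" "\<lambda>x. 1"] by auto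

lemma sep_sum: "finite I \<Longrightarrow> (\<And>i. i \<in> I \<Longrightarrow> sep (K i)) \<Longrightarrow> sep (\<lambda>x y. \<Sum>i\<in>I. K i x y)"
  by (induction I rule: finite_induct) (auto intro: sep_add sep_const)

lemma sep_mult:
  assumes "sep K" "sep L" shows "sep (\<lambda>x y. K x y * L x y)"
  using assms(1)
proof induction
  case (sep_prod p q)
  from assms(2) show ?case
  proof induction
    case (sep_prod p' q')
    have "sep (\<lambda>x y. (p x * p' x) * (q y * q' y))"
      using \<open>rpoly p\<close> \<open>rpoly q\<close> sep_prod by (intro sep.sep_prod rpoly_mult)
    then show ?case by (simp add: mult_ac)
  next
    case (sep_add K L)
    from sep.sep_add[OF sep_add.IH] show ?case by (simp add: algebra_simps)
  qed
next
  case (sep_add K1 K2)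
  from sep.sep_add[OF sep_add.IH] show ?case by (simp add: algebra_simps)
qed

lemma sep_inner: "sep (\<lambda>x y. x \<bullet> y)"
  unfolding inner_vec_def by (intro sep_sum) (auto intro!: sep_prod)

lemma sep_poly_inner: "sep (\<lambda>x y. poly q (x \<bullet> y))"
  by (induction q) (auto intro!: sep_add sep_mult sep_const sep_inner)

lemma sep_rpoly_left: "sep K \<Longrightarrow> rpoly (\<lambda>x. K x y)"
  by (induction rule: sep.induct) (auto intro!: rpoly_add rpoly_mult)

lemma sep_rpoly_right: "sep K \<Longrightarrow> rpoly (K x)"
  by (induction rule: sep.induct) (auto intro!: rpoly_add rpoly_mult)

lemma sep_LD: "sep K \<Longrightarrow> sep (\<lambda>x y. LD a (\<lambda>x. K x y) x)"
proof (induction rule: sep.induct)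
  case (sep_prod p q)
  have "(\<lambda>x y. LD a (\<lambda>x. p x * q y) x) = (\<lambda>x y. LD a p x * q y)"
    using sep_prod by (simp add: LD_mult fun_eq_iff)
  then show ?case using sep_prod by (auto intro: sep.sep_prod)
next
  case (sep_add K L)
  have "(\<lambda>x y. LD a (\<lambda>x. K x y + L x y) x) = (\<lambda>x y. LD a (\<lambda>x. K x y) x + LD a (\<lambda>x. L x y) x)"
    using sep_rpoly_left sep_add by (intro ext LD_add) auto
  then show ?case using sep.sep_add[OF sep_add.IH] by simp
qed

lemma integrable_sep:
  assumes "sep K" "continuous_on (sphere 0 1) f"
  shows "integrable smeas (\<lambda>y. f y * K x y)"
  by (intro integrable_smeas_continuous continuous_on_mult assms(2) rpoly_continuous_on sep_rpoly_right[OF assms(1)])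

lemma integral_sep:
  assumes "sep K" and f: "continuous_on (sphere 0 1) f"
  shows "rpoly (\<lambda>x. \<integral>y. f y * K x y \<partial>smeas)"
    and "LD a (\<lambda>x. \<integral>y. f y * K x y \<partial>smeas) x = (\<integral>y. f y * LD a (\<lambda>x. K x y) x \<partial>smeas)"
proof -
  have "rpoly (\<lambda>x. \<integral>y. f y * K x y \<partial>smeas) \<and>
     LD a (\<lambda>x. \<integral>y. f y * K x y \<partial>smeas) x = (\<integral>y. f y * LD a (\<lambda>x. K x y) x \<partial>smeas)"
    using assms(1)
  proof induction
    case (sep_prod p q)
    have *: "(\<integral>y. f y * (c * q y) \<partial>smeas) = c * (\<integral>y. f y * q y \<partial>smeas)" for c
      by (subst integral_mult_right_zero[symmetric]) (simp add: mult_ac)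
    have "(\<integral>y. f y * LD a (\<lambda>x. p x * q y) x \<partial>smeas) = LD a p x * (\<integral>y. f y * q y \<partial>smeas)"
      using sep_prod by (simp add: LD_mult *)
    then show ?case
      using sep_prod unfolding * by (auto simp: LD_mult intro!: rpoly_mult)
  next
    case (sep_add K L)
    have *: "(\<integral>y. f y * (K x y + L x y) \<partial>smeas) = (\<integral>y. f y * K x y \<partial>smeas) + (\<integral>y. f y * L x y \<partial>smeas)" for x
      unfolding distrib_left
      by (intro Bochner_Integration.integral_add integrable_sep f sep_add)
    have "(\<integral>y. f y * LD a (\<lambda>x. K x y + L x y) x \<partial>smeas)
       = (\<integral>y. f y * LD a (\<lambda>x. K x y) x + f y * LD a (\<lambda>x. L x y) x \<partial>smeas)"
      using sep_add(1,2)[THEN sep_rpoly_left] by (simp add: LD_add distrib_left)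
    also have "\<dots> = (\<integral>y. f y * LD a (\<lambda>x. K x y) x \<partial>smeas) + (\<integral>y. f y * LD a (\<lambda>x. L x y) x \<partial>smeas)"
      using integrable_sep[OF sep_LD f] sep_add(1,2) by (intro Bochner_Integration.integral_add) auto
    finally show ?case
      using sep_add unfolding * by (auto simp: LD_add)
  qed
  then show "rpoly (\<lambda>x. \<integral>y. f y * K x y \<partial>smeas)"
    and "LD a (\<lambda>x. \<integral>y. f y * K x y \<partial>smeas) x = (\<integral>y. f y * LD a (\<lambda>x. K x y) x \<partial>smeas)" by auto
qed

section \<open>Zonal convolutions\<close>

definition zonal :: "real poly \<Rightarrow> (real^'n \<Rightarrow> real) \<Rightarrow> real^'n::finite \<Rightarrow> real" where
  "zonal q f x = (\<integral>y. f y * poly q (x \<bullet> y) \<partial>smeas)"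

lemma rpoly_zonal [simp, intro]: "continuous_on (sphere 0 1) f \<Longrightarrow> rpoly (zonal q f)"
  unfolding zonal_def[abs_def] by (rule integral_sep(1)[OF sep_poly_inner])

lemma zonal_sum:
  assumes f: "continuous_on (sphere 0 1) f" and "finite I"
  shows "zonal (\<Sum>i\<in>I. q i) f x = (\<Sum>i\<in>I. zonal (q i) f x)"
  unfolding zonal_def poly_sum sum_distrib_left
  by (rule Bochner_Integration.integral_sum) (rule integrable_sep[OF sep_poly_inner f])

lemma zonal_smult: "zonal (smult c q) f x = c * zonal q f x"
  unfolding zonal_def by (subst integral_mult_right_zero[symmetric]) (simp add: mult_ac)

lemma zonal_const: "zonal [:c:] f x = c * (\<integral>y. f y \<partial>smeas)"
  by (simp add: zonal_def mult.commute)

lemma rpoly_inner_left: "rpoly (\<lambda>x::real^'n::finite. x \<bullet> y)"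
  by (rule sep_rpoly_left[OF sep_inner])

lemma LD_inner_left: "LD (i, j) (\<lambda>x. x \<bullet> y) x = x $ i * y $ j - x $ j * y $ i"
  by (simp add: LD_def PD_linear bounded_linear_inner_left inner_axis')

lemma LD_poly_inner_left:
  "LD (i, j) (\<lambda>x. poly q (x \<bullet> y)) x = poly (pderiv q) (x \<bullet> y) * (x $ i * y $ j - x $ j * y $ i)"
  by (subst LD_compose[OF rpoly_diff[OF rpoly_inner_left] poly_DERIV]) (simp add: LD_inner_left)

text \<open>The kernel is invariant under simultaneous rotations of both arguments.\<close>

lemma LD_zonal:
  assumes f: "C1S f"
  shows "LD a (zonal q f) x = zonal q (LD a f) x"
proof (cases a)
  case (Pair i j)
  have sw: "LD a (\<lambda>x. poly q (x \<bullet> y)) x = - LD a (\<lambda>y. poly q (x \<bullet> y)) y" for y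
    unfolding Pair LD_poly_inner_left
    using LD_poly_inner_left[of i j q x y] by (simp add: inner_commute algebra_simps)
  have "LD a (zonal q f) x = (\<integral>y. f y * LD a (\<lambda>x. poly q (x \<bullet> y)) x \<partial>smeas)"
    unfolding zonal_def[abs_def] by (rule integral_sep(2)[OF sep_poly_inner C1S_cont[OF f]])
  also have "\<dots> = - (\<integral>y. f y * LD a (\<lambda>y. poly q (x \<bullet> y)) y \<partial>smeas)"
    unfolding sw by simp
  also have "\<dots> = (\<integral>y. LD a f y * poly q (x \<bullet> y) \<partial>smeas)"
    using integral_LD_by_parts[OF f C1S_rpoly[OF sep_rpoly_right[OF sep_poly_inner]], of a q x] by simp
  finally show ?thesis by (simp add: zonal_def)
qed

text \<open>The Gegenbauer operator \<open>(1 - s\<^sup>2) q'' - d s q'\<close>, which is the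
  spherical Laplacian acting on functions of \<open>s = x \<bullet> y\<close>.\<close>

definition zonal_op :: "real \<Rightarrow> real poly \<Rightarrow> real poly" where
  "zonal_op d q = [:1, 0, -1:] * pderiv (pderiv q) - smult d ([:0, 1:] * pderiv q)"

lemma Lap_poly_inner:
  fixes x y :: "real^'n::finite"
  assumes x: "norm x = 1" and y: "norm y = 1"
  shows "Lap (\<lambda>x. poly q (x \<bullet> y)) x = poly (zonal_op (real CARD('n) - 1) q) (x \<bullet> y)"
proof -
  let ?s = "x \<bullet> y"
  have xx: "x \<bullet> x = 1" "y \<bullet> y = 1" using x y by (simp_all add: norm_eq_1)
  have L2: "LD (i, j) (LD (i, j) (\<lambda>x. poly q (x \<bullet> y))) x
     = poly (pderiv (pderiv q)) ?s * ((x $ i * y $ j - x $ j * y $ i) * (x $ i * y $ j - x $ j * y $ i))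
     + poly (pderiv q) ?s * (of_bool (j = i) * (2 * x $ i * y $ i) - x $ i * y $ i - x $ j * y $ j)" for i j
  proof -
    have LL: "LD (i,j) (\<lambda>x. x $ i * y $ j - x $ j * y $ i) x
       = of_bool (j = i) * (2 * x $ i * y $ i) - x $ i * y $ i - x $ j * y $ j"
    proof -
      have "LD (i,j) (\<lambda>x. x $ i * y $ j - x $ j * y $ i) x
        = LD (i,j) (\<lambda>x. y $ j * x $ i - y $ i * x $ j) x" by (simp add: mult.commute)
      also have "\<dots> = y $ j * LD (i,j) (\<lambda>x. x $ i) x - y $ i * LD (i,j) (\<lambda>x. x $ j) x"
        by (subst LD_diff) (auto simp: LD_cmult rpoly_diff rpoly_coord intro!: differentiable_mult)
      finally show ?thesis by (cases "i = j") (simp_all add: LD_coord)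
    qed
    have pl: "rpoly (\<lambda>x. x $ i * y $ j - x $ j * y $ i)"
      by (intro real_polynomial_function_diff rpoly_mult rpoly_coord rpoly_const)
    have "LD (i, j) (LD (i, j) (\<lambda>x. poly q (x \<bullet> y))) x
      = LD (i, j) (\<lambda>x. poly (pderiv q) (x \<bullet> y) * (x $ i * y $ j - x $ j * y $ i)) x"
      by (simp add: LD_poly_inner_left[abs_def])
    also have "\<dots> = poly (pderiv q) ?s * LD (i,j) (\<lambda>x. x $ i * y $ j - x $ j * y $ i) x
       + LD (i,j) (\<lambda>x. poly (pderiv q) (x \<bullet> y)) x * (x $ i * y $ j - x $ j * y $ i)"
      using rpoly_diff[OF sep_rpoly_left[OF sep_poly_inner]] rpoly_diff[OF pl] by (rule LD_mult)
    finally show ?thesis unfolding LL LD_poly_inner_left by (simp add: mult_ac)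
  qed
  have "(\<Sum>i\<in>UNIV. \<Sum>j\<in>UNIV. of_bool (j = i) * (2 * x $ i * y $ i) - x $ i * y $ i - x $ j * y $ j)
     = 2 * ?s - real CARD('n) * ?s - real CARD('n) * ?s"
    unfolding sum_subtractf sum_of_bool_eq
    by (simp add: inner_vec_def sum_distrib_left mult.assoc)
  then have "Lap (\<lambda>x. poly q (x \<bullet> y)) x
    = (poly (pderiv (pderiv q)) ?s * (2 * (1 - ?s * ?s)) + poly (pderiv q) ?s * (2 * ?s - real CARD('n) * ?s - real CARD('n) * ?s)) / 2"
    unfolding Lap_def sum_UNIV_pair L2 sum.distrib sum_distrib_left[symmetric] wedge_inner
    by (simp add: xx inner_commute)
  then show ?thesis by (simp add: zonal_op_def algebra_simps)
qed

lemma Lap_zonal: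
  fixes f :: "real^'n::finite \<Rightarrow> real"
  assumes f: "continuous_on (sphere 0 1) f" and x: "x \<in> sphere 0 1"
  shows "Lap (zonal q f) x = zonal (zonal_op (real CARD('n) - 1) q) f x"
proof -
  have L: "LD a (zonal q f) = (\<lambda>x. \<integral>y. f y * LD a (\<lambda>x. poly q (x \<bullet> y)) x \<partial>smeas)" for a
    unfolding zonal_def[abs_def] by (intro ext integral_sep(2)[OF sep_poly_inner f])
  have "Lap (zonal q f) x = (\<Sum>a\<in>UNIV. (\<integral>y. f y * LD a (LD a (\<lambda>x. poly q (x \<bullet> y))) x / 2 \<partial>smeas))"
    unfolding Lap_def L integral_sep(2)[OF sep_LD[OF sep_poly_inner] f] by (simp add: sum_divide_distrib)
  also have "\<dots> = (\<integral>y. (\<Sum>a\<in>UNIV. f y * LD a (LD a (\<lambda>x. poly q (x \<bullet> y))) x / 2) \<partial>smeas)"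
    using integrable_sep[OF sep_LD[OF sep_LD[OF sep_poly_inner]] f]
    by (intro Bochner_Integration.integral_sum[symmetric]) auto
  also have "\<dots> = (\<integral>y. f y * Lap (\<lambda>x. poly q (x \<bullet> y)) x \<partial>smeas)"
    by (simp add: Lap_def sum_distrib_left sum_divide_distrib)
  also have "\<dots> = zonal (zonal_op (real CARD('n) - 1) q) f x"
    unfolding zonal_def using x by (intro Bochner_Integration.integral_cong refl) (simp add: Lap_poly_inner)
  finally show ?thesis .
qed

text \<open>The eigenvalue of \<open>- Lap\<close> on spherical harmonics of degree
  \<open>j\<close>.\<close>

definition eigen :: "real \<Rightarrow> nat \<Rightarrow> real" where
  "eigen d j = real j * (real j + d - 1)"

section \<open>Decomposition of polynomials into eigenfunctions of the Gegenbauer operator\<close>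

lemma eigen_mono:
  assumes "d > 0" "i < j" shows "eigen d i < eigen d j"
proof -
  have "real i + 1 \<le> real j" using assms by linarith
  then have "eigen d j - eigen d i = (real j - real i) * (real i + real j + d - 1)"
    by (simp add: eigen_def algebra_simps)
  moreover have "\<dots> > 0" using assms \<open>real i + 1 \<le> real j\<close> by (intro mult_pos_pos) auto
  ultimately show ?thesis by simp
qed

lemma zonal_op_add: "zonal_op d (p + q) = zonal_op d p + zonal_op d q"
  by (simp add: zonal_op_def pderiv_add algebra_simps smult_add_right)

lemma zonal_op_smult: "zonal_op d (smult c q) = smult c (zonal_op d q)"
  by (simp add: zonal_op_def pderiv_smult smult_diff_right smult_add_right mult.commute)

lemma zonal_op_0 [simp]: "zonal_op d 0 = 0"
  by (simp add: zonal_op_def)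

lemma zonal_op_sum: "zonal_op d (\<Sum>i\<in>I. q i) = (\<Sum>i\<in>I. zonal_op d (q i))"
  by (induction I rule: infinite_finite_induct) (simp_all add: zonal_op_add)

lemma smult_sum_distrib: "smult (c::real) (\<Sum>i\<in>I. q i) = (\<Sum>i\<in>I. smult c (q i))"
  by (induction I rule: infinite_finite_induct) (simp_all add: smult_add_right)

lemma zonal_op_monom:
  "zonal_op d (monom 1 (Suc (Suc k))) =
     smult (real (Suc (Suc k)) * real (Suc k)) (monom 1 k) - smult (eigen d (Suc (Suc k))) (monom 1 (Suc (Suc k)))"
proof -
  have "poly (zonal_op d (monom 1 (Suc (Suc k)))) s = poly (smult (real (Suc (Suc k)) * real (Suc k)) (monom 1 k) - smult (eigen d (Suc (Suc k))) (monom 1 (Suc (Suc k)))) s" for s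
    by (simp add: zonal_op_def pderiv_monom poly_monom eigen_def algebra_simps)
  then show ?thesis using poly_eq_poly_eq_iff by blast
qed

text \<open>The Gegenbauer operator is triangular on monomials, with off-diagonal terms two degrees
  lower, and its diagonal entries are distinct, so it can be diagonalised by induction on the
  degree. That the component of index 0 is a constant later identifies the limit of the
  flow.\<close>

lemma monom_eigen_decomposition:
  assumes d: "d > 0"
  shows "\<exists>Z. monom 1 k = (\<Sum>j\<le>k. Z j) \<and> (\<forall>j. zonal_op d (Z j) = smult (- eigen d j) (Z j)) \<and> (\<exists>c. Z 0 = [:c:])"
proof (induction k rule: less_induct)
  case (less k)
  consider "k = 0" | "k = 1" | m where "k = Suc (Suc m)" by (metis One_nat_def not0_implies_Suc)
  then show ?case
  proof cases
    case 1
    then show ?thesis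
      by (intro exI[of _ "\<lambda>j. if j = 0 then 1 else 0"])
         (auto simp: zonal_op_def eigen_def one_pCons)
  next
    case 2
    have "zonal_op d [:0, 1:] = smult (- eigen d 1) [:0, 1:]"
      by (simp add: zonal_op_def eigen_def pderiv_pCons)
    then show ?thesis using 2
      by (intro exI[of _ "\<lambda>j. if j = 1 then [:0, 1:] else 0"])
         (auto simp: monom_altdef)
  next
    case 3
    then obtain W where W: "monom 1 m = (\<Sum>j\<le>m. W j)" "\<And>j. zonal_op d (W j) = smult (- eigen d j) (W j)"
      and W0: "\<exists>c. W 0 = [:c:]"
      using less[of m] by auto
    define a where "a = real (Suc (Suc m)) * real (Suc m)"
    \<comment> \<open>Dividing by the spectral gap solves for the correction: subtracting these
      components from the monomial of degree \<open>k\<close> absorbs the term of degree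
      \<open>m\<close> that the operator produces, and the remainder is the eigenfunction of index
      \<open>k\<close>.\<close>
    define V where "V = (\<lambda>j. smult (a / (eigen d k - eigen d j)) (W j))"
    define Z where "Z = (\<lambda>j. if j \<le> m then V j else if j = k then monom 1 k - (\<Sum>j\<le>m. V j) else 0)"
    have V: "zonal_op d (V j) = smult (- eigen d j) (V j)" for j
      by (simp add: V_def zonal_op_smult W(2) mult.commute)
    have "(\<Sum>j\<le>m. smult a (W j)) = (\<Sum>j\<le>m. smult (eigen d k - eigen d j) (V j))"
    proof (intro sum.cong refl)
      fix j assume "j \<in> {..m}"
      then have "eigen d j < eigen d k" using 3 by (intro eigen_mono d) auto
      then show "smult a (W j) = smult (eigen d k - eigen d j) (V j)" by (simp add: V_def)
    qed
    then have sm: "smult a (monom 1 m) = (\<Sum>j\<le>m. smult (eigen d k - eigen d j) (V j))"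
      by (simp add: W(1) smult_sum_distrib)
    have "zonal_op d (monom 1 k - (\<Sum>j\<le>m. V j)) = zonal_op d (monom 1 k) - zonal_op d (\<Sum>j\<le>m. V j)"
      using zonal_op_add[of d "monom 1 k" "smult (-1) (\<Sum>j\<le>m. V j)"] by (simp add: zonal_op_smult[of d "-1", simplified])
    also have "\<dots> = (\<Sum>j\<le>m. smult (eigen d k - eigen d j) (V j)) - smult (eigen d k) (monom 1 k)
        - (\<Sum>j\<le>m. smult (- eigen d j) (V j))"
      unfolding 3 zonal_op_monom zonal_op_sum V[unfolded 3] using sm by (simp add: a_def 3)
    also have "\<dots> = smult (- eigen d k) (monom 1 k - (\<Sum>j\<le>m. V j))"
      by (simp add: smult_diff_left smult_diff_right sum_subtractf smult_sum_distrib sum_negf)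
    finally have Zk: "zonal_op d (monom 1 k - (\<Sum>j\<le>m. V j)) = smult (- eigen d k) (monom 1 k - (\<Sum>j\<le>m. V j))" .
    have "(\<Sum>j\<le>k. Z j) = (\<Sum>j\<le>m. Z j) + Z (Suc m) + Z k" using 3 by simp
    also have "\<dots> = monom 1 k" using 3 by (simp add: Z_def)
    finally have "monom 1 k = (\<Sum>j\<le>k. Z j)" ..
    moreover have "zonal_op d (Z j) = smult (- eigen d j) (Z j)" for j
      using V Zk by (auto simp: Z_def)
    moreover have "\<exists>c. Z 0 = [:c:]" using W0 by (auto simp: Z_def V_def)
    ultimately show ?thesis by blast
  qed
qed

lemma poly_eigen_decomposition:
  fixes q :: "real poly"
  assumes d: "d > 0"
  obtains N Z where "q = (\<Sum>j\<le>N. Z j)" "\<And>j. zonal_op d (Z j) = smult (- eigen d j) (Z j)" "\<exists>c. Z 0 = [:c:]"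
proof -
  obtain W where W: "\<And>k. monom 1 k = (\<Sum>j\<le>k. W k j)" "\<And>k j. zonal_op d (W k j) = smult (- eigen d j) (W k j)"
    "\<And>k. \<exists>c. W k 0 = [:c:]"
    using monom_eigen_decomposition[OF d] by metis
  define N where "N = degree q"
  define Z where "Z = (\<lambda>j. \<Sum>k\<le>N. smult (coeff q k) (if j \<le> k then W k j else 0))"
  have "q = (\<Sum>k\<le>N. smult (coeff q k) (monom 1 k))"
    by (simp add: smult_monom N_def poly_as_sum_of_monoms)
  also have "\<dots> = (\<Sum>k\<le>N. \<Sum>j\<le>N. smult (coeff q k) (if j \<le> k then W k j else 0))"
  proof (intro sum.cong refl)
    fix k assume k: "k \<in> {..N}"
    have "(\<Sum>j\<le>N. smult (coeff q k) (if j \<le> k then W k j else 0)) = (\<Sum>j\<le>k. smult (coeff q k) (W k j))"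
      using k by (intro sum.mono_neutral_cong_right) auto
    then show "smult (coeff q k) (monom 1 k) = (\<Sum>j\<le>N. smult (coeff q k) (if j \<le> k then W k j else 0))"
      by (simp add: W(1) smult_sum_distrib)
  qed
  also have "\<dots> = (\<Sum>j\<le>N. Z j)" unfolding Z_def by (rule sum.swap)
  finally have 1: "q = (\<Sum>j\<le>N. Z j)" .
  have 2: "zonal_op d (Z j) = smult (- eigen d j) (Z j)" for j
    unfolding Z_def zonal_op_sum zonal_op_smult smult_sum_distrib
    by (intro sum.cong refl) (auto simp: W(2) mult.commute)
  obtain c where c: "\<And>k. W k 0 = [:c k:]" using W(3) by metis
  have "Z 0 = [:\<Sum>k\<le>N. coeff q k * c k:]"
  proof -
    have "(\<Sum>k\<in>A. [:e k:]) = [:\<Sum>k\<in>A. e k:]" for e :: "nat \<Rightarrow> real" and A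
      by (induction A rule: infinite_finite_induct) auto
    then show ?thesis by (simp add: Z_def c)
  qed
  then show ?thesis using that[OF 1 2] by blast
qed

section \<open>Polynomial approximation by convolution\<close>

lemma smeas_measure_sphere [simp]: "measure (smeas :: (real^'n::finite) measure) (sphere 0 1) = 1"
  using prob_space.prob_space[of "smeas :: (real^'n) measure"] smeas.prob_space_axioms by simp

fun kernel_mass :: "real \<Rightarrow> nat \<Rightarrow> real" where
  "kernel_mass d 0 = 1"
| "kernel_mass d (Suc k) = kernel_mass d k * ((2 * real k + d) / (real k + d))"

lemma kernel_mass_pos: "d > 0 \<Longrightarrow> kernel_mass d k > 0"
  by (induction k) (auto intro!: mult_pos_pos divide_pos_pos add_nonneg_pos)

text \<open>As \<open>1 - s\<^sup>2\<close> contains the factor \<open>1 + s\<close>, the operator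
  maps the power of order \<open>Suc k\<close> to a combination of the powers of orders
  \<open>k\<close> and \<open>Suc k\<close>. This is what makes the masses of these kernels
  computable.\<close>

lemma zonal_op_kernel:
  "poly (zonal_op d ([:1, 1:] ^ Suc k)) s
     = (real k + 1) * ((2 * real k + d) * (1 + s) ^ k - (real k + d) * (1 + s) ^ Suc k)"
proof -
  have p1: "pderiv ([:1, 1::real:] ^ Suc k) = smult (real k + 1) ([:1, 1:] ^ k)"
    by (subst pderiv_power_Suc) (simp add: pderiv_pCons add.commute)
  have p2: "(1 - s * s) * poly (pderiv ([:1, 1::real:] ^ k)) s = (1 - s) * (real k * (1 + s) ^ k)"
  proof (cases k)
    case (Suc m)
    then show ?thesis
      by (simp only: pderiv_power_Suc) (simp add: pderiv_pCons algebra_simps)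
  qed simp
  have "poly (zonal_op d ([:1, 1:] ^ Suc k)) s
     = (real k + 1) * ((1 - s * s) * poly (pderiv ([:1, 1::real:] ^ k)) s) - d * s * (real k + 1) * (1 + s) ^ k"
    unfolding zonal_op_def p1 by (simp add: pderiv_smult algebra_simps)
  also have "\<dots> = (real k + 1) * ((2 * real k + d) * (1 + s) ^ k - (real k + d) * (1 + s) ^ Suc k)"
    unfolding p2 by (simp add: algebra_simps)
  finally show ?thesis .
qed

text \<open>The mass of \<open>(1 + x \<bullet> y) ^ k\<close> satisfies a two-term recursion because the Laplacian of
  \<open>(1 + x \<bullet> y) ^ Suc k\<close> integrates to zero.\<close>

lemma integral_kernel:
  fixes x :: "real^'n::finite"
  assumes x: "x \<in> sphere 0 1" and n: "CARD('n) \<ge> 2"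
  shows "(\<integral>y. (1 + x \<bullet> y) ^ k \<partial>smeas) = kernel_mass (real CARD('n) - 1) k"
proof (induction k)
  case 0
  show ?case by simp
next
  case (Suc k)
  define d where "d = real CARD('n) - 1"
  have d: "d > 0" using n by (simp add: d_def)
  let ?q = "[:1, 1::real:] ^ Suc k"
  have int: "integrable smeas (\<lambda>y. (1 + x \<bullet> y) ^ m)" for m
    by (intro integrable_smeas_continuous continuous_intros)
  have "(\<integral>y. 1 * Lap (\<lambda>y. poly ?q (x \<bullet> y)) y \<partial>smeas) = - (\<integral>y. Gam (\<lambda>y. 1) (\<lambda>y. poly ?q (x \<bullet> y)) y \<partial>smeas)"
    by (intro integral_Lap_by_parts C1S_rpoly rpoly_LD sep_rpoly_right[OF sep_poly_inner]
        rpoly_const)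
  then have "0 = (\<integral>y. Lap (\<lambda>y. poly ?q (x \<bullet> y)) y \<partial>smeas)"
    by (simp add: Gam_def)
  also have "\<dots> = (\<integral>y. (real k + 1) * (2 * real k + d) * (1 + x \<bullet> y) ^ k - (real k + 1) * (real k + d) * (1 + x \<bullet> y) ^ Suc k \<partial>smeas)"
  proof (intro Bochner_Integration.integral_cong refl)
    fix y assume "y \<in> space (smeas :: (real^'n) measure)"
    then have "Lap (\<lambda>y. poly ?q (y \<bullet> x)) y = poly (zonal_op d ?q) (y \<bullet> x)"
      unfolding d_def using x by (intro Lap_poly_inner) auto
    then show "Lap (\<lambda>y. poly ?q (x \<bullet> y)) y
      = (real k + 1) * (2 * real k + d) * (1 + x \<bullet> y) ^ k - (real k + 1) * (real k + d) * (1 + x \<bullet> y) ^ Suc k"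
      unfolding zonal_op_kernel by (simp only: inner_commute[of _ x] right_diff_distrib mult.assoc)
  qed
  also have "\<dots> = (real k + 1) * (2 * real k + d) * (\<integral>y. (1 + x \<bullet> y) ^ k \<partial>smeas)
      - (real k + 1) * (real k + d) * (\<integral>y. (1 + x \<bullet> y) ^ Suc k \<partial>smeas)"
    using int[of k] int[of "Suc k"] by (subst Bochner_Integration.integral_diff) auto
  finally have "(real k + 1) * ((real k + d) * (\<integral>y. (1 + x \<bullet> y) ^ Suc k \<partial>smeas))
      = (real k + 1) * ((2 * real k + d) * kernel_mass d k)"
    using Suc unfolding d_def[symmetric] by (simp only: mult.assoc)
  then have "(real k + d) * (\<integral>y. (1 + x \<bullet> y) ^ Suc k \<partial>smeas) = (2 * real k + d) * kernel_mass d k"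
    by simp
  moreover have "real k + d > 0" using d by linarith
  ultimately have "(\<integral>y. (1 + x \<bullet> y) ^ Suc k \<partial>smeas) = (2 * real k + d) * kernel_mass d k / (real k + d)"
    by (simp only: eq_divide_eq mult.commute) simp
  then show ?case unfolding d_def[symmetric] by (simp add: mult.commute)
qed

definition avg_poly :: "real \<Rightarrow> nat \<Rightarrow> real poly" where
  "avg_poly d k = smult (1 / kernel_mass d k) ([:1, 1:] ^ k)"

abbreviation avg :: "nat \<Rightarrow> (real^'n \<Rightarrow> real) \<Rightarrow> real^'n::finite \<Rightarrow> real" where
  "avg k \<equiv> zonal (avg_poly (real CARD('n) - 1) k)"

lemma avg_poly_nonneg:
  assumes "x \<in> sphere 0 1" "y \<in> sphere 0 1" "d > 0"
  shows "poly (avg_poly d k) (x \<bullet> y) \<ge> 0"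
proof -
  have "\<bar>x \<bullet> y\<bar> \<le> 1" using Cauchy_Schwarz_ineq2[of x y] assms by simp
  then show ?thesis using kernel_mass_pos[OF assms(3), of k] by (simp add: avg_poly_def)
qed

lemma integrable_poly_inner: "integrable smeas (\<lambda>y. poly q (x \<bullet> y))"
  by (intro integrable_smeas_continuous continuous_intros)

text \<open>On the sphere the squared distance is \<open>2 * (2 - (1 + x \<bullet> y))\<close>, so
  the second moment involves only the ratio of two consecutive kernel masses; it decays like
  \<open>1 / k\<close>.\<close>

lemma integral_avg_poly:
  fixes x :: "real^'n::finite"
  assumes x: "x \<in> sphere 0 1" and n: "CARD('n) \<ge> 2"
  shows "(\<integral>y. poly (avg_poly (real CARD('n) - 1) k) (x \<bullet> y) \<partial>smeas) = 1"
    and "(\<integral>y. poly (avg_poly (real CARD('n) - 1) k) (x \<bullet> y) * (norm (y - x))\<^sup>2 \<partial>smeas)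
       = 2 * (real CARD('n) - 1) / (real k + (real CARD('n) - 1))"
proof -
  define d where "d = real CARD('n) - 1"
  have d: "d > 0" using n by (simp add: d_def)
  have A: "kernel_mass d k > 0" using d by (rule kernel_mass_pos)
  have int: "integrable smeas (\<lambda>y. (1 + x \<bullet> y) ^ m)" for m
    by (intro integrable_smeas_continuous continuous_intros)
  show "(\<integral>y. poly (avg_poly (real CARD('n) - 1) k) (x \<bullet> y) \<partial>smeas) = 1"
    using A unfolding d_def[symmetric] avg_poly_def
    by (simp add: integral_kernel[OF x n, folded d_def])
  have "(\<integral>y. poly (avg_poly d k) (x \<bullet> y) * (norm (y - x))\<^sup>2 \<partial>smeas)
     = (\<integral>y. (2 / kernel_mass d k) * (2 * (1 + x \<bullet> y) ^ k - (1 + x \<bullet> y) ^ Suc k) \<partial>smeas)"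
  proof (intro Bochner_Integration.integral_cong refl)
    fix y assume "y \<in> space (smeas :: (real^'n) measure)"
    then have "y \<bullet> y = 1" "x \<bullet> x = 1" using x by (simp_all add: norm_eq_1)
    then have nrm: "(norm (y - x))\<^sup>2 = 2 * (2 - (1 + x \<bullet> y))"
      unfolding power2_norm_eq_inner by (simp add: inner_diff_left inner_diff_right inner_commute)
    then show "poly (avg_poly d k) (x \<bullet> y) * (norm (y - x))\<^sup>2
      = (2 / kernel_mass d k) * (2 * (1 + x \<bullet> y) ^ k - (1 + x \<bullet> y) ^ Suc k)"
      unfolding nrm using A by (simp add: avg_poly_def field_simps)
  qed
  also have "\<dots> = (2 / kernel_mass d k) * (2 * kernel_mass d k - kernel_mass d (Suc k))"
    using int[of k] int[of "Suc k"] unfolding integral_kernel[OF x n, folded d_def, symmetric]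
    by (subst integral_mult_right_zero, subst Bochner_Integration.integral_diff) auto
  also have "\<dots> = 2 * (2 - (2 * real k + d) / (real k + d))"
    using A by (simp add: field_simps)
  also have "\<dots> = 2 * d / (real k + d)"
    using d by (simp add: field_simps)
  finally show "(\<integral>y. poly (avg_poly (real CARD('n) - 1) k) (x \<bullet> y) * (norm (y - x))\<^sup>2 \<partial>smeas)
       = 2 * (real CARD('n) - 1) / (real k + (real CARD('n) - 1))"
    by (simp add: d_def)
qed

lemma avg_ge:
  fixes f :: "real^'n::finite \<Rightarrow> real"
  assumes f: "continuous_on (sphere 0 1) f" and m: "\<And>y. y \<in> sphere 0 1 \<Longrightarrow> m \<le> f y"
    and x: "x \<in> sphere 0 1" and n: "CARD('n) \<ge> 2"
  shows "m \<le> avg k f x"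
proof -
  have d: "real CARD('n) - 1 > 0" using n by simp
  have "m = (\<integral>y. m * poly (avg_poly (real CARD('n) - 1) k) (x \<bullet> y) \<partial>smeas)"
    by (simp add: integral_avg_poly(1)[OF x n])
  also have "\<dots> \<le> avg k f x"
    unfolding zonal_def
    using avg_poly_nonneg[OF x _ d] m
    by (intro Bochner_Integration.integral_mono integrable_sep[OF sep_poly_inner f] integrable_mult_right integrable_poly_inner)
      (auto intro!: mult_right_mono)
  finally show ?thesis .
qed

text \<open>Korovkin's device: uniform continuity handles nearby points and boundedness the distant
  ones, at the price of a quadratic term. The second moment of the kernel then controls the
  approximation error.\<close>

lemma quadratic_modulus:
  fixes f :: "real^'n::finite \<Rightarrow> real"
  assumes f: "continuous_on (sphere 0 1) f" and e: "e > 0"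
  obtains C where "C \<ge> 0" "\<And>x y. x \<in> sphere 0 1 \<Longrightarrow> y \<in> sphere 0 1 \<Longrightarrow> \<bar>f y - f x\<bar> \<le> e + C * (norm (y - x))\<^sup>2"
proof -
  obtain B where B: "\<And>x. x \<in> sphere 0 1 \<Longrightarrow> \<bar>f x\<bar> \<le> B" "B > 0"
    using continuous_sphere_bounded[OF f] by blast
  have "uniformly_continuous_on (sphere 0 1) f"
    using f by (intro compact_uniformly_continuous) auto
  then obtain s where s: "s > 0" "\<And>x y. x \<in> sphere 0 1 \<Longrightarrow> y \<in> sphere 0 1 \<Longrightarrow> dist y x < s \<Longrightarrow> dist (f y) (f x) < e"
    using e unfolding uniformly_continuous_on_def by metis
  show thesis
  proof (rule that[of "2 * B / s\<^sup>2"])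
    fix x y :: "real^'n" assume xy: "x \<in> sphere 0 1" "y \<in> sphere 0 1"
    show "\<bar>f y - f x\<bar> \<le> e + 2 * B / s\<^sup>2 * (norm (y - x))\<^sup>2"
    proof (cases "dist y x < s")
      case True
      then have "\<bar>f y - f x\<bar> < e" using s(2)[OF xy] by (simp add: dist_real_def)
      moreover have "0 \<le> 2 * B / s\<^sup>2 * (norm (y - x))\<^sup>2" using B(2) by simp
      ultimately show ?thesis by linarith
    next
      case False
      then have "s\<^sup>2 \<le> (norm (y - x))\<^sup>2" using s(1) by (intro power_mono) (auto simp: dist_norm)
      then have "2 * B * 1 \<le> 2 * B * ((norm (y - x))\<^sup>2 / s\<^sup>2)"
        using B(2) s(1) by (intro mult_left_mono) (auto simp: field_simps)
      moreover have "\<bar>f y - f x\<bar> \<le> 2 * B" using B(1)[OF xy(1)] B(1)[OF xy(2)] by linarith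
      ultimately show ?thesis using e by (simp add: field_simps)
    qed
  qed (use B(2) in auto)
qed

lemma avg_uniform_limit:
  fixes f :: "real^'n::finite \<Rightarrow> real"
  assumes f: "continuous_on (sphere 0 1) f" and n: "CARD('n) \<ge> 2"
  shows "uniform_limit (sphere 0 1) (\<lambda>k. avg k f) f sequentially"
proof (rule uniform_limitI)
  fix e :: real assume e: "e > 0"
  define d where "d = real CARD('n) - 1"
  have d: "d > 0" using n by (simp add: d_def)
  obtain C where C: "C \<ge> 0" "\<And>x y. x \<in> sphere 0 1 \<Longrightarrow> y \<in> sphere 0 1 \<Longrightarrow> \<bar>f y - f x\<bar> \<le> e / 2 + C * (norm (y - x))\<^sup>2"
    using quadratic_modulus[OF f, of "e / 2"] e by auto
  have bound: "\<bar>avg k f x - f x\<bar> \<le> e / 2 + C * (2 * d / (real k + d))" if x: "x \<in> sphere 0 1" for k x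
  proof -
    let ?w = "\<lambda>y. poly (avg_poly d k) (x \<bullet> y)"
    have i1: "integrable smeas (\<lambda>y. f y * ?w y)" by (rule integrable_sep[OF sep_poly_inner f])
    have i2: "integrable smeas (\<lambda>y. f x * ?w y)" "integrable smeas (\<lambda>y. e / 2 * ?w y)"
      by (intro integrable_mult_right integrable_poly_inner)+
    have i3: "integrable smeas (\<lambda>y. C * (?w y * (norm (y - x))\<^sup>2))"
      by (intro integrable_smeas_continuous continuous_intros)
    have "avg k f x - f x = (\<integral>y. f y * ?w y \<partial>smeas) - (\<integral>y. f x * ?w y \<partial>smeas)"
      using integral_avg_poly(1)[OF x n, of k] by (simp add: zonal_def d_def)
    also have "\<dots> = (\<integral>y. (f y - f x) * ?w y \<partial>smeas)"
      using i1 i2(1) by (simp add: left_diff_distrib)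
    finally have "\<bar>avg k f x - f x\<bar> \<le> (\<integral>y. \<bar>(f y - f x) * ?w y\<bar> \<partial>smeas)"
      by (metis integral_abs_bound)
    also have "\<dots> \<le> (\<integral>y. e / 2 * ?w y + C * (?w y * (norm (y - x))\<^sup>2) \<partial>smeas)"
    proof (intro Bochner_Integration.integral_mono Bochner_Integration.integrable_add i2 i3)
      show "integrable smeas (\<lambda>y. \<bar>(f y - f x) * ?w y\<bar>)"
        using i1 i2(1) by (intro integrable_abs) (simp add: left_diff_distrib)
      fix y assume "y \<in> space (smeas :: (real^'n) measure)"
      then have y: "y \<in> sphere 0 1" by simp
      have w: "?w y \<ge> 0" using avg_poly_nonneg[OF x y d] .
      have "\<bar>(f y - f x) * ?w y\<bar> = \<bar>f y - f x\<bar> * ?w y" using w by (simp add: abs_mult)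
      also have "\<dots> \<le> (e / 2 + C * (norm (y - x))\<^sup>2) * ?w y" by (intro mult_right_mono C x y w)
      finally show "\<bar>(f y - f x) * ?w y\<bar> \<le> e / 2 * ?w y + C * (?w y * (norm (y - x))\<^sup>2)"
        by (simp add: algebra_simps)
    qed
    also have "\<dots> = e / 2 + C * (2 * d / (real k + d))"
      using integral_avg_poly[OF x n, of k] i2 i3 by (simp add: d_def)
    finally show ?thesis .
  qed
  have "filterlim (\<lambda>k. d + real k) at_top sequentially"
    by (rule filterlim_tendsto_add_at_top[OF tendsto_const filterlim_real_sequentially])
  then have "(\<lambda>k. C * (2 * d / (real k + d))) \<longlonglongrightarrow> C * 0"
    by (intro tendsto_mult tendsto_const real_tendsto_divide_at_top[OF tendsto_const]) (simp add: add.commute)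
  then have "\<forall>\<^sub>F k in sequentially. C * (2 * d / (real k + d)) < e / 2"
    using e by (intro order_tendstoD) auto
  then show "\<forall>\<^sub>F k in sequentially. \<forall>x\<in>sphere 0 1. dist (avg k f x) (f x) < e"
  proof eventually_elim
    case (elim k)
    show ?case
    proof
      fix x :: "real^'n" assume "x \<in> sphere 0 1"
      from bound[OF this, of k] elim show "dist (avg k f x) (f x) < e" by (simp add: dist_real_def)
    qed
  qed
qed

section \<open>The heat flow on zonal polynomials\<close>

lemma second_derivative_nonneg_at_min:
  fixes f f' :: "real \<Rightarrow> real"
  assumes f': "\<And>s. (f has_real_derivative f' s) (at s)" and f'': "(f' has_real_derivative c) (at 0)"
    and min: "\<And>s. f 0 \<le> f s"
  shows "c \<ge> 0"
proof (rule ccontr)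
  assume "\<not> c \<ge> 0"
  then obtain e where e: "e > 0" "\<And>h. 0 < h \<Longrightarrow> h < e \<Longrightarrow> f' (0 + h) < f' 0"
    using DERIV_neg_dec_right[OF f''] by auto
  have "f' 0 = 0" using DERIV_local_min[OF f', of 1 0] min by auto
  obtain z where "0 < z" "z < e / 2" "f (e / 2) - f 0 = (e / 2 - 0) * f' z"
    using MVT2[of 0 "e / 2" f f'] f' e(1) by auto
  note z = this
  have "f' z < 0" using e(2)[of z] \<open>f' 0 = 0\<close> z by simp
  then have "(e / 2 - 0) * f' z < 0" using e(1) by (intro mult_pos_neg) auto
  with z(3) have "f (e / 2) < f 0" by simp
  with min[of "e / 2"] show False by simp
qed

text \<open>Along every rotation orbit through a minimum the second derivative is nonnegative, and
  \<open>Lap\<close> is half the sum of these.\<close>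

lemma Lap_nonneg_at_min:
  assumes h: "rpoly h" and x: "x \<in> sphere 0 1" and min: "\<And>y. y \<in> sphere 0 1 \<Longrightarrow> h x \<le> h y"
  shows "Lap h x \<ge> 0"
proof -
  have "LD a (LD a h) x \<ge> 0" for a
  proof (cases a)
    case (Pair i j)
    show ?thesis
    proof (cases "i = j")
      case ij: False
      show ?thesis unfolding Pair
      proof (rule second_derivative_nonneg_at_min)
        show "((\<lambda>s. h (rot i j s x)) has_real_derivative LD (i,j) h (rot i j s x)) (at s)" for s
          using h by (intro rot_derivative_LD ij) auto
        show "((\<lambda>s. LD (i,j) h (rot i j s x)) has_real_derivative LD (i,j) (LD (i,j) h) x) (at 0)"
          using rot_derivative_LD[OF ij, of "LD (i,j) h" 0 x] h by simp
        show "h (rot i j 0 x) \<le> h (rot i j s x)" for s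
          using min[OF rot_in_sphere[OF ij x]] by simp
      qed
    qed (simp add: Pair)
  qed
  then show ?thesis unfolding Lap_def by (intro divide_nonneg_nonneg sum_nonneg) auto
qed

text \<open>\<open>c\<close> is the value of the constant mode, hence the mean and the limit of the
  flow. The eigenvalue equation is required only on the sphere, where the Gegenbauer form of
  \<open>Lap\<close> is valid.\<close>

locale heat_flow =
  fixes H :: "nat \<Rightarrow> real^'n::finite \<Rightarrow> real" and N :: nat and c d :: real
  assumes H: "\<And>j. rpoly (H j)"
    and eigen: "\<And>j x. x \<in> sphere 0 1 \<Longrightarrow> Lap (H j) x = - eigen d j * H j x"
    and H0: "\<And>x. H 0 x = c"
    and dim: "CARD('n) \<ge> 2" and d_def: "d = real CARD('n) - 1"
begin

definition flow :: "real \<Rightarrow> real^'n \<Rightarrow> real" where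
  "flow t = (\<lambda>x. \<Sum>j\<le>N. exp (- eigen d j * t) * H j x)"

definition dflow :: "real \<Rightarrow> real^'n \<Rightarrow> real" where
  "dflow t = (\<lambda>x. \<Sum>j\<le>N. - eigen d j * exp (- eigen d j * t) * H j x)"

section \<open>Derivatives, bounds, limits and positivity of the flow\<close>

lemma d_pos: "d > 0"
  using dim by (simp add: d_def)

lemma eigen_0 [simp]: "eigen d 0 = 0"
  by (simp add: eigen_def)

lemma eigen_ge: "0 < j \<Longrightarrow> eigen d j \<ge> d"
proof -
  assume "0 < j"
  then have "1 * d \<le> real j * (real j + d - 1)"
    using d_pos by (intro mult_mono) auto
  then show ?thesis by (simp add: eigen_def)
qed

lemma eigen_nonneg: "eigen d j \<ge> 0"
  using eigen_ge[of j] d_pos by (cases "j = 0") auto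

lemma rpoly_lin: "rpoly (\<lambda>x. \<Sum>j\<le>N. e j * H j x)"
  by (intro real_polynomial_function_sum rpoly_const rpoly_mult H) auto

lemma rpoly_flow [simp, intro]: "rpoly (flow t)" and rpoly_dflow [simp, intro]: "rpoly (dflow t)"
  unfolding flow_def dflow_def by (rule rpoly_lin)+

lemma LD_lin: "LD a (\<lambda>x. \<Sum>j\<le>N. e j * H j x) x = (\<Sum>j\<le>N. e j * LD a (H j) x)"
proof -
  have "rpoly (\<lambda>x. e j * H j x)" for j by (intro rpoly_const rpoly_mult H)
  then show ?thesis by (subst LD_sum) (auto simp: LD_cmult H)
qed

lemma LD_flow: "LD a (flow t) x = (\<Sum>j\<le>N. exp (- eigen d j * t) * LD a (H j) x)"
  unfolding flow_def by (rule LD_lin)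

lemma LD_dflow: "LD a (dflow t) x = (\<Sum>j\<le>N. - eigen d j * exp (- eigen d j * t) * LD a (H j) x)"
  unfolding dflow_def by (rule LD_lin)

lemma Lap_flow:
  assumes "x \<in> sphere 0 1"
  shows "Lap (flow t) x = dflow t x"
proof -
  have L: "LD a (flow t) = (\<lambda>x. \<Sum>j\<le>N. exp (- eigen d j * t) * LD a (H j) x)" for a
    by (intro ext LD_flow)
  have r: "rpoly (\<lambda>x. exp (- eigen d j * t) * LD a (H j) x)" for a j
    by (intro rpoly_const rpoly_mult H rpoly_LD)
  have "Lap (flow t) x = (\<Sum>a\<in>UNIV. \<Sum>j\<le>N. exp (- eigen d j * t) * LD a (LD a (H j)) x) / 2"
    unfolding Lap_def L using r by (simp add: LD_sum LD_cmult H)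
  also have "\<dots> = (\<Sum>j\<le>N. exp (- eigen d j * t) * Lap (H j) x)"
    by (subst sum.swap) (simp add: Lap_def sum_distrib_left sum_divide_distrib)
  also have "\<dots> = dflow t x"
    unfolding dflow_def by (simp add: eigen[OF assms] mult_ac)
  finally show ?thesis .
qed

text \<open>\<open>Lap (flow t)\<close> is known to equal \<open>dflow t\<close> only on the sphere;
  the equation may be differentiated because the rotation fields are tangential.\<close>

lemma Gam_Lap_flow:
  assumes "x \<in> sphere 0 1"
  shows "Gam g (Lap (flow t)) x = Gam g (dflow t) x"
proof -
  have "LD a (Lap (flow t)) x = LD a (dflow t) x" for a
    by (intro LD_cong_sphere rpoly_diff rpoly_Lap rpoly_flow rpoly_dflow Lap_flow assms)
  then show ?thesis by (simp add: Gam_def)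
qed

lemma flow_deriv: "((\<lambda>t. flow t x) has_real_derivative dflow t x) (at t within T)"
  unfolding flow_def dflow_def
  by (auto intro!: derivative_eq_intros sum.cong)

lemma LD_flow_deriv: "((\<lambda>t. LD a (flow t) x) has_real_derivative LD a (dflow t) x) (at t within T)"
  unfolding LD_flow LD_dflow
  by (auto intro!: derivative_eq_intros sum.cong)

lemma Gam_flow_deriv:
  "((\<lambda>t. Gam (flow t) (flow t) x) has_real_derivative 2 * Gam (flow t) (dflow t) x) (at t within T)"
proof -
  have "((\<lambda>t. \<Sum>a\<in>UNIV. LD a (flow t) x * LD a (flow t) x) has_real_derivative
     (\<Sum>a\<in>UNIV. LD a (flow t) x * LD a (dflow t) x + LD a (dflow t) x * LD a (flow t) x)) (at t within T)"
    by (intro DERIV_sum DERIV_mult' LD_flow_deriv)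
  from DERIV_cdivide[OF this, of 2]
  show ?thesis unfolding Gam_def by (simp add: mult.commute mult_2[symmetric] sum_distrib_left[symmetric])
qed

lemma lin_bound:
  assumes e: "\<And>j. \<bar>e j\<bar> \<le> w j"
  shows "\<bar>\<Sum>j\<le>N. e j * (h j :: real)\<bar> \<le> (\<Sum>j\<le>N. w j * \<bar>h j\<bar>)"
  by (rule order_trans[OF sum_abs]) (auto intro!: sum_mono mult_right_mono e simp: abs_mult)

lemma exp_bound: "t \<ge> 0 \<Longrightarrow> \<bar>exp (- eigen d j * t)\<bar> \<le> 1"
  using eigen_nonneg[of j] by simp

lemma exp_bound': "t \<ge> 0 \<Longrightarrow> \<bar>- eigen d j * exp (- eigen d j * t)\<bar> \<le> eigen d j"
  using eigen_nonneg[of j] by (simp add: abs_mult mult_left_le)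

text \<open>All exponentials are at most 1 for nonnegative times, so the bounds are uniform in time;
  they dominate the integrands both when differentiating in \<open>t\<close> and when
  \<open>t\<close> tends to infinity.\<close>

lemma flow_bounds:
  obtains B where "B > 0"
    "\<And>t x. t \<ge> 0 \<Longrightarrow> x \<in> sphere 0 1 \<Longrightarrow> \<bar>flow t x\<bar> \<le> B"
    "\<And>t x. t \<ge> 0 \<Longrightarrow> x \<in> sphere 0 1 \<Longrightarrow> \<bar>dflow t x\<bar> \<le> B"
    "\<And>t x. t \<ge> 0 \<Longrightarrow> x \<in> sphere 0 1 \<Longrightarrow> Gam (flow t) (flow t) x \<le> B"
    "\<And>t x. t \<ge> 0 \<Longrightarrow> x \<in> sphere 0 1 \<Longrightarrow> \<bar>Gam (flow t) (dflow t) x\<bar> \<le> B"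
proof -
  define B1 where "B1 = (\<lambda>x. \<Sum>j\<le>N. 1 * \<bar>H j x\<bar>)"
  define B2 where "B2 = (\<lambda>x. \<Sum>j\<le>N. eigen d j * \<bar>H j x\<bar>)"
  define B3 where "B3 = (\<lambda>x. (\<Sum>a\<in>UNIV. (\<Sum>j\<le>N. 1 * \<bar>LD a (H j) x\<bar>) * (\<Sum>j\<le>N. 1 * \<bar>LD a (H j) x\<bar>)) / 2)"
  define B4 where "B4 = (\<lambda>x. (\<Sum>a\<in>UNIV. (\<Sum>j\<le>N. 1 * \<bar>LD a (H j) x\<bar>) * (\<Sum>j\<le>N. eigen d j * \<bar>LD a (H j) x\<bar>)) / 2)"
  have "continuous_on (sphere 0 1) (\<lambda>x. \<bar>B1 x\<bar> + \<bar>B2 x\<bar> + \<bar>B3 x\<bar> + \<bar>B4 x\<bar>)"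
    unfolding B1_def B2_def B3_def B4_def
    by (intro continuous_intros rpoly_continuous_on rpoly_LD H) auto
  then obtain B where B: "\<And>x. x \<in> sphere 0 1 \<Longrightarrow> \<bar>\<bar>B1 x\<bar> + \<bar>B2 x\<bar> + \<bar>B3 x\<bar> + \<bar>B4 x\<bar>\<bar> \<le> B" "B > 0"
    using continuous_sphere_bounded by blast
  have le: "\<bar>flow t x\<bar> \<le> B1 x" "\<bar>dflow t x\<bar> \<le> B2 x"
    "Gam (flow t) (flow t) x \<le> B3 x" "\<bar>Gam (flow t) (dflow t) x\<bar> \<le> B4 x" if "t \<ge> 0" for t x
  proof -
    show "\<bar>flow t x\<bar> \<le> B1 x" "\<bar>dflow t x\<bar> \<le> B2 x"
      unfolding flow_def dflow_def B1_def B2_def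
      by (intro lin_bound exp_bound exp_bound' that)+
    have L: "\<bar>LD a (flow t) x\<bar> \<le> (\<Sum>j\<le>N. 1 * \<bar>LD a (H j) x\<bar>)" "\<bar>LD a (dflow t) x\<bar> \<le> (\<Sum>j\<le>N. eigen d j * \<bar>LD a (H j) x\<bar>)" for a
      unfolding LD_flow LD_dflow by (intro lin_bound exp_bound exp_bound' that)+
    have nn: "(\<Sum>j\<le>N. 1 * \<bar>LD a (H j) x\<bar>) \<ge> 0" for a by (intro sum_nonneg) auto
    have "\<bar>LD a (flow t) x * LD a (flow t) x\<bar> \<le> (\<Sum>j\<le>N. 1 * \<bar>LD a (H j) x\<bar>) * (\<Sum>j\<le>N. 1 * \<bar>LD a (H j) x\<bar>)" for a
      unfolding abs_mult by (intro mult_mono L nn abs_ge_zero)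
    then have "\<bar>Gam (flow t) (flow t) x\<bar> \<le> B3 x"
      unfolding Gam_def B3_def abs_divide abs_numeral
      by (intro divide_right_mono order_trans[OF sum_abs] sum_mono) auto
    then show "Gam (flow t) (flow t) x \<le> B3 x" by simp
    have "\<bar>LD a (flow t) x * LD a (dflow t) x\<bar> \<le> (\<Sum>j\<le>N. 1 * \<bar>LD a (H j) x\<bar>) * (\<Sum>j\<le>N. eigen d j * \<bar>LD a (H j) x\<bar>)" for a
      unfolding abs_mult by (intro mult_mono L nn abs_ge_zero)
    then show "\<bar>Gam (flow t) (dflow t) x\<bar> \<le> B4 x"
      unfolding Gam_def B4_def abs_divide abs_numeral
      by (intro divide_right_mono order_trans[OF sum_abs] sum_mono) auto
  qed
  show thesis
  proof (rule that[OF B(2)])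
    fix t :: real and x :: "real^'n" assume "t \<ge> 0" "x \<in> sphere 0 1"
    with le[of t x] B(1)[of x]
    show "\<bar>flow t x\<bar> \<le> B" "\<bar>dflow t x\<bar> \<le> B" "Gam (flow t) (flow t) x \<le> B" "\<bar>Gam (flow t) (dflow t) x\<bar> \<le> B"
      by linarith+
  qed
qed

lemma exp_lim: "((\<lambda>t. exp (- eigen d j * t)) \<longlongrightarrow> (if j = 0 then 1 else 0)) at_top"
proof (cases "j = 0")
  case False
  then have "eigen d j > 0" using eigen_ge[of j] d_pos by simp
  then have "filterlim (\<lambda>t. eigen d j * t) at_top at_top"
    by (intro filterlim_tendsto_pos_mult_at_top[OF tendsto_const]) (auto simp: filterlim_ident)
  then have "filterlim (\<lambda>t. - (eigen d j * t)) at_bot at_top"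
    by (simp add: filterlim_uminus_at_top)
  from filterlim_compose[OF exp_at_bot this] False show ?thesis by simp
qed auto

lemma lin_lim: "((\<lambda>t. \<Sum>j\<le>N. exp (- eigen d j * t) * h j) \<longlongrightarrow> h 0) at_top"
proof -
  have "((\<lambda>t. \<Sum>j\<le>N. exp (- eigen d j * t) * h j) \<longlongrightarrow> (\<Sum>j\<le>N. (if j = 0 then 1 else 0) * h j)) at_top"
    by (intro tendsto_sum tendsto_mult exp_lim tendsto_const)
  also have "(\<Sum>j\<le>N. (if j = 0 then 1 else 0) * h j) = h 0"
    by (simp add: if_distrib[of "\<lambda>z. z * _"] cong: if_cong)
  finally show ?thesis .
qed

lemma flow_lim: "((\<lambda>t. flow t x) \<longlongrightarrow> c) at_top"
  using lin_lim[of "\<lambda>j. H j x"] by (simp add: flow_def H0)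

lemma LD_flow_lim: "((\<lambda>t. LD a (flow t) x) \<longlongrightarrow> 0) at_top"
proof -
  have "H 0 = (\<lambda>x. c)" by (simp add: fun_eq_iff H0)
  then show ?thesis using lin_lim[of "\<lambda>j. LD a (H j) x"] by (simp add: LD_flow)
qed

lemma Gam_flow_lim: "((\<lambda>t. Gam (flow t) (flow t) x) \<longlongrightarrow> 0) at_top"
proof -
  have "((\<lambda>t. Gam (flow t) (flow t) x) \<longlongrightarrow> (\<Sum>a\<in>(UNIV::('n \<times> 'n) set). 0 * 0) / 2) at_top"
    unfolding Gam_def by (intro tendsto_divide tendsto_sum tendsto_mult LD_flow_lim tendsto_const) auto
  then show ?thesis by simp
qed

lemma flow_ge:
  assumes m: "\<And>x. x \<in> sphere 0 1 \<Longrightarrow> m \<le> flow 0 x" and t: "t \<ge> 0" and x: "x \<in> sphere 0 1"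
  shows "m \<le> flow t x"
proof (rule ccontr)
  assume neg: "\<not> m \<le> flow t x"
  then have "t > 0" using m[OF x] t by (cases "t = 0") auto
  \<comment> \<open>The tilt \<open>e * s\<close> will make a nonnegative time derivative strictly
    positive, yet it is small enough that \<open>g (t, x)\<close> is the average of \<open>m\<close>
    and \<open>flow t x\<close> and stays below \<open>m\<close>. The minimum of \<open>g\<close> is
    therefore not attained at time 0.\<close>
  define e where "e = (m - flow t x) / (2 * t)"
  have e: "e > 0" using neg \<open>t > 0\<close> by (simp add: e_def)
  define g where "g = (\<lambda>(s, y). flow s y + e * s)"
  have "continuous_on ({0..t} \<times> sphere 0 1) g"
    unfolding g_def flow_def case_prod_unfold
    by (intro continuous_intros continuous_on_compose2[OF rpoly_continuous_on[OF H, of UNIV]]) auto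
  then obtain p where p: "p \<in> {0..t} \<times> sphere 0 1" "\<And>q. q \<in> {0..t} \<times> sphere 0 1 \<Longrightarrow> g p \<le> g q"
    using continuous_attains_inf[of "{0..t} \<times> sphere 0 1" g] x t
    by (metis compact_Times compact_Icc compact_sphere SigmaI atLeastAtMost_iff empty_iff order_refl)
  obtain s y where sy: "p = (s, y)" by (cases p)
  then have s: "0 \<le> s" "s \<le> t" and y: "y \<in> sphere 0 1" using p(1) by auto
  have "g p \<le> g (t, x)" using x t by (intro p(2)) auto
  also have "g (t, x) = (m + flow t x) / 2" using \<open>t > 0\<close> by (simp add: g_def e_def field_simps)
  also have "\<dots> < m" using neg by simp
  finally have lt: "flow s y + e * s < m" by (simp add: g_def sy)
  then have "s > 0" using m[OF y] s by (cases "s = 0") auto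
  have "Lap (flow s) y \<ge> 0"
  proof (rule Lap_nonneg_at_min[OF rpoly_flow y])
    fix z :: "real^'n" assume "z \<in> sphere 0 1"
    then show "flow s y \<le> flow s z" using p(2)[of "(s, z)"] s by (simp add: g_def sy)
  qed
  \<comment> \<open>At a minimum in space the heat equation gives \<open>dflow s y \<ge> 0\<close>,
    so the tilted flow was smaller shortly before \<open>s\<close>. Only earlier times are used, so
    \<open>s = t\<close> is not a special case.\<close>
  then have "dflow s y + e > 0" using Lap_flow[OF y] e by simp
  moreover have "((\<lambda>s. flow s y + e * s) has_real_derivative dflow s y + e) (at s)"
    by (auto intro!: derivative_eq_intros flow_deriv)
  ultimately obtain b where b: "b > 0" "\<And>h. 0 < h \<Longrightarrow> h < b \<Longrightarrow> flow (s - h) y + e * (s - h) < flow s y + e * s"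
    using DERIV_pos_inc_left[of "\<lambda>s. flow s y + e * s"] by blast
  define h where "h = min (b / 2) s"
  have h: "0 < h" "h < b" "h \<le> s" using b(1) \<open>s > 0\<close> by (auto simp: h_def)
  have "g p \<le> g (s - h, y)" using h s y by (intro p(2)) auto
  with b(2)[OF h(1,2)] show False by (simp add: g_def sy)
qed

section \<open>Orthogonality of the modes and the spectral gap\<close>

lemma integral_H:
  assumes "0 < j" shows "(\<integral>x. H j x \<partial>smeas) = 0"
proof -
  have "(\<integral>x. 1 * Lap (H j) x \<partial>smeas) = - (\<integral>x. Gam (\<lambda>x. 1) (H j) x \<partial>smeas)"
    by (intro integral_Lap_by_parts C1S_rpoly rpoly_LD H rpoly_const)
  then have "(\<integral>x. Lap (H j) x \<partial>smeas) = 0" by (simp add: Gam_def)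
  moreover have "(\<integral>x. Lap (H j) x \<partial>smeas) = (\<integral>x. - eigen d j * H j x \<partial>smeas)"
    by (intro Bochner_Integration.integral_cong refl) (simp add: eigen)
  ultimately show ?thesis using eigen_ge[OF assms] d_pos by simp
qed

lemma integral_H_orthogonal:
  assumes "i \<noteq> j" shows "(\<integral>x. H i x * H j x \<partial>smeas) = 0"
proof -
  have *: "- eigen d j * (\<integral>x. H i x * H j x \<partial>smeas) = - (\<integral>x. Gam (H i) (H j) x \<partial>smeas)" for i j
  proof -
    have "(\<integral>x. H i x * Lap (H j) x \<partial>smeas) = - (\<integral>x. Gam (H i) (H j) x \<partial>smeas)"
      by (intro integral_Lap_by_parts C1S_rpoly rpoly_LD H)
    moreover have "(\<integral>x. H i x * Lap (H j) x \<partial>smeas) = (\<integral>x. - eigen d j * (H i x * H j x) \<partial>smeas)"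
      by (intro Bochner_Integration.integral_cong refl) (simp add: eigen)
    ultimately show ?thesis by simp
  qed
  have "eigen d j * (\<integral>x. H i x * H j x \<partial>smeas) = eigen d i * (\<integral>x. H i x * H j x \<partial>smeas)"
    using *[of j i] *[of i j] Gam_commute[of "H i" "H j"] by (simp add: mult.commute[of "H j _"])
  moreover have "eigen d i \<noteq> eigen d j"
    using assms eigen_mono[OF d_pos, of i j] eigen_mono[OF d_pos, of j i] by (cases i j rule: linorder_cases) auto
  ultimately show ?thesis by simp
qed

text \<open>In the orthogonal expansion both sides are sums over the modes: subtracting the squared
  mean removes the constant mode, and every other eigenvalue is at least \<open>d\<close>.\<close>

lemma poincare_flow_0:
  "d * ((\<integral>x. (flow 0 x)\<^sup>2 \<partial>smeas) - (\<integral>x. flow 0 x \<partial>smeas)\<^sup>2) \<le> (\<integral>x. Gam (flow 0) (flow 0) x \<partial>smeas)"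
proof -
  have f0: "flow 0 = (\<lambda>x. \<Sum>j\<le>N. H j x)" by (simp add: flow_def)
  have int: "integrable smeas (\<lambda>x. H i x * H j x)" for i j
    by (intro integrable_smeas_continuous continuous_on_mult rpoly_continuous_on H)
  have int1: "integrable smeas (H j)" for j
    by (intro integrable_smeas_continuous rpoly_continuous_on H)
  have mean: "(\<integral>x. flow 0 x \<partial>smeas) = c"
  proof -
    have "(\<integral>x. flow 0 x \<partial>smeas) = (\<Sum>j\<le>N. \<integral>x. H j x \<partial>smeas)"
      unfolding f0 by (rule Bochner_Integration.integral_sum) (rule int1)
    also have "\<dots> = (\<Sum>j\<le>N. if j = 0 then c else 0)"
      by (intro sum.cong refl) (auto simp: integral_H H0)
    finally show ?thesis by simp
  qed
  have quad: "(\<integral>x. (\<Sum>i\<le>N. H i x) * (\<Sum>j\<le>N. e j * H j x) \<partial>smeas) = (\<Sum>j\<le>N. e j * (\<integral>x. H j x * H j x \<partial>smeas))" for e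
  proof -
    have "(\<integral>x. (\<Sum>i\<le>N. H i x) * (\<Sum>j\<le>N. e j * H j x) \<partial>smeas) = (\<integral>x. (\<Sum>i\<le>N. \<Sum>j\<le>N. e j * (H i x * H j x)) \<partial>smeas)"
      by (simp add: sum_product mult_ac)
    also have "\<dots> = (\<Sum>i\<le>N. \<integral>x. (\<Sum>j\<le>N. e j * (H i x * H j x)) \<partial>smeas)"
      by (intro Bochner_Integration.integral_sum Bochner_Integration.integrable_sum integrable_mult_right int)
    also have "\<dots> = (\<Sum>i\<le>N. \<Sum>j\<le>N. e j * (\<integral>x. H i x * H j x \<partial>smeas))"
      by (subst Bochner_Integration.integral_sum) (auto intro: integrable_mult_right int)
    also have "\<dots> = (\<Sum>i\<le>N. \<Sum>j\<le>N. if j = i then e i * (\<integral>x. H i x * H i x \<partial>smeas) else 0)"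
      by (intro sum.cong refl) (auto simp: integral_H_orthogonal)
    also have "\<dots> = (\<Sum>j\<le>N. e j * (\<integral>x. H j x * H j x \<partial>smeas))" by simp
    finally show ?thesis .
  qed
  define h where "h j = (\<integral>x. H j x * H j x \<partial>smeas)" for j
  have h: "h j \<ge> 0" for j unfolding h_def by (intro Bochner_Integration.integral_nonneg) auto
  have h0: "h 0 = c\<^sup>2" by (simp add: h_def H0 power2_eq_square)
  have sq: "(\<integral>x. (flow 0 x)\<^sup>2 \<partial>smeas) = (\<Sum>j\<le>N. h j)"
    using quad[of "\<lambda>_. 1"] by (simp add: f0 power2_eq_square h_def)
  have "(\<integral>x. flow 0 x * Lap (flow 0) x \<partial>smeas) = - (\<integral>x. Gam (flow 0) (flow 0) x \<partial>smeas)"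
    by (intro integral_Lap_by_parts C1S_rpoly rpoly_LD rpoly_flow)
  then have "(\<integral>x. Gam (flow 0) (flow 0) x \<partial>smeas) = - (\<integral>x. flow 0 x * Lap (flow 0) x \<partial>smeas)" by simp
  also have "(\<integral>x. flow 0 x * Lap (flow 0) x \<partial>smeas) = (\<integral>x. (\<Sum>i\<le>N. H i x) * (\<Sum>j\<le>N. (- eigen d j) * H j x) \<partial>smeas)"
  proof (intro Bochner_Integration.integral_cong refl)
    fix x :: "real^'n" assume "x \<in> space smeas"
    then have "Lap (flow 0) x = dflow 0 x" by (intro Lap_flow) simp
    then show "flow 0 x * Lap (flow 0) x = (\<Sum>i\<le>N. H i x) * (\<Sum>j\<le>N. (- eigen d j) * H j x)"
      by (simp only: dflow_def) (simp add: f0)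
  qed
  also have "\<dots> = (\<Sum>j\<le>N. - eigen d j * h j)" unfolding quad h_def ..
  finally have G: "(\<integral>x. Gam (flow 0) (flow 0) x \<partial>smeas) = (\<Sum>j\<le>N. eigen d j * h j)"
    by (simp add: sum_negf)
  have "d * ((\<Sum>j\<le>N. h j) - c\<^sup>2) = (\<Sum>j\<in>{..N} - {0}. d * h j)"
    using sum.remove[of "{..N}" 0 h] by (simp add: h0 sum_distrib_left)
  also have "\<dots> \<le> (\<Sum>j\<in>{..N} - {0}. eigen d j * h j)"
    by (intro sum_mono mult_right_mono eigen_ge h) auto
  also have "\<dots> \<le> (\<Sum>j\<le>N. eigen d j * h j)"
    by (intro sum_mono2) (auto intro: mult_nonneg_nonneg eigen_nonneg h)
  finally show ?thesis unfolding sq mean G .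
qed

end

text \<open>The convolution is linear in its kernel, so splitting the kernel into Gegenbauer
  eigenfunctions splits the convolution into eigenfunctions of \<open>Lap\<close>, whatever the
  continuous function \<open>f\<close> is.\<close>

lemma zonal_heat_flow:
  fixes f :: "real^'n::finite \<Rightarrow> real"
  assumes f: "continuous_on (sphere 0 1) f" and n: "CARD('n) \<ge> 2"
  obtains H N c where "heat_flow H c (real CARD('n) - 1)" "heat_flow.flow H N (real CARD('n) - 1) 0 = zonal q f"
proof -
  define d where "d = real CARD('n) - 1"
  have d: "d > 0" using n by (simp add: d_def)
  obtain N Z where Z: "q = (\<Sum>j\<le>N. Z j)" "\<And>j. zonal_op d (Z j) = smult (- eigen d j) (Z j)" "\<exists>c. Z 0 = [:c:]"
    using poly_eigen_decomposition[OF d, of q] by metis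
  obtain c where c: "Z 0 = [:c:]" using Z(3) by blast
  have hf: "heat_flow (\<lambda>j. zonal (Z j) f) (c * (\<integral>y. f y \<partial>smeas)) d"
  proof
    fix j and x :: "real^'n" assume "x \<in> sphere 0 1"
    then show "Lap (zonal (Z j) f) x = - eigen d j * zonal (Z j) f x"
      by (simp only: Lap_zonal[OF f] d_def[symmetric] Z(2) zonal_smult)
  qed (use f n in \<open>auto simp: c zonal_const d_def\<close>)
  moreover have "heat_flow.flow (\<lambda>j. zonal (Z j) f) N d 0 = zonal q f"
    unfolding heat_flow.flow_def[OF hf] Z(1) by (simp add: zonal_sum[OF f] fun_eq_iff)
  ultimately show ?thesis using that unfolding d_def by blast
qed

section \<open>Poincare inequality on the sphere\<close>

lemma integral_limit_bounded:
  fixes g :: "real^'n::finite \<Rightarrow> real"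
  assumes "\<And>k. continuous_on (sphere 0 1) (f k)" "continuous_on (sphere 0 1) g"
    and "\<And>x. x \<in> sphere 0 1 \<Longrightarrow> (\<lambda>k. f k x) \<longlonglongrightarrow> g x"
    and "\<And>k x. x \<in> sphere 0 1 \<Longrightarrow> \<bar>f k x\<bar> \<le> B"
  shows "(\<lambda>k. \<integral>x. f k x \<partial>smeas) \<longlonglongrightarrow> (\<integral>x. g x \<partial>smeas)"
  by (rule integral_dominated_convergence[where w = "\<lambda>_. B"])
     (use assms in \<open>auto intro!: measurable_smeas_continuous AE_I2\<close>)

lemma avg_abs_le:
  fixes f :: "real^'n::finite \<Rightarrow> real"
  assumes f: "continuous_on (sphere 0 1) f" and B: "\<And>y. y \<in> sphere 0 1 \<Longrightarrow> \<bar>f y\<bar> \<le> B"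
    and x: "x \<in> sphere 0 1" and n: "CARD('n) \<ge> 2"
  shows "\<bar>avg k f x\<bar> \<le> B"
proof -
  have "- B \<le> avg k f x"
  proof (rule avg_ge[OF f _ x n])
    fix y :: "real^'n" assume "y \<in> sphere 0 1"
    from B[OF this] show "- B \<le> f y" by linarith
  qed
  moreover have "- B \<le> avg k (\<lambda>y. - f y) x"
  proof (rule avg_ge[OF continuous_on_minus[OF f] _ x n])
    fix y :: "real^'n" assume "y \<in> sphere 0 1"
    from B[OF this] show "- B \<le> - f y" by linarith
  qed
  moreover have "avg k (\<lambda>y. - f y) x = - avg k f x"
    by (simp add: zonal_def)
  ultimately show ?thesis by linarith
qed

lemma avg_tendsto:
  fixes f :: "real^'n::finite \<Rightarrow> real"
  assumes "continuous_on (sphere 0 1) f" "x \<in> sphere 0 1" "CARD('n) \<ge> 2"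
  shows "(\<lambda>k. avg k f x) \<longlonglongrightarrow> f x"
  using tendsto_uniform_limitI[OF avg_uniform_limit] assms by blast

lemma LD_avg_tendsto:
  fixes f :: "real^'n::finite \<Rightarrow> real"
  assumes "C1S f" "x \<in> sphere 0 1" "CARD('n) \<ge> 2"
  shows "(\<lambda>k. LD a (avg k f) x) \<longlonglongrightarrow> LD a f x"
  using avg_tendsto[OF C1S_cont_LD[OF assms(1)] assms(2,3)] by (simp add: LD_zonal[OF assms(1)])

lemma Gam_avg_tendsto:
  fixes f :: "real^'n::finite \<Rightarrow> real"
  assumes "C1S f" "x \<in> sphere 0 1" "CARD('n) \<ge> 2"
  shows "(\<lambda>k. Gam (avg k f) (avg k f) x) \<longlonglongrightarrow> Gam f f x"
  unfolding Gam_def using LD_avg_tendsto[OF assms] by (intro tendsto_intros) auto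

text \<open>The averages commute with the rotation fields, so the bounds of \<open>f\<close> and of
  all \<open>LD a f\<close> are inherited uniformly in \<open>k\<close>.\<close>

lemma avg_bounds:
  fixes f :: "real^'n::finite \<Rightarrow> real"
  assumes f: "C1S f" and n: "CARD('n) \<ge> 2"
  obtains B where "B > 0" "\<And>k x. x \<in> sphere 0 1 \<Longrightarrow> \<bar>avg k f x\<bar> \<le> B"
    "\<And>k x. x \<in> sphere 0 1 \<Longrightarrow> Gam (avg k f) (avg k f) x \<le> B"
proof -
  obtain B0 where B0: "\<And>x. x \<in> sphere 0 1 \<Longrightarrow> \<bar>f x\<bar> \<le> B0" "B0 > 0"
    using continuous_sphere_bounded[OF C1S_cont[OF f]] by blast
  have "\<exists>B. \<forall>x. x \<in> sphere 0 1 \<longrightarrow> \<bar>LD a f x\<bar> \<le> B" for a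
    using continuous_sphere_bounded[OF C1S_cont_LD[OF f, of a]] by metis
  then obtain b where b: "\<And>a x. x \<in> sphere 0 1 \<Longrightarrow> \<bar>LD a f x\<bar> \<le> b a" by metis
  define B1 where "B1 = (\<Sum>a\<in>UNIV. (b a)\<^sup>2) / 2"
  have B1: "B1 \<ge> 0" by (simp add: B1_def sum_nonneg)
  have "Gam (avg k f) (avg k f) x \<le> B1" if x: "x \<in> sphere 0 1" for k x
  proof -
    have "LD a (avg k f) x * LD a (avg k f) x \<le> (b a)\<^sup>2" for a
    proof -
      have "\<bar>LD a (avg k f) x\<bar> \<le> b a"
        unfolding LD_zonal[OF f] by (rule avg_abs_le[OF C1S_cont_LD[OF f] b x n])
      then have "\<bar>LD a (avg k f) x\<bar>\<^sup>2 \<le> (b a)\<^sup>2" by (intro power_mono) auto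
      then show ?thesis by (simp add: power2_eq_square)
    qed
    then show ?thesis unfolding Gam_def B1_def by (intro divide_right_mono sum_mono) auto
  qed
  moreover have "\<bar>avg k f x\<bar> \<le> B0" if "x \<in> sphere 0 1" for k x
    using avg_abs_le[OF C1S_cont[OF f] B0(1) that n] .
  ultimately show thesis
    using B0(2) B1 by (intro that[of "B0 + B1"]) (force intro: add_increasing add_increasing2)+
qed

lemma poincare_sphere:
  fixes f :: "real^'n::finite \<Rightarrow> real"
  assumes f: "C1S f" and n: "CARD('n) \<ge> 2"
  shows "(real CARD('n) - 1) * ((\<integral>x. (f x)\<^sup>2 \<partial>smeas) - (\<integral>x. f x \<partial>smeas)\<^sup>2) \<le> (\<integral>x. Gam f f x \<partial>smeas)"
proof -
  let ?d = "real CARD('n) - 1"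
  have fc: "continuous_on (sphere 0 1) f" using f by (rule C1S_cont)
  obtain B where B: "B > 0" "\<And>k x. x \<in> sphere 0 1 \<Longrightarrow> \<bar>avg k f x\<bar> \<le> B"
    "\<And>k x. x \<in> sphere 0 1 \<Longrightarrow> Gam (avg k f) (avg k f) x \<le> B"
    using avg_bounds[OF f n] by metis
  have ac: "continuous_on (sphere 0 1) (avg k f)" for k by (intro rpoly_continuous_on[OF rpoly_zonal] fc)
  have le: "?d * ((\<integral>x. (avg k f x)\<^sup>2 \<partial>smeas) - (\<integral>x. avg k f x \<partial>smeas)\<^sup>2) \<le> (\<integral>x. Gam (avg k f) (avg k f) x \<partial>smeas)" for k
  proof -
    obtain H N c where "heat_flow H c ?d" "heat_flow.flow H N ?d 0 = avg k f"
      using zonal_heat_flow[OF fc n, of "avg_poly ?d k"] by metis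
    then show ?thesis using heat_flow.poincare_flow_0[of H c ?d N] by simp
  qed
  have l1: "(\<lambda>k. \<integral>x. (avg k f x)\<^sup>2 \<partial>smeas) \<longlonglongrightarrow> (\<integral>x. (f x)\<^sup>2 \<partial>smeas)"
  proof (rule integral_limit_bounded[where B = "B\<^sup>2"])
    show "\<bar>(avg k f x)\<^sup>2\<bar> \<le> B\<^sup>2" if "x \<in> sphere 0 1" for k x
      using power_mono[OF B(2)[OF that, of k], of 2] by simp
  qed (auto intro!: continuous_intros tendsto_intros ac fc avg_tendsto n)
  have l2: "(\<lambda>k. \<integral>x. avg k f x \<partial>smeas) \<longlonglongrightarrow> (\<integral>x. f x \<partial>smeas)"
    by (rule integral_limit_bounded[where B = B]) (use B ac fc n in \<open>auto intro!: avg_tendsto\<close>)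
  have l3: "(\<lambda>k. \<integral>x. Gam (avg k f) (avg k f) x \<partial>smeas) \<longlonglongrightarrow> (\<integral>x. Gam f f x \<partial>smeas)"
  proof (rule integral_limit_bounded[where B = B])
    show "continuous_on (sphere 0 1) (Gam (avg k f) (avg k f))" for k
      by (intro rpoly_continuous_on[OF rpoly_Gam] rpoly_zonal fc)
    show "\<bar>Gam (avg k f) (avg k f) x\<bar> \<le> B" if "x \<in> sphere 0 1" for k x
      using B(3)[OF that] Gam_self_nonneg[of "avg k f" x] by simp
  qed (use f n in \<open>auto intro: continuous_Gam Gam_avg_tendsto\<close>)
  show ?thesis
  proof (rule LIMSEQ_le[OF _ l3])
    show "(\<lambda>k. ?d * ((\<integral>x. (avg k f x)\<^sup>2 \<partial>smeas) - (\<integral>x. avg k f x \<partial>smeas)\<^sup>2))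
      \<longlonglongrightarrow> ?d * ((\<integral>x. (f x)\<^sup>2 \<partial>smeas) - (\<integral>x. f x \<partial>smeas)\<^sup>2)"
      by (intro tendsto_intros l1 l2)
  qed (use le in blast)
qed

text \<open>\<open>g\<close> plays the role of the gradient \<open>LD a f\<close>, which need only be differentiable along the sphere.\<close>

lemma spectral_gap_sphere:
  fixes f :: "real^'n::finite \<Rightarrow> real"
  assumes f: "C1S f" and g: "\<And>a. C1S (g a)" "\<And>a x. x \<in> sphere 0 1 \<Longrightarrow> g a x = LD a f x"
    and n: "CARD('n) \<ge> 2"
  shows "(real CARD('n) - 1) * (\<integral>x. Gam f f x \<partial>smeas) \<le> (\<integral>x. ((\<Sum>a\<in>UNIV. LD a (g a) x) / 2)\<^sup>2 \<partial>smeas)"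
proof -
  let ?d = "real CARD('n) - 1"
  have d: "?d > 0" using n by simp
  define L where "L = (\<lambda>x. (\<Sum>a\<in>UNIV. LD a (g a) x) / 2)"
  define m where "m = (\<integral>x. f x \<partial>smeas)"
  have fc: "continuous_on (sphere 0 1) f" using f by (rule C1S_cont)
  have Lc: "continuous_on (sphere 0 1) L" unfolding L_def using g(1) by (intro continuous_intros C1S_cont_LD) auto
  have C1h: "C1S (\<lambda>x. f x + - m)" by (intro C1S_add f C1S_rpoly rpoly_const)
  have LDh: "LD a (\<lambda>x. f x + - m) x = LD a f x" if "x \<in> sphere 0 1" for a x
    using f that by (subst LD_add) auto
  have "(\<integral>x. (f x - m) * L x \<partial>smeas) = (\<integral>x. (\<Sum>a\<in>UNIV. (f x + - m) * LD a (g a) x / 2) \<partial>smeas)"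
    by (simp add: L_def sum_distrib_left sum_divide_distrib)
  also have "\<dots> = (\<Sum>a\<in>UNIV. (\<integral>x. (f x + - m) * LD a (g a) x / 2 \<partial>smeas))"
    by (intro Bochner_Integration.integral_sum integrable_smeas_continuous continuous_on_divide continuous_on_mult
       continuous_on_const C1S_cont[OF C1h] C1S_cont_LD g) auto
  also have "\<dots> = (\<Sum>a\<in>UNIV. - (\<integral>x. LD a f x * LD a f x / 2 \<partial>smeas))"
  proof (intro sum.cong refl)
    fix a :: "'n \<times> 'n"
    have "(\<integral>x. (f x + - m) * LD a (g a) x / 2 \<partial>smeas) = - (\<integral>x. LD a (\<lambda>x. f x + - m) x * g a x \<partial>smeas) / 2"
      using integral_LD_by_parts[OF C1h g(1), of a a] by simp
    also have "(\<integral>x. LD a (\<lambda>x. f x + - m) x * g a x \<partial>smeas) = (\<integral>x. LD a f x * LD a f x \<partial>smeas)"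
    proof (intro Bochner_Integration.integral_cong refl)
      fix x :: "real^'n" assume "x \<in> space smeas"
      then have "x \<in> sphere 0 1" by simp
      then show "LD a (\<lambda>x. f x + - m) x * g a x = LD a f x * LD a f x" by (simp only: LDh g(2))
    qed
    finally show "(\<integral>x. (f x + - m) * LD a (g a) x / 2 \<partial>smeas) = - (\<integral>x. LD a f x * LD a f x / 2 \<partial>smeas)" by simp
  qed
  also have "\<dots> = - (\<Sum>a\<in>UNIV. \<integral>x. LD a f x * LD a f x / 2 \<partial>smeas)" by (rule sum_negf)
  also have "(\<Sum>a\<in>UNIV. \<integral>x. LD a f x * LD a f x / 2 \<partial>smeas) = (\<integral>x. (\<Sum>a\<in>UNIV. LD a f x * LD a f x / 2) \<partial>smeas)"
    by (intro Bochner_Integration.integral_sum[symmetric] integrable_smeas_continuous continuous_on_divide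
       continuous_on_mult continuous_on_const C1S_cont_LD f) auto
  also have "\<dots> = (\<integral>x. Gam f f x \<partial>smeas)" by (simp add: Gam_def sum_divide_distrib)
  finally have 1: "(\<integral>x. Gam f f x \<partial>smeas) = - (\<integral>x. (f x - m) * L x \<partial>smeas)" by simp
  have i1: "integrable smeas (\<lambda>x. ?d * (f x - m)\<^sup>2)" "integrable smeas (\<lambda>x. (L x)\<^sup>2 / ?d)"
    "integrable smeas (\<lambda>x. (f x)\<^sup>2)" "integrable smeas (\<lambda>x. 2 * m * f x)"
    using d by (intro integrable_smeas_continuous continuous_intros fc Lc; simp)+
  have i2: "integrable smeas (\<lambda>x. - 2 * ((f x - m) * L x))"
    by (intro integrable_smeas_continuous continuous_intros fc Lc)
  \<comment> \<open>Young's inequality with weight \<open>?d\<close>: by the Poincare inequality its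
    first term costs at most one copy of the Dirichlet integral, which leaves the other copy on the
    left.\<close>
  have "2 * (\<integral>x. Gam f f x \<partial>smeas) = (\<integral>x. - 2 * ((f x - m) * L x) \<partial>smeas)"
    unfolding 1 by simp
  also have "\<dots> \<le> (\<integral>x. ?d * (f x - m)\<^sup>2 + (L x)\<^sup>2 / ?d \<partial>smeas)"
  proof (intro Bochner_Integration.integral_mono Bochner_Integration.integrable_add i1 i2)
    fix x :: "real^'n"
    have "0 \<le> (?d * (f x - m) + L x)\<^sup>2 / ?d" using d by simp
    also have "\<dots> = ?d * (f x - m)\<^sup>2 + 2 * ((f x - m) * L x) + (L x)\<^sup>2 / ?d"
      using d by (simp add: power2_eq_square field_simps)
    finally show "- 2 * ((f x - m) * L x) \<le> ?d * (f x - m)\<^sup>2 + (L x)\<^sup>2 / ?d" by simp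
  qed
  also have "\<dots> = ?d * (\<integral>x. (f x - m)\<^sup>2 \<partial>smeas) + (\<integral>x. (L x)\<^sup>2 \<partial>smeas) / ?d"
    using i1 by simp
  also have "(\<integral>x. (f x - m)\<^sup>2 \<partial>smeas) = (\<integral>x. (f x)\<^sup>2 - 2 * m * f x + m\<^sup>2 \<partial>smeas)"
    by (intro Bochner_Integration.integral_cong refl) (simp add: power2_eq_square algebra_simps)
  also have "\<dots> = (\<integral>x. (f x)\<^sup>2 \<partial>smeas) - m\<^sup>2"
    using i1(3,4) by (simp add: m_def power2_eq_square)
  also have "?d * \<dots> \<le> (\<integral>x. Gam f f x \<partial>smeas)"
    unfolding m_def by (rule poincare_sphere[OF f n])
  finally have "(\<integral>x. Gam f f x \<partial>smeas) \<le> (\<integral>x. (L x)\<^sup>2 \<partial>smeas) / ?d" by simp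
  then have "?d * (\<integral>x. Gam f f x \<partial>smeas) \<le> (\<integral>x. (L x)\<^sup>2 \<partial>smeas)" using d by (simp add: field_simps)
  then show ?thesis unfolding L_def .
qed

text \<open>This is the spectral gap for \<open>u = r powr (1 - z)\<close>, whose gradient is
  \<open>(1 - z) * r powr (- z)\<close> times that of \<open>r\<close>; both sides carry the factor
  \<open>(1 - z)\<^sup>2\<close>, which can be cancelled.\<close>

lemma spectral_gap_powr:
  fixes r :: "real^'n::finite \<Rightarrow> real"
  assumes r: "rpoly r" and pos: "\<And>x. x \<in> sphere 0 1 \<Longrightarrow> r x > 0" and n: "CARD('n) = 2" and z: "z \<noteq> 1"
  shows "(\<integral>x. r x powr (- 2 * z) * Gam r r x \<partial>smeas)
      \<le> (\<integral>x. r x powr (- 2 * z) * (Lap r x)\<^sup>2 \<partial>smeas)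
         - 2 * z * (\<integral>x. r x powr (- 2 * z - 1) * (Gam r r x * Lap r x) \<partial>smeas)
         + z\<^sup>2 * (\<integral>x. r x powr (- 2 * z - 2) * (Gam r r x)\<^sup>2 \<partial>smeas)"
proof -
  define s where "s = 1 - z"
  have s: "s \<noteq> 0" using z by (simp add: s_def)
  define u where "u = (\<lambda>x. r x powr s)"
  define g where "g = (\<lambda>a x. (s * r x powr (s - 1)) * LD a r x)"
  have C1w: "C1S (\<lambda>x. r x powr e)" for e using r pos by (intro C1S_powr C1S_rpoly)
  have C1c: "C1S (\<lambda>x. s * r x powr e)" for e
    by (intro C1S_mult C1w C1S_rpoly rpoly_const)
  have u: "C1S u" unfolding u_def by (rule C1w)
  have g: "C1S (g a)" for a unfolding g_def using r by (intro C1S_mult C1c C1S_rpoly rpoly_LD)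
  have LDu: "g a x = LD a u x" if "x \<in> sphere 0 1" for a x
    unfolding g_def u_def using r pos that by (subst LD_powr) auto
  have int: "integrable smeas (\<lambda>x. r x powr e * q x)" if "rpoly q" for e q
    using that by (intro integrable_smeas_continuous continuous_on_mult C1S_cont[OF C1w] rpoly_continuous_on)
  have polys2: "rpoly (\<lambda>x. Gam r r x * Lap r x)" "rpoly (\<lambda>x. (Lap r x)\<^sup>2)" "rpoly (\<lambda>x. (Gam r r x)\<^sup>2)"
    using r by (auto intro!: rpoly_mult real_polynomial_function_power)
  \<comment> \<open>Every weight is \<open>v\<close> or \<open>v * v\<close> times a power of
    \<open>r x\<close>, so comparing the integrands becomes ring arithmetic.\<close>
  have pw: "r x powr (s - 1) = v * r x" "r x powr (s - 1 - 1) = v" "r x powr (- 2 * z) = v * v * (r x * r x)"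
    "r x powr (- 2 * z - 1) = v * v * r x" "r x powr (- 2 * z - 2) = v * v"
    if "x \<in> sphere 0 1" "v = r x powr (s - 2)" for x v
  proof -
    have v: "v = r x powr (s - 2)" by (rule that(2))
    have m: "r x powr e' = r x powr e * r x ^ k" if "e' = e + real k" for e e' and k :: nat
      unfolding that using pos[OF \<open>x \<in> sphere 0 1\<close>] by (simp add: powr_add powr_realpow)
    have vv: "r x powr ((s - 2) + (s - 2)) = v * v" unfolding v by (rule powr_add)
    show "r x powr (s - 1) = v * r x"
      using m[of "s - 1" "s - 2" 1] by (simp add: v)
    show "r x powr (s - 1 - 1) = v"
      using m[of "s - 1 - 1" "s - 2" 0] by (simp add: v)
    show "r x powr (- 2 * z) = v * v * (r x * r x)"
      using m[of "- 2 * z" "(s - 2) + (s - 2)" 2] unfolding vv by (simp add: s_def power2_eq_square)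
    show "r x powr (- 2 * z - 1) = v * v * r x"
      using m[of "- 2 * z - 1" "(s - 2) + (s - 2)" 1] unfolding vv by (simp add: s_def)
    show "r x powr (- 2 * z - 2) = v * v"
      using m[of "- 2 * z - 2" "(s - 2) + (s - 2)" 0] unfolding vv by (simp add: s_def)
  qed
  have L: "(\<Sum>a\<in>UNIV. LD a (g a) x) / 2 = s * r x powr (s - 1) * Lap r x + s * (s - 1) * r x powr (s - 1 - 1) * Gam r r x"
    if x: "x \<in> sphere 0 1" for x
  proof -
    have "LD a (g a) x = s * r x powr (s - 1) * LD a (LD a r) x + s * ((s - 1) * r x powr (s - 1 - 1) * LD a r x) * LD a r x" for a
    proof -
      have "LD a (\<lambda>x. s * r x powr (s - 1)) x = s * ((s - 1) * r x powr (s - 1 - 1) * LD a r x)"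
        using LD_cmult[OF C1S_diff[OF C1w x], of a s] LD_powr[OF rpoly_diff[OF r] pos[OF x]] by simp
      then show ?thesis
        unfolding g_def using LD_mult[OF C1S_diff[OF C1c x] rpoly_diff[OF rpoly_LD[OF r]]] by simp
    qed
    then show ?thesis
      by (simp add: Lap_def Gam_def sum.distrib add_divide_distrib sum_distrib_left mult_ac)
  qed
  have "s\<^sup>2 * (\<integral>x. r x powr (- 2 * z) * Gam r r x \<partial>smeas) = (\<integral>x. Gam u u x \<partial>smeas)"
    unfolding integral_mult_right_zero[symmetric]
  proof (intro Bochner_Integration.integral_cong refl)
    fix x :: "real^'n" assume "x \<in> space smeas"
    then have x: "x \<in> sphere 0 1" by simp
    have "Gam u u x = (s * r x powr (s - 1)) * (s * r x powr (s - 1)) * Gam r r x"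
      unfolding Gam_def LDu[OF x, symmetric] g_def by (simp add: sum_distrib_left mult_ac)
    then show "s\<^sup>2 * (r x powr (- 2 * z) * Gam r r x) = Gam u u x"
      unfolding pw[OF x refl] by (simp add: power2_eq_square)
  qed
  also have "\<dots> \<le> (\<integral>x. ((\<Sum>a\<in>UNIV. LD a (g a) x) / 2)\<^sup>2 \<partial>smeas)"
    using spectral_gap_sphere[OF u g LDu] n by simp
  also have "\<dots> = (\<integral>x. s\<^sup>2 * (r x powr (- 2 * z) * (Lap r x)\<^sup>2 + (- 2 * z) * (r x powr (- 2 * z - 1) * (Gam r r x * Lap r x))
      + z\<^sup>2 * (r x powr (- 2 * z - 2) * (Gam r r x)\<^sup>2)) \<partial>smeas)"
  proof (intro Bochner_Integration.integral_cong refl)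
    fix x :: "real^'n" assume "x \<in> space smeas"
    then have x: "x \<in> sphere 0 1" by simp
    have z: "z = 1 - s" by (simp add: s_def)
    show "((\<Sum>a\<in>UNIV. LD a (g a) x) / 2)\<^sup>2 = s\<^sup>2 * (r x powr (- 2 * z) * (Lap r x)\<^sup>2 + (- 2 * z) * (r x powr (- 2 * z - 1) * (Gam r r x * Lap r x))
      + z\<^sup>2 * (r x powr (- 2 * z - 2) * (Gam r r x)\<^sup>2))"
      unfolding L[OF x] pw[OF x refl] unfolding z by (simp add: power2_eq_square algebra_simps)
  qed
  also have "\<dots> = s\<^sup>2 * ((\<integral>x. r x powr (- 2 * z) * (Lap r x)\<^sup>2 \<partial>smeas)
         - 2 * z * (\<integral>x. r x powr (- 2 * z - 1) * (Gam r r x * Lap r x) \<partial>smeas)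
         + z\<^sup>2 * (\<integral>x. r x powr (- 2 * z - 2) * (Gam r r x)\<^sup>2 \<partial>smeas))"
    using int[OF polys2(1), of "- 2 * z - 1"] int[OF polys2(2), of "- 2 * z"] int[OF polys2(3), of "- 2 * z - 2"]
    by simp
  finally show ?thesis using s by simp
qed

section \<open>Monotonicity along the heat flow\<close>

text \<open>A power is monotone, in a direction that depends on the sign of \<open>e\<close>; the
  sum of the endpoint values covers both cases.\<close>

lemma powr_between_bound:
  fixes v m B e :: real
  assumes "0 < m" "m \<le> v" "v \<le> B"
  shows "v powr e \<le> m powr e + B powr e"
proof (cases "e \<ge> 0")
  case True
  then have "v powr e \<le> B powr e" using assms by (intro powr_mono2) auto
  then show ?thesis by (simp add: add_increasing)
next
  case False
  then have "v powr e \<le> m powr e" using assms by (intro powr_mono2') auto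
  then show ?thesis by (simp add: add_increasing2)
qed

lemma Cauchy_Schwarz_integral:
  fixes f g :: "'a \<Rightarrow> real"
  assumes "integrable M (\<lambda>x. (f x)\<^sup>2)" "integrable M (\<lambda>x. (g x)\<^sup>2)" "integrable M (\<lambda>x. f x * g x)"
  shows "(\<integral>x. f x * g x \<partial>M)\<^sup>2 \<le> (\<integral>x. (f x)\<^sup>2 \<partial>M) * (\<integral>x. (g x)\<^sup>2 \<partial>M)"
proof -
  define A where "A = (\<integral>x. (f x)\<^sup>2 \<partial>M)"
  define B where "B = (\<integral>x. f x * g x \<partial>M)"
  define C where "C = (\<integral>x. (g x)\<^sup>2 \<partial>M)"
  have quad: "0 \<le> t\<^sup>2 * A + 2 * t * s * B + s\<^sup>2 * C" for s t
  proof -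
    have "0 \<le> (\<integral>x. (t * f x + s * g x)\<^sup>2 \<partial>M)" by (intro Bochner_Integration.integral_nonneg) auto
    also have "\<dots> = (\<integral>x. t\<^sup>2 * (f x)\<^sup>2 + 2 * t * s * (f x * g x) + s\<^sup>2 * (g x)\<^sup>2 \<partial>M)"
      by (intro Bochner_Integration.integral_cong refl) (simp add: power2_eq_square algebra_simps)
    also have "\<dots> = t\<^sup>2 * A + 2 * t * s * B + s\<^sup>2 * C"
      using assms by (simp add: A_def B_def C_def)
    finally show ?thesis .
  qed
  have "A \<ge> 0" unfolding A_def by (intro Bochner_Integration.integral_nonneg) auto
  show "B\<^sup>2 \<le> A * C"
  proof (cases "A = 0")
    case True
    have "B = 0"
    proof (rule ccontr)
      assume "B \<noteq> 0"
      \<comment> \<open>When \<open>A\<close> vanishes, a nonzero \<open>B\<close> would let the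
        nonnegative quadratic form take the value -1.\<close>
      then have "2 * (- (C + 1) / (2 * B)) * 1 * B = - (C + 1)" by simp
      with quad[of "- (C + 1) / (2 * B)" 1] True show False by simp
    qed
    with True show ?thesis by simp
  next
    case False
    then have "A > 0" using \<open>A \<ge> 0\<close> by simp
    have "0 \<le> A * (A * C - B\<^sup>2)" using quad[of "- B" A] by (simp add: power2_eq_square algebra_simps)
    then show ?thesis using \<open>A > 0\<close> by (simp add: zero_le_mult_iff)
  qed
qed

context heat_flow
begin

lemma integral_flow_0: "(\<integral>x. flow 0 x \<partial>smeas) = c"
proof -
  have int1: "integrable smeas (H j)" for j
    by (intro integrable_smeas_continuous rpoly_continuous_on H)
  have "(\<integral>x. flow 0 x \<partial>smeas) = (\<Sum>j\<le>N. \<integral>x. H j x \<partial>smeas)"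
    unfolding flow_def by (subst Bochner_Integration.integral_sum[symmetric]) (auto intro: int1)
  also have "\<dots> = (\<Sum>j\<le>N. if j = 0 then c else 0)"
    by (intro sum.cong refl) (auto simp: integral_H H0)
  finally show ?thesis by simp
qed

end

text \<open>To be read with \<open>z = 1 - 1 / p\<close> and \<open>u = flow t powr (1 - z)\<close>:
  then \<open>sq_norm\<close> below is the integral of \<open>u\<^sup>2\<close>,
  \<open>dirichlet\<close> that of the squared gradient of \<open>u\<close>, and \<open>gain\<close>
  is \<gamma> times \<open>(1 - z)\<^sup>2\<close>.\<close>

locale positive_heat_flow = heat_flow H N c d
  for H :: "nat \<Rightarrow> real^'n::finite \<Rightarrow> real" and N :: nat and c d :: real +
  fixes m z :: real
  assumes m: "m > 0" "\<And>x. x \<in> sphere 0 1 \<Longrightarrow> m \<le> flow 0 x"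
    and z: "0 \<le> z" "z < 1"
begin

definition sq_norm :: "real \<Rightarrow> real" where
  "sq_norm t = (\<integral>x. flow t x powr (2 - 2 * z) \<partial>smeas)"

definition dirichlet :: "real \<Rightarrow> real" where
  "dirichlet t = (1 - z)\<^sup>2 * (\<integral>x. flow t x powr (- 2 * z) * Gam (flow t) (flow t) x \<partial>smeas)"

definition gain :: real where
  "gain = z * (1 - z) * d / (d + 2) - z\<^sup>2 * (d - 1)\<^sup>2 / (d + 2)\<^sup>2"

definition dirichlet_rate :: "real \<Rightarrow> real" where
  "dirichlet_rate t = (1 - z)\<^sup>2 * (- 2 * z * (\<integral>x. flow t x powr (- 2 * z - 1) * (Gam (flow t) (flow t) x * Lap (flow t) x) \<partial>smeas)
       + 2 * (\<integral>x. flow t x powr (- 2 * z) * Gam (flow t) (Lap (flow t)) x \<partial>smeas))"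

section \<open>Evolution of the squared L^2 norm and of the Dirichlet energy\<close>

lemma flow_ge_m: "t \<ge> 0 \<Longrightarrow> x \<in> sphere 0 1 \<Longrightarrow> m \<le> flow t x"
  using flow_ge[OF m(2)] by blast

lemma flow_pos: "t \<ge> 0 \<Longrightarrow> x \<in> sphere 0 1 \<Longrightarrow> flow t x > 0"
  using flow_ge_m[of t x] m(1) by linarith

lemma C1S_flow_powr: "t \<ge> 0 \<Longrightarrow> C1S (\<lambda>x. flow t x powr e)"
  by (intro C1S_powr C1S_rpoly rpoly_flow flow_pos)

lemma continuous_flow_powr: "t \<ge> 0 \<Longrightarrow> continuous_on (sphere 0 1) (\<lambda>x. flow t x powr e)"
  by (intro C1S_cont C1S_flow_powr)

lemma int_flow: "t \<ge> 0 \<Longrightarrow> rpoly q \<Longrightarrow> integrable smeas (\<lambda>x. flow t x powr e * q x)"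
  by (intro integrable_smeas_continuous continuous_on_mult continuous_flow_powr rpoly_continuous_on)

lemma flow_powr_bound:
  assumes "\<And>t x. t \<ge> 0 \<Longrightarrow> x \<in> sphere 0 1 \<Longrightarrow> \<bar>flow t x\<bar> \<le> B" "t \<ge> 0" "x \<in> sphere 0 1"
  shows "flow t x powr e \<le> m powr e + B powr e"
  using assms(1)[OF assms(2,3)] flow_ge_m[OF assms(2,3)] by (intro powr_between_bound m) auto

lemma flow_powr_deriv:
  assumes "t \<ge> 0" "x \<in> sphere 0 1"
  shows "((\<lambda>t. flow t x powr e) has_real_derivative e * flow t x powr (e - 1) * dflow t x) (at t within {0..})"
proof -
  have "((\<lambda>v. v powr e) has_real_derivative e * flow t x powr (e - 1)) (at (flow t x))"
    using flow_pos[OF assms] by (auto intro!: derivative_eq_intros)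
  from DERIV_chain2[OF this flow_deriv] show ?thesis .
qed

text \<open>For \<open>z = 1 - 1 / p\<close> the coefficient equals \<open>2 * (p - 2)\<close>.
  Positivity and the bounds on the flow are established for nonnegative times, hence the one-sided
  derivative at 0.\<close>

lemma sq_norm_deriv:
  assumes t: "t \<ge> 0"
  shows "(sq_norm has_real_derivative - 2 * (1 - 2 * z) / (1 - z) * dirichlet t) (at t within {0..})"
proof -
  obtain B where B: "B > 0"
    "\<And>t x. t \<ge> 0 \<Longrightarrow> x \<in> sphere 0 1 \<Longrightarrow> \<bar>flow t x\<bar> \<le> B"
    "\<And>t x. t \<ge> 0 \<Longrightarrow> x \<in> sphere 0 1 \<Longrightarrow> \<bar>dflow t x\<bar> \<le> B"
    by (rule flow_bounds) blast
  define e where "e = 2 - 2 * z"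
  have e: "e > 0" using z by (simp add: e_def)
  have "((\<lambda>s. \<integral>x. flow s x powr e \<partial>smeas) has_real_derivative
      (\<integral>x. e * flow t x powr (e - 1) * dflow t x \<partial>smeas)) (at t within {0..})"
  proof (rule has_real_derivative_integral[where B = "e * (m powr (e - 1) + B powr (e - 1)) * B"])
    fix s :: real and x :: "real^'n" assume s: "s \<in> {0..}" and x: "x \<in> space smeas"
    then show "((\<lambda>s. flow s x powr e) has_real_derivative e * flow s x powr (e - 1) * dflow s x) (at s within {0..})"
      by (intro flow_powr_deriv) auto
    have "\<bar>e * flow s x powr (e - 1) * dflow s x\<bar> = e * flow s x powr (e - 1) * \<bar>dflow s x\<bar>"
      using e by (simp add: abs_mult)
    also have "\<dots> \<le> e * (m powr (e - 1) + B powr (e - 1)) * B"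
      using s x e B(1) by (intro mult_mono mult_nonneg_nonneg flow_powr_bound[OF B(2)] B(3)) auto
    finally show "\<bar>e * flow s x powr (e - 1) * dflow s x\<bar> \<le> e * (m powr (e - 1) + B powr (e - 1)) * B" .
  next
    show "integrable smeas (\<lambda>x. flow s x powr e)" if "s \<in> {0..}" for s
      using that by (intro integrable_smeas_continuous continuous_flow_powr) auto
    show "(\<lambda>x. e * flow t x powr (e - 1) * dflow t x) \<in> borel_measurable smeas"
      using t by (intro measurable_smeas_continuous continuous_intros continuous_flow_powr rpoly_continuous_on rpoly_dflow)
  qed (use t in \<open>auto simp: smeas.finite_measure_axioms\<close>)
  moreover have "(\<integral>x. e * flow t x powr (e - 1) * dflow t x \<partial>smeas) = - 2 * (1 - 2 * z) / (1 - z) * dirichlet t"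
  proof -
    have "(\<integral>x. e * flow t x powr (e - 1) * dflow t x \<partial>smeas) = e * (\<integral>x. flow t x powr (e - 1) * Lap (flow t) x \<partial>smeas)"
      unfolding integral_mult_right_zero[symmetric]
      by (intro Bochner_Integration.integral_cong refl) (simp add: Lap_flow)
    also have "(\<integral>x. flow t x powr (e - 1) * Lap (flow t) x \<partial>smeas) = - (\<integral>x. Gam (\<lambda>x. flow t x powr (e - 1)) (flow t) x \<partial>smeas)"
      by (intro integral_Lap_by_parts C1S_flow_powr t C1S_rpoly rpoly_LD rpoly_flow)
    also have "(\<integral>x. Gam (\<lambda>x. flow t x powr (e - 1)) (flow t) x \<partial>smeas)
      = (\<integral>x. (e - 1) * (flow t x powr (- 2 * z) * Gam (flow t) (flow t) x) \<partial>smeas)"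
    proof (intro Bochner_Integration.integral_cong refl)
      fix x :: "real^'n" assume "x \<in> space smeas"
      then have x: "x \<in> sphere 0 1" by simp
      have "e - 1 - 1 = - 2 * z" by (simp add: e_def)
      then show "Gam (\<lambda>x. flow t x powr (e - 1)) (flow t) x = (e - 1) * (flow t x powr (- 2 * z) * Gam (flow t) (flow t) x)"
        using Gam_powr_left[OF rpoly_diff[OF rpoly_flow] flow_pos[OF t x], of "e - 1"] by (simp only: mult.assoc)
    qed
    also have "\<dots> = (e - 1) * (\<integral>x. flow t x powr (- 2 * z) * Gam (flow t) (flow t) x \<partial>smeas)"
      by (rule integral_mult_right_zero)
    finally have eq: "(\<integral>x. e * flow t x powr (e - 1) * dflow t x \<partial>smeas)
      = e * - ((e - 1) * (\<integral>x. flow t x powr (- 2 * z) * Gam (flow t) (flow t) x \<partial>smeas))" .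
    have "e * - ((e - 1) * X) = - 2 * (1 - 2 * z) / (1 - z) * ((1 - z)\<^sup>2 * X)" for X
      using z by (simp add: e_def power2_eq_square) (simp add: algebra_simps)
    then show ?thesis unfolding eq dirichlet_def .
  qed
  ultimately show ?thesis unfolding sq_norm_def[abs_def] e_def by (simp only:)
qed

lemma dirichlet_deriv:
  assumes t: "t \<ge> 0"
  shows "(dirichlet has_real_derivative dirichlet_rate t) (at t within {0..})"
proof -
  obtain B where B: "B > 0"
    "\<And>t x. t \<ge> 0 \<Longrightarrow> x \<in> sphere 0 1 \<Longrightarrow> \<bar>flow t x\<bar> \<le> B"
    "\<And>t x. t \<ge> 0 \<Longrightarrow> x \<in> sphere 0 1 \<Longrightarrow> \<bar>dflow t x\<bar> \<le> B"
    "\<And>t x. t \<ge> 0 \<Longrightarrow> x \<in> sphere 0 1 \<Longrightarrow> Gam (flow t) (flow t) x \<le> B"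
    "\<And>t x. t \<ge> 0 \<Longrightarrow> x \<in> sphere 0 1 \<Longrightarrow> \<bar>Gam (flow t) (dflow t) x\<bar> \<le> B"
    by (rule flow_bounds) blast
  let ?e = "- 2 * z"
  let ?F' = "\<lambda>s x. flow s x powr ?e * (2 * Gam (flow s) (dflow s) x) + ?e * flow s x powr (?e - 1) * dflow s x * Gam (flow s) (flow s) x"
  let ?b = "\<lambda>e. m powr e + B powr e"
  have b: "?b e \<ge> 0" for e by simp
  have "((\<lambda>s. \<integral>x. flow s x powr ?e * Gam (flow s) (flow s) x \<partial>smeas) has_real_derivative
      (\<integral>x. ?F' t x \<partial>smeas)) (at t within {0..})"
  proof (rule has_real_derivative_integral[where B = "?b ?e * (2 * B) + 2 * z * ?b (?e - 1) * B * B"])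
    fix s :: real and x :: "real^'n" assume s': "s \<in> {0..}" and x': "x \<in> space smeas"
    then have s: "s \<ge> 0" and x: "x \<in> sphere 0 1" by auto
    show "((\<lambda>s. flow s x powr ?e * Gam (flow s) (flow s) x) has_real_derivative ?F' s x) (at s within {0..})"
      by (rule DERIV_mult'[OF flow_powr_deriv[OF s x] Gam_flow_deriv])
    have "\<bar>?F' s x\<bar> \<le> \<bar>flow s x powr ?e * (2 * Gam (flow s) (dflow s) x)\<bar> + \<bar>?e * flow s x powr (?e - 1) * dflow s x * Gam (flow s) (flow s) x\<bar>"
      by (rule abs_triangle_ineq)
    also have "\<bar>flow s x powr ?e * (2 * Gam (flow s) (dflow s) x)\<bar> \<le> ?b ?e * (2 * B)"
      unfolding abs_mult using b B(1) by (intro mult_mono) (auto intro: B(5)[OF s x] flow_powr_bound[OF B(2) s x])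
    also have "\<bar>?e * flow s x powr (?e - 1) * dflow s x * Gam (flow s) (flow s) x\<bar> \<le> 2 * z * ?b (?e - 1) * B * B"
      unfolding abs_mult using z b B(1)
      by (intro mult_mono mult_nonneg_nonneg)
         (auto intro: B(3)[OF s x] B(4)[OF s x] flow_powr_bound[OF B(2) s x] Gam_self_nonneg simp: abs_of_nonneg[OF Gam_self_nonneg])
    finally show "\<bar>?F' s x\<bar> \<le> ?b ?e * (2 * B) + 2 * z * ?b (?e - 1) * B * B" by simp
  next
    show "integrable smeas (\<lambda>x. flow s x powr ?e * Gam (flow s) (flow s) x)" if "s \<in> {0..}" for s
      using that by (intro int_flow rpoly_Gam rpoly_flow) auto
    show "?F' t \<in> borel_measurable smeas"
      using t by (intro measurable_smeas_continuous continuous_intros continuous_flow_powr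
         rpoly_continuous_on[OF rpoly_dflow] rpoly_continuous_on[OF rpoly_Gam] rpoly_dflow rpoly_flow)
  qed (use t in \<open>auto simp: smeas.finite_measure_axioms\<close>)
  from DERIV_cmult[OF this, of "(1 - z)\<^sup>2"]
  have "(dirichlet has_real_derivative (1 - z)\<^sup>2 * (\<integral>x. ?F' t x \<partial>smeas)) (at t within {0..})"
    unfolding dirichlet_def[abs_def] .
  note D = this
  have "(\<integral>x. ?F' t x \<partial>smeas) = (\<integral>x. 2 * (flow t x powr ?e * Gam (flow t) (Lap (flow t)) x)
      + ?e * (flow t x powr (?e - 1) * (Gam (flow t) (flow t) x * Lap (flow t) x)) \<partial>smeas)"
    by (intro Bochner_Integration.integral_cong refl) (simp add: Lap_flow Gam_Lap_flow mult_ac)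
  also have "\<dots> = 2 * (\<integral>x. flow t x powr ?e * Gam (flow t) (Lap (flow t)) x \<partial>smeas)
      + ?e * (\<integral>x. flow t x powr (?e - 1) * (Gam (flow t) (flow t) x * Lap (flow t) x) \<partial>smeas)"
  proof -
    have "integrable smeas (\<lambda>x. flow t x powr ?e * Gam (flow t) (Lap (flow t)) x)"
      by (intro int_flow t rpoly_Gam rpoly_Lap rpoly_flow)
    moreover have "integrable smeas (\<lambda>x. flow t x powr (?e - 1) * (Gam (flow t) (flow t) x * Lap (flow t) x))"
      by (intro int_flow t rpoly_mult rpoly_Gam rpoly_Lap rpoly_flow)
    ultimately show ?thesis
      by (subst Bochner_Integration.integral_add) auto
  qed
  finally show ?thesis using D unfolding dirichlet_rate_def by (simp only: add.commute)
qed

lemma sq_norm_pos: "t \<ge> 0 \<Longrightarrow> sq_norm t > 0"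
proof -
  assume t: "t \<ge> 0"
  have "0 < m powr (2 - 2 * z)" using m(1) by simp
  also have "m powr (2 - 2 * z) = (\<integral>x. m powr (2 - 2 * z) \<partial>(smeas :: (real^'n) measure))" by simp
  also have "\<dots> \<le> sq_norm t"
    unfolding sq_norm_def using t flow_ge_m[OF t] m(1) z
    by (intro Bochner_Integration.integral_mono integrable_smeas_continuous continuous_flow_powr)
       (auto intro!: powr_mono2)
  finally show ?thesis .
qed

lemma dirichlet_rate_le:
  assumes t: "t \<ge> 0" and k: "gain \<ge> 0"
  shows "dirichlet_rate t \<le> - 2 * d * dirichlet t - 2 * (gain / (1 - z)\<^sup>2) * (dirichlet t)\<^sup>2 / sq_norm t"
proof -
  let ?r = "flow t"
  have dd: "d = real (CARD('n) - 1)" using dim by (simp add: d_def of_nat_diff)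
  define X5 where "X5 = (\<integral>x. ?r x powr (- 2 * z) * Gam ?r ?r x \<partial>smeas)"
  define X3 where "X3 = (\<integral>x. ?r x powr (- 2 * z - 2) * (Gam ?r ?r x)\<^sup>2 \<partial>smeas)"
  have Q: "(\<integral>x. ?r x powr (- 2 * z) * Gam ?r ?r x \<partial>smeas)
      \<le> (\<integral>x. ?r x powr (- 2 * z) * (Lap ?r x)\<^sup>2 \<partial>smeas)
         - 2 * z * (\<integral>x. ?r x powr (- 2 * z - 1) * (Gam ?r ?r x * Lap ?r x) \<partial>smeas)
         + z\<^sup>2 * (\<integral>x. ?r x powr (- 2 * z - 2) * (Gam ?r ?r x)\<^sup>2 \<partial>smeas)" if "CARD('n) = 2"
    using z by (intro spectral_gap_powr rpoly_flow flow_pos[OF t] that) auto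
  note E = entropy_dissipation[OF rpoly_flow[of t] flow_pos[OF t] dim Q]
  have "dirichlet_rate t \<le> (1 - z)\<^sup>2 * (- 2 * d * X5 - 2 * gain * X3)"
    unfolding dirichlet_rate_def X5_def X3_def gain_def using E[folded dd] by (intro mult_left_mono) auto
  moreover have "(1 - z)\<^sup>2 * X5 = dirichlet t" by (simp add: X5_def dirichlet_def)
  \<comment> \<open>Cauchy-Schwarz for the product of \<open>u\<close> and the squared gradient of
    \<open>u\<close> divided by \<open>u\<close>, written in terms of the flow and without the
    constant \<open>(1 - z)\<^sup>2\<close>.\<close>
  moreover have "X5\<^sup>2 \<le> X3 * sq_norm t"
  proof -
    have p: "rpoly (\<lambda>x. (Gam ?r ?r x)\<^sup>2)" by (intro real_polynomial_function_power rpoly_Gam rpoly_flow)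
    have f2: "(?r x powr (- z - 1) * Gam ?r ?r x)\<^sup>2 = ?r x powr (- 2 * z - 2) * (Gam ?r ?r x)\<^sup>2"
      and g2: "(?r x powr (1 - z))\<^sup>2 = ?r x powr (2 - 2 * z)"
      and fg: "?r x powr (- z - 1) * Gam ?r ?r x * ?r x powr (1 - z) = ?r x powr (- 2 * z) * Gam ?r ?r x" for x
    proof -
      show "(?r x powr (- z - 1) * Gam ?r ?r x)\<^sup>2 = ?r x powr (- 2 * z - 2) * (Gam ?r ?r x)\<^sup>2"
        unfolding power_mult_distrib power2_eq_square[of "?r x powr (- z - 1)"] powr_add[symmetric] by simp
      show "(?r x powr (1 - z))\<^sup>2 = ?r x powr (2 - 2 * z)"
        unfolding power2_eq_square powr_add[symmetric] by simp
      have "?r x powr (- z - 1) * ?r x powr (1 - z) = ?r x powr (- 2 * z)"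
        unfolding powr_add[symmetric] by simp
      then show "?r x powr (- z - 1) * Gam ?r ?r x * ?r x powr (1 - z) = ?r x powr (- 2 * z) * Gam ?r ?r x"
        by (metis mult.assoc mult.commute)
    qed
    have "(\<integral>x. (?r x powr (- z - 1) * Gam ?r ?r x) * ?r x powr (1 - z) \<partial>smeas)\<^sup>2
      \<le> (\<integral>x. (?r x powr (- z - 1) * Gam ?r ?r x)\<^sup>2 \<partial>smeas) * (\<integral>x. (?r x powr (1 - z))\<^sup>2 \<partial>smeas)"
    proof (intro Cauchy_Schwarz_integral)
      show "integrable smeas (\<lambda>x. (?r x powr (- z - 1) * Gam ?r ?r x)\<^sup>2)"
        unfolding f2 by (intro int_flow t p)
      show "integrable smeas (\<lambda>x. (?r x powr (1 - z))\<^sup>2)"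
        unfolding g2 by (intro integrable_smeas_continuous continuous_flow_powr t)
      show "integrable smeas (\<lambda>x. ?r x powr (- z - 1) * Gam ?r ?r x * ?r x powr (1 - z))"
        unfolding fg by (intro int_flow t rpoly_Gam rpoly_flow)
    qed
    then show ?thesis unfolding f2 g2 fg X5_def X3_def sq_norm_def .
  qed
  then have "(1 - z)\<^sup>2 * X5\<^sup>2 / sq_norm t \<le> (1 - z)\<^sup>2 * X3"
    using sq_norm_pos[OF t] by (simp add: divide_simps mult_left_mono mult.assoc)
  then have "gain * ((1 - z)\<^sup>2 * X5\<^sup>2 / sq_norm t) \<le> gain * ((1 - z)\<^sup>2 * X3)" using k by (rule mult_left_mono)
  moreover have "gain * ((1 - z)\<^sup>2 * X5\<^sup>2 / sq_norm t) = (gain / (1 - z)\<^sup>2) * ((1 - z)\<^sup>2 * X5)\<^sup>2 / sq_norm t"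
    using z by (simp add: power2_eq_square)
  moreover have "(1 - z)\<^sup>2 * (- 2 * d * X5 - 2 * gain * X3) = - 2 * d * ((1 - z)\<^sup>2 * X5) - 2 * (gain * ((1 - z)\<^sup>2 * X3))"
    by (simp add: algebra_simps)
  moreover have "- 2 * d * dirichlet t - 2 * (gain / (1 - z)\<^sup>2) * (dirichlet t)\<^sup>2 / sq_norm t = - 2 * d * dirichlet t - 2 * ((gain / (1 - z)\<^sup>2) * (dirichlet t)\<^sup>2 / sq_norm t)"
    by simp
  ultimately show ?thesis by (smt (verit))
qed

end

context positive_heat_flow
begin

section \<open>Long-time limit and comparison with the initial time\<close>

lemma c_ge: "m \<le> c"
proof -
  have "m = (\<integral>x. m \<partial>(smeas :: (real^'n) measure))" by simp
  also have "\<dots> \<le> (\<integral>x. flow 0 x \<partial>smeas)"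
    using m(2) by (intro Bochner_Integration.integral_mono integrable_smeas_continuous rpoly_continuous_on rpoly_flow) auto
  finally show ?thesis by (simp add: integral_flow_0)
qed

lemma sq_norm_dirichlet_limits:
  "(\<lambda>k. sq_norm (real k)) \<longlonglongrightarrow> c powr (2 - 2 * z)" "(\<lambda>k. dirichlet (real k)) \<longlonglongrightarrow> 0"
proof -
  obtain B where B: "B > 0"
    "\<And>t x. t \<ge> 0 \<Longrightarrow> x \<in> sphere 0 1 \<Longrightarrow> \<bar>flow t x\<bar> \<le> B"
    "\<And>t x. t \<ge> 0 \<Longrightarrow> x \<in> sphere 0 1 \<Longrightarrow> Gam (flow t) (flow t) x \<le> B"
    by (rule flow_bounds) blast
  have c: "c \<noteq> 0" using c_ge m(1) by simp
  have fl: "(\<lambda>k. flow (real k) x powr e) \<longlonglongrightarrow> c powr e" for x e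
    by (intro tendsto_powr filterlim_compose[OF flow_lim filterlim_real_sequentially] tendsto_const c)
  have gl: "(\<lambda>k. Gam (flow (real k)) (flow (real k)) x) \<longlonglongrightarrow> 0" for x
    by (rule filterlim_compose[OF Gam_flow_lim filterlim_real_sequentially])
  have "(\<lambda>k. sq_norm (real k)) \<longlonglongrightarrow> (\<integral>x. c powr (2 - 2 * z) \<partial>(smeas :: (real^'n) measure))"
    unfolding sq_norm_def
  proof (rule integral_limit_bounded[where B = "m powr (2 - 2 * z) + B powr (2 - 2 * z)"])
    show "\<bar>flow (real k) x powr (2 - 2 * z)\<bar> \<le> m powr (2 - 2 * z) + B powr (2 - 2 * z)" if "x \<in> sphere 0 1" for k x
      using flow_powr_bound[OF B(2) _ that, of "real k" "2 - 2 * z"] by simp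
  qed (auto intro!: continuous_flow_powr fl)
  then show "(\<lambda>k. sq_norm (real k)) \<longlonglongrightarrow> c powr (2 - 2 * z)" by simp
  have "(\<lambda>k. \<integral>x. flow (real k) x powr (- 2 * z) * Gam (flow (real k)) (flow (real k)) x \<partial>smeas)
     \<longlonglongrightarrow> (\<integral>x. 0 \<partial>(smeas :: (real^'n) measure))"
  proof (rule integral_limit_bounded[where B = "(m powr (- 2 * z) + B powr (- 2 * z)) * B"])
    show "\<bar>flow (real k) x powr (- 2 * z) * Gam (flow (real k)) (flow (real k)) x\<bar> \<le> (m powr (- 2 * z) + B powr (- 2 * z)) * B"
      if x: "x \<in> sphere 0 1" for k x
    proof -
      have "\<bar>flow (real k) x powr (- 2 * z) * Gam (flow (real k)) (flow (real k)) x\<bar>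
         = flow (real k) x powr (- 2 * z) * Gam (flow (real k)) (flow (real k)) x"
        using Gam_self_nonneg[of "flow (real k)" x] by simp
      also have "\<dots> \<le> (m powr (- 2 * z) + B powr (- 2 * z)) * B"
        by (intro mult_mono flow_powr_bound[OF B(2)] B(3) Gam_self_nonneg add_nonneg_nonneg x) auto
      finally show ?thesis .
    qed
    show "(\<lambda>k. flow (real k) x powr (- 2 * z) * Gam (flow (real k)) (flow (real k)) x) \<longlonglongrightarrow> 0" for x
      using tendsto_mult[OF fl gl, of x "- 2 * z" x] by simp
    show "continuous_on (sphere 0 1) (\<lambda>x. flow (real k) x powr (- 2 * z) * Gam (flow (real k)) (flow (real k)) x)" for k
      by (intro continuous_on_mult continuous_flow_powr rpoly_continuous_on[OF rpoly_Gam] rpoly_flow) simp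
  qed auto
  from tendsto_mult[OF tendsto_const[of "(1 - z)\<^sup>2"] this]
  show "(\<lambda>k. dirichlet (real k)) \<longlonglongrightarrow> 0" unfolding dirichlet_def by simp
qed

text \<open>Here \<open>a\<close> stands for \<open>p - 2\<close> and \<open>g\<close> for \<gamma>.
  Differentiating the power \<kappa> of \<open>sq_norm\<close> reproduces the term quadratic in
  \<open>dirichlet\<close> because \<open>\<kappa> * a = g\<close>, and \<open>K\<close> is fixed by
  \<open>K * (\<kappa> + 1) * a = d\<close>, which produces the linear term. The differential
  inequality thus says that \<open>Q\<close> is nonincreasing, whatever the signs of
  \<open>a\<close> and \<open>K\<close>.\<close>

lemma entropy_inequality:
  fixes a g \<kappa> K :: real
  assumes a: "a = (2 * z - 1) / (1 - z)" "a \<noteq> 0" and g: "g = gain / (1 - z)\<^sup>2" "g \<ge> 0" and ag: "a + g \<noteq> 0"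
    and \<kappa>: "\<kappa> = g / a" and K: "K = d / (a + g)"
  shows "K * (c powr (2 - 2 * z)) powr (\<kappa> + 1) \<le> dirichlet 0 * sq_norm 0 powr \<kappa> + K * sq_norm 0 powr (\<kappa> + 1)"
proof -
  define Q where "Q t = dirichlet t * sq_norm t powr \<kappa> + K * sq_norm t powr (\<kappa> + 1)" for t
  define Q' where "Q' t = sq_norm t powr \<kappa> * (dirichlet_rate t + 2 * g * (dirichlet t)\<^sup>2 / sq_norm t + 2 * d * dirichlet t)" for t
  have gain: "gain \<ge> 0" using g z by (simp add: zero_le_divide_iff)
  have K1: "K * (\<kappa> + 1) * (2 * a) = 2 * d"
  proof -
    have "(\<kappa> + 1) * a = a + g" unfolding \<kappa> using a(2) by (simp add: distrib_right)
    moreover have "K * (a + g) = d" unfolding K using ag by simp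
    ultimately show ?thesis by (metis mult.assoc mult.commute)
  qed
  have ka: "\<kappa> * a = g" unfolding \<kappa> using a(2) by simp
  have deriv: "(Q has_real_derivative Q' t) (at t within {0..})" if t: "t \<ge> 0" for t
  proof -
    have y: "(sq_norm has_real_derivative 2 * a * dirichlet t) (at t within {0..})"
    proof -
      have "- 2 * (1 - 2 * z) / (1 - z) = 2 * a" unfolding a using z by (simp add: field_simps)
      then show ?thesis using sq_norm_deriv[OF t] by simp
    qed
    have yp: "((\<lambda>t. sq_norm t powr e) has_real_derivative e * sq_norm t powr (e - 1) * (2 * a * dirichlet t)) (at t within {0..})" for e
    proof -
      have "((\<lambda>v. v powr e) has_real_derivative e * sq_norm t powr (e - 1)) (at (sq_norm t))"
        using sq_norm_pos[OF t] by (auto intro!: derivative_eq_intros)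
      from DERIV_chain2[OF this y] show ?thesis .
    qed
    have "(Q has_real_derivative (dirichlet t * (\<kappa> * sq_norm t powr (\<kappa> - 1) * (2 * a * dirichlet t)) + dirichlet_rate t * sq_norm t powr \<kappa>)
       + K * ((\<kappa> + 1) * sq_norm t powr (\<kappa> + 1 - 1) * (2 * a * dirichlet t))) (at t within {0..})"
      unfolding Q_def[abs_def] by (intro DERIV_add DERIV_mult' dirichlet_deriv t yp DERIV_cmult)
    moreover have "(dirichlet t * (\<kappa> * sq_norm t powr (\<kappa> - 1) * (2 * a * dirichlet t)) + dirichlet_rate t * sq_norm t powr \<kappa>)
       + K * ((\<kappa> + 1) * sq_norm t powr (\<kappa> + 1 - 1) * (2 * a * dirichlet t)) = Q' t"
    proof -
      have p1: "sq_norm t powr (\<kappa> - 1) = sq_norm t powr \<kappa> / sq_norm t" using sq_norm_pos[OF t] by (simp add: powr_diff)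
      have "(dirichlet t * (\<kappa> * sq_norm t powr (\<kappa> - 1) * (2 * a * dirichlet t)) + dirichlet_rate t * sq_norm t powr \<kappa>)
         + K * ((\<kappa> + 1) * sq_norm t powr (\<kappa> + 1 - 1) * (2 * a * dirichlet t))
        = sq_norm t powr \<kappa> * (dirichlet_rate t + 2 * (\<kappa> * a) * (dirichlet t)\<^sup>2 / sq_norm t + (K * (\<kappa> + 1) * (2 * a)) * dirichlet t)"
        unfolding p1 by (simp add: power2_eq_square algebra_simps)
      then show ?thesis unfolding ka K1 Q'_def .
    qed
    ultimately show ?thesis by simp
  qed
  have Q'_le: "Q' t \<le> 0" if "t \<ge> 0" for t
  proof -
    have "dirichlet_rate t + 2 * g * (dirichlet t)\<^sup>2 / sq_norm t + 2 * d * dirichlet t \<le> 0"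
      using dirichlet_rate_le[OF that gain] unfolding g(1) by simp
    then show ?thesis unfolding Q'_def by (intro mult_nonneg_nonpos) auto
  qed
  \<comment> \<open>Two-sided derivatives are obtained at positive times only; continuity up to 0
    brings in the initial value.\<close>
  have mono: "Q t \<le> Q 0" if "t > 0" for t
  proof (rule DERIV_nonpos_imp_decreasing_open[OF less_imp_le[OF that]])
    fix s :: real assume "0 < s" "s < t"
    then have "s \<in> interior {0..}" by simp
    then have "at s within {0..} = at s" by (rule at_within_interior)
    then show "\<exists>y. (Q has_real_derivative y) (at s) \<and> y \<le> 0"
      using deriv[of s] Q'_le[of s] \<open>0 < s\<close> by auto
  next
    have "continuous_on {0..} Q" using deriv by (intro DERIV_continuous_on) auto
    then show "continuous_on {0..t} Q" by (rule continuous_on_subset) auto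
  qed
  have c: "c powr (2 - 2 * z) \<noteq> 0" using c_ge m(1) by simp
  have "(\<lambda>k. Q (real k)) \<longlonglongrightarrow> 0 * (c powr (2 - 2 * z)) powr \<kappa> + K * (c powr (2 - 2 * z)) powr (\<kappa> + 1)"
    unfolding Q_def using c by (intro tendsto_intros sq_norm_dirichlet_limits) auto
  moreover have "\<exists>k0. \<forall>k\<ge>k0. Q (real k) \<le> Q 0"
    using mono by (intro exI[of _ 1]) auto
  ultimately have "0 * (c powr (2 - 2 * z)) powr \<kappa> + K * (c powr (2 - 2 * z)) powr (\<kappa> + 1) \<le> Q 0"
    by (rule LIMSEQ_le_const2)
  then show ?thesis by (simp add: Q_def)
qed

end

lemma entropy_inequality_avg:
  fixes f :: "real^'n::finite \<Rightarrow> real" and z :: real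
  defines "d \<equiv> real CARD('n) - 1"
  defines "b \<equiv> z * (1 - z) * d / (d + 2) - z\<^sup>2 * (d - 1)\<^sup>2 / (d + 2)\<^sup>2"
  assumes f: "continuous_on (sphere 0 1) f" and n: "CARD('n) \<ge> 2"
    and m: "m > 0" "\<And>x. x \<in> sphere 0 1 \<Longrightarrow> m \<le> f x" and z: "0 \<le> z" "z < 1"
    and a: "a = (2 * z - 1) / (1 - z)" "a \<noteq> 0" and g: "g = b / (1 - z)\<^sup>2" "g \<ge> 0" and ag: "a + g \<noteq> 0"
    and \<kappa>: "\<kappa> = g / a" and K: "K = d / (a + g)"
  shows "K * ((\<integral>x. avg k f x \<partial>smeas) powr (2 - 2 * z)) powr (\<kappa> + 1)
    \<le> ((1 - z)\<^sup>2 * (\<integral>x. avg k f x powr (- 2 * z) * Gam (avg k f) (avg k f) x \<partial>smeas))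
        * (\<integral>x. avg k f x powr (2 - 2 * z) \<partial>smeas) powr \<kappa>
      + K * (\<integral>x. avg k f x powr (2 - 2 * z) \<partial>smeas) powr (\<kappa> + 1)"
proof -
  obtain H N c where hf: "heat_flow H c d" and f0: "heat_flow.flow H N d 0 = avg k f"
    unfolding d_def by (rule zonal_heat_flow[OF f n])
  interpret heat_flow H N c d by (rule hf)
  interpret positive_heat_flow H N c d m z
    using avg_ge[OF f m(2) _ n, of _ k] m(1) z by unfold_locales (auto simp: f0)
  have "K * (c powr (2 - 2 * z)) powr (\<kappa> + 1) \<le> dirichlet 0 * sq_norm 0 powr \<kappa> + K * sq_norm 0 powr (\<kappa> + 1)"
    by (rule entropy_inequality[OF a g[unfolded b_def gain_def[symmetric]] ag \<kappa> K])
  then show ?thesis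
    using integral_flow_0 by (simp only: f0 dirichlet_def sq_norm_def)
qed

section \<open>From polynomials to Sobolev functions\<close>

text \<open>For \<open>d \<ge> 2\<close> the identity
  \<open>2 * d\<^sup>2 + 1 = d * (d + 2) + (d - 1)\<^sup>2\<close> exhibits the Bakry-Emery exponent
  as 1 plus \<open>d * (d + 2) / (d - 1)\<^sup>2\<close>. This turns the product form of \<gamma>
  into the difference that the dissipation inequality yields with
  \<open>z = 1 - 1 / p\<close>.\<close>

lemma BE_gamma_eq:
  assumes d: "d = 1 \<or> d \<ge> 2" and p: "p \<ge> 1"
  shows "BE_gamma d p = ((1 - 1 / p) * (1 - (1 - 1 / p)) * d / (d + 2) - (1 - 1 / p)\<^sup>2 * (d - 1)\<^sup>2 / (d + 2)\<^sup>2) / (1 - (1 - 1 / p))\<^sup>2"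
proof -
  define z where "z = 1 - 1 / p"
  have p0: "p > 0" using p by simp
  have "(z * (1 - z) * d / (d + 2) - z\<^sup>2 * (d - 1)\<^sup>2 / (d + 2)\<^sup>2) / (1 - z)\<^sup>2
     = (z * (1 - z)) * p\<^sup>2 * d / (d + 2) - z\<^sup>2 * p\<^sup>2 * (d - 1)\<^sup>2 / (d + 2)\<^sup>2"
  proof -
    have "(1 - z)\<^sup>2 = 1 / p\<^sup>2" by (simp add: z_def power_divide)
    moreover have "(X * d / E - Z * D / F) / (1 / P) = X * P * d / E - Z * P * D / F" for X d E Z D F P :: real
      by (simp add: algebra_simps)
    ultimately show ?thesis by simp
  qed
  also have "(z * (1 - z)) * p\<^sup>2 = p - 1" using p0 by (simp add: z_def power2_eq_square field_simps)
  also have "z\<^sup>2 * p\<^sup>2 = (p - 1)\<^sup>2"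
  proof -
    have "z * p = p - 1" using p0 by (simp add: z_def left_diff_distrib)
    then show ?thesis by (simp only: power_mult_distrib[symmetric])
  qed
  also have "(p - 1) * d / (d + 2) - (p - 1)\<^sup>2 * (d - 1)\<^sup>2 / (d + 2)\<^sup>2 = BE_gamma d p"
  proof (cases "d = 1")
    case True
    then show ?thesis by (simp add: BE_gamma_def)
  next
    case False
    then have d: "d \<ge> 2" using assms(1) by simp
    define D where "D = (d - 1)\<^sup>2"
    define E where "E = d + 2"
    have D: "D > 0" and E: "E > 0" using d by (auto simp: D_def E_def)
    have DE: "2 * d\<^sup>2 + 1 = d * E + D" by (simp add: D_def E_def power2_eq_square algebra_simps)
    have "BE_gamma d p = D / E\<^sup>2 * (p - 1) * ((d * E + D) / D - p)"
      unfolding BE_gamma_def BE_exp_def DE power_divide D_def[symmetric] E_def[symmetric] using d by simp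
    also have "\<dots> = (p - 1) * (d * E + D - D * p) / E\<^sup>2"
    proof -
      have "(d * E + D) / D - p = (d * E + D - D * p) / D" using D by (simp add: diff_divide_distrib)
      then show ?thesis using D by simp
    qed
    also have "\<dots> = (p - 1) * d / E - (p - 1)\<^sup>2 * D / E\<^sup>2"
    proof -
      have "(p - 1) * (d * E + D - D * p) / E\<^sup>2 = ((p - 1) * d * E - (p - 1)\<^sup>2 * D) / E\<^sup>2"
        by (simp add: power2_eq_square algebra_simps)
      also have "\<dots> = (p - 1) * d / E - (p - 1)\<^sup>2 * D / E\<^sup>2"
        using E by (simp add: diff_divide_distrib power2_eq_square)
      finally show ?thesis .
    qed
    finally show ?thesis by (simp add: D_def E_def)
  qed
  finally show ?thesis unfolding z_def by simp
qed

lemma BE_gamma_nonneg: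
  assumes "p \<ge> 1" "d \<ge> 2 \<longrightarrow> p \<le> BE_exp d"
  shows "BE_gamma d p \<ge> 0"
  using assms by (auto simp: BE_gamma_def intro!: mult_nonneg_nonneg)

text \<open>The flow starts from the averages of \<open>w powr p\<close>, polynomials that are
  positive on the sphere. Their rotation derivatives converge pointwise and boundedly because
  averaging commutes with the rotation fields, so dominated convergence removes the
  averaging.\<close>

lemma interpolation_C1S_pos:
  fixes w :: "real^'n::finite \<Rightarrow> real"
  defines "d \<equiv> real CARD('n) - 1"
  assumes w: "C1S w" and pos: "\<And>x. x \<in> sphere 0 1 \<Longrightarrow> w x > 0" and n: "CARD('n) \<ge> 2"
    and p: "p \<ge> 1" "p \<noteq> 2" and g: "g = BE_gamma d p" "g \<ge> 0" "g \<noteq> 2 - p"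
    and \<kappa>: "\<kappa> = g / (p - 2)" and K: "K = d / (p - 2 + g)"
  shows "K * ((\<integral>x. w x powr p \<partial>smeas) powr (2 / p)) powr (\<kappa> + 1)
    \<le> (\<integral>x. Gam w w x \<partial>smeas) * (\<integral>x. (w x)\<^sup>2 \<partial>smeas) powr \<kappa> + K * (\<integral>x. (w x)\<^sup>2 \<partial>smeas) powr (\<kappa> + 1)"
proof -
  define z where "z = 1 - 1 / p"
  have z: "0 \<le> z" "z < 1" using p by (auto simp: z_def)
  have a: "p - 2 = (2 * z - 1) / (1 - z)" using p by (simp add: z_def field_simps)
  have dd: "d = 1 \<or> d \<ge> 2"
  proof (cases "CARD('n) = 2")
    case False
    then have "CARD('n) \<ge> 3" using n by simp
    then show ?thesis by (simp add: d_def)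
  qed (simp add: d_def)
  have gz: "g = (z * (1 - z) * d / (d + 2) - z\<^sup>2 * (d - 1)\<^sup>2 / (d + 2)\<^sup>2) / (1 - z)\<^sup>2"
    unfolding g(1) z_def by (rule BE_gamma_eq[OF dd p(1)])
  define f where "f = (\<lambda>x. w x powr p)"
  have f: "C1S f" unfolding f_def by (rule C1S_powr[OF w pos])
  have fc: "continuous_on (sphere 0 1) f" using f by (rule C1S_cont)
  have fpos: "f x > 0" if "x \<in> sphere 0 1" for x using pos[OF that] by (simp add: f_def)
  obtain x0 :: "real^'n" where x0: "x0 \<in> sphere 0 1" "\<And>y. y \<in> sphere 0 1 \<Longrightarrow> f x0 \<le> f y"
    using continuous_attains_inf[OF compact_sphere _ fc] by auto
  define m where "m = f x0"
  have m: "m > 0" "\<And>x. x \<in> sphere 0 1 \<Longrightarrow> m \<le> f x" unfolding m_def using fpos x0 by auto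
  have ag: "m \<le> avg k f x" if "x \<in> sphere 0 1" for k x by (rule avg_ge[OF fc m(2) that n])
  have apos: "avg k f x > 0" if "x \<in> sphere 0 1" for k x using ag[OF that, of k] m(1) by linarith
  obtain B where B: "B > 0" "\<And>k x. x \<in> sphere 0 1 \<Longrightarrow> \<bar>avg k f x\<bar> \<le> B"
    "\<And>k x. x \<in> sphere 0 1 \<Longrightarrow> Gam (avg k f) (avg k f) x \<le> B"
    using avg_bounds[OF f n] by metis
  have pw_le: "avg k f x powr e \<le> m powr e + B powr e" if "x \<in> sphere 0 1" for k x e
    using ag[OF that, of k] B(2)[OF that, of k] by (intro powr_between_bound m) auto
  have ap: "C1S (\<lambda>x. avg k f x powr e)" for k e
    by (intro C1S_powr C1S_rpoly rpoly_zonal fc apos)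
  have fp: "C1S (\<lambda>x. f x powr e)" for e by (intro C1S_powr f fpos)
  have pw_lim: "(\<lambda>k. avg k f x powr e) \<longlonglongrightarrow> f x powr e" if "x \<in> sphere 0 1" for x e
    using fpos[OF that] by (intro tendsto_powr avg_tendsto[OF fc that n] tendsto_const) auto
  have l1: "(\<lambda>k. \<integral>x. avg k f x \<partial>smeas) \<longlonglongrightarrow> (\<integral>x. w x powr p \<partial>smeas)"
    unfolding f_def[symmetric]
    by (rule integral_limit_bounded[where B = B])
       (auto intro: avg_tendsto[OF fc _ n] B(2) fc rpoly_continuous_on[OF rpoly_zonal[OF fc]] simp: f_def[symmetric])
  have "(\<lambda>k. \<integral>x. avg k f x powr (2 - 2 * z) \<partial>smeas) \<longlonglongrightarrow> (\<integral>x. f x powr (2 - 2 * z) \<partial>smeas)"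
  proof (rule integral_limit_bounded[where B = "m powr (2 - 2 * z) + B powr (2 - 2 * z)"])
    show "\<bar>avg k f x powr (2 - 2 * z)\<bar> \<le> m powr (2 - 2 * z) + B powr (2 - 2 * z)" if "x \<in> sphere 0 1" for k x
      using pw_le[OF that, of k "2 - 2 * z"] by simp
  qed (auto intro: C1S_cont[OF ap] C1S_cont[OF fp] pw_lim)
  also have "(\<integral>x. f x powr (2 - 2 * z) \<partial>smeas) = (\<integral>x. (w x)\<^sup>2 \<partial>smeas)"
  proof (intro Bochner_Integration.integral_cong refl)
    fix x :: "real^'n" assume "x \<in> space smeas"
    then have "w x > 0" by (intro pos) simp
    moreover have "p * (2 - 2 * z) = 2" using p by (simp add: z_def)
    ultimately show "f x powr (2 - 2 * z) = (w x)\<^sup>2"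
      unfolding f_def powr_powr by simp
  qed
  finally have l2: "(\<lambda>k. \<integral>x. avg k f x powr (2 - 2 * z) \<partial>smeas) \<longlonglongrightarrow> (\<integral>x. (w x)\<^sup>2 \<partial>smeas)" .
  have "(\<lambda>k. (1 - z)\<^sup>2 * (\<integral>x. avg k f x powr (- 2 * z) * Gam (avg k f) (avg k f) x \<partial>smeas))
     \<longlonglongrightarrow> (1 - z)\<^sup>2 * (\<integral>x. f x powr (- 2 * z) * Gam f f x \<partial>smeas)"
  proof (rule tendsto_mult[OF tendsto_const integral_limit_bounded[where B = "(m powr (- 2 * z) + B powr (- 2 * z)) * B"]])
    show "\<bar>avg k f x powr (- 2 * z) * Gam (avg k f) (avg k f) x\<bar> \<le> (m powr (- 2 * z) + B powr (- 2 * z)) * B"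
      if x: "x \<in> sphere 0 1" for k x
    proof -
      have "\<bar>avg k f x powr (- 2 * z) * Gam (avg k f) (avg k f) x\<bar> = avg k f x powr (- 2 * z) * Gam (avg k f) (avg k f) x"
        using Gam_self_nonneg[of "avg k f" x] by simp
      also have "\<dots> \<le> (m powr (- 2 * z) + B powr (- 2 * z)) * B"
        by (intro mult_mono pw_le B(3) Gam_self_nonneg add_nonneg_nonneg x) auto
      finally show ?thesis .
    qed
    show "continuous_on (sphere 0 1) (\<lambda>x. avg k f x powr (- 2 * z) * Gam (avg k f) (avg k f) x)" for k
      by (intro continuous_on_mult C1S_cont[OF ap] rpoly_continuous_on[OF rpoly_Gam] rpoly_zonal fc)
    show "continuous_on (sphere 0 1) (\<lambda>x. f x powr (- 2 * z) * Gam f f x)"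
      by (intro continuous_on_mult C1S_cont[OF fp] continuous_Gam f)
    show "(\<lambda>k. avg k f x powr (- 2 * z) * Gam (avg k f) (avg k f) x) \<longlonglongrightarrow> f x powr (- 2 * z) * Gam f f x"
      if "x \<in> sphere 0 1" for x
      using that by (intro tendsto_mult pw_lim Gam_avg_tendsto f n)
  qed
  also have "(1 - z)\<^sup>2 * (\<integral>x. f x powr (- 2 * z) * Gam f f x \<partial>smeas) = (\<integral>x. Gam w w x \<partial>smeas)"
    unfolding integral_mult_right_zero[symmetric]
  proof (intro Bochner_Integration.integral_cong refl)
    fix x :: "real^'n" assume "x \<in> space smeas"
    then have x: "x \<in> sphere 0 1" by simp
    have Gf: "Gam f f x = (p * w x powr (p - 1)) * ((p * w x powr (p - 1)) * Gam w w x)"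
      using Gam_powr_left[OF C1S_diff[OF w x] pos[OF x], of p f]
        Gam_powr_left[OF C1S_diff[OF w x] pos[OF x], of p w] Gam_commute[of w f x]
      unfolding f_def[symmetric] by simp
    have e0: "p * (- 2 * z) + ((p - 1) + (p - 1)) = 0" using p by (simp add: z_def field_simps)
    have e: "f x powr (- 2 * z) * (w x powr (p - 1) * w x powr (p - 1)) = 1"
      unfolding f_def powr_powr powr_add[symmetric] e0 using pos[OF x] by simp
    have pz: "(1 - z) * p = 1" using p by (simp add: z_def)
    have "(1 - z)\<^sup>2 * (f x powr (- 2 * z) * Gam f f x)
       = ((1 - z) * p) * ((1 - z) * p) * (f x powr (- 2 * z) * (w x powr (p - 1) * w x powr (p - 1))) * Gam w w x"
      unfolding Gf by (simp add: power2_eq_square mult_ac)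
    then show "(1 - z)\<^sup>2 * (f x powr (- 2 * z) * Gam f f x) = Gam w w x"
      unfolding e pz by simp
  qed
  finally have l3: "(\<lambda>k. (1 - z)\<^sup>2 * (\<integral>x. avg k f x powr (- 2 * z) * Gam (avg k f) (avg k f) x \<partial>smeas))
     \<longlonglongrightarrow> (\<integral>x. Gam w w x \<partial>smeas)" .
  have ineq: "K * ((\<integral>x. avg k f x \<partial>smeas) powr (2 - 2 * z)) powr (\<kappa> + 1)
    \<le> ((1 - z)\<^sup>2 * (\<integral>x. avg k f x powr (- 2 * z) * Gam (avg k f) (avg k f) x \<partial>smeas))
        * (\<integral>x. avg k f x powr (2 - 2 * z) \<partial>smeas) powr \<kappa>
      + K * (\<integral>x. avg k f x powr (2 - 2 * z) \<partial>smeas) powr (\<kappa> + 1)" for k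
    by (rule entropy_inequality_avg[OF fc n m z a _ gz[unfolded d_def] g(2) _ \<kappa> K[unfolded d_def]]) (use p g(3) in auto)
  \<comment> \<open>The exponents may be negative, so convergence of the powers relies on the
    limiting integrals being nonzero.\<close>
  have int_pos: "(\<integral>x. h x \<partial>smeas) \<noteq> 0" if h: "continuous_on (sphere 0 1) h" "\<And>x. x \<in> sphere 0 1 \<Longrightarrow> h x > 0" for h :: "real^'n \<Rightarrow> real"
  proof -
    obtain x1 :: "real^'n" where x1: "x1 \<in> sphere 0 1" "\<And>y. y \<in> sphere 0 1 \<Longrightarrow> h x1 \<le> h y"
      using continuous_attains_inf[OF compact_sphere _ h(1)] x0(1) by auto
    have "h x1 = (\<integral>x. h x1 \<partial>(smeas :: (real^'n) measure))" by simp
    also have "\<dots> \<le> (\<integral>x. h x \<partial>smeas)"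
      using x1 h(1) by (intro Bochner_Integration.integral_mono integrable_smeas_continuous) auto
    finally show ?thesis using h(2)[OF x1(1)] by linarith
  qed
  have n1: "(\<integral>x. w x powr p \<partial>smeas) \<noteq> 0"
    unfolding f_def[symmetric] by (intro int_pos fpos) (simp_all add: f_def[symmetric] fc)
  have n2: "(\<integral>x. (w x)\<^sup>2 \<partial>smeas) \<noteq> 0"
    by (intro int_pos continuous_on_power C1S_cont w zero_less_power pos)
  have e2: "2 - 2 * z = 2 / p" by (simp add: z_def)
  have "K * ((\<integral>x. w x powr p \<partial>smeas) powr (2 - 2 * z)) powr (\<kappa> + 1)
    \<le> (\<integral>x. Gam w w x \<partial>smeas) * (\<integral>x. (w x)\<^sup>2 \<partial>smeas) powr \<kappa> + K * (\<integral>x. (w x)\<^sup>2 \<partial>smeas) powr (\<kappa> + 1)"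
  proof (rule LIMSEQ_le)
    show "(\<lambda>k. K * ((\<integral>x. avg k f x \<partial>smeas) powr (2 - 2 * z)) powr (\<kappa> + 1))
      \<longlonglongrightarrow> K * ((\<integral>x. w x powr p \<partial>smeas) powr (2 - 2 * z)) powr (\<kappa> + 1)"
      using n1 by (intro tendsto_mult tendsto_const tendsto_powr l1) auto
    show "(\<lambda>k. ((1 - z)\<^sup>2 * (\<integral>x. avg k f x powr (- 2 * z) * Gam (avg k f) (avg k f) x \<partial>smeas))
        * (\<integral>x. avg k f x powr (2 - 2 * z) \<partial>smeas) powr \<kappa>
      + K * (\<integral>x. avg k f x powr (2 - 2 * z) \<partial>smeas) powr (\<kappa> + 1))
      \<longlonglongrightarrow> (\<integral>x. Gam w w x \<partial>smeas) * (\<integral>x. (w x)\<^sup>2 \<partial>smeas) powr \<kappa> + K * (\<integral>x. (w x)\<^sup>2 \<partial>smeas) powr (\<kappa> + 1)"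
      using n2 by (intro tendsto_add tendsto_mult tendsto_const tendsto_powr l2 l3) auto
  qed (use ineq in blast)
  then show ?thesis unfolding e2 .
qed

section \<open>Convergence of power integrals along L^2 limits\<close>

lemma integral_square_limit:
  fixes g :: "'a \<Rightarrow> real"
  assumes f: "\<And>k. f k \<in> borel_measurable M" and g: "g \<in> borel_measurable M"
    and int: "\<And>k. integrable M (\<lambda>x. (f k x - g x)\<^sup>2)" "integrable M (\<lambda>x. (g x)\<^sup>2)"
    and lim: "(\<lambda>k. \<integral>x. (f k x - g x)\<^sup>2 \<partial>M) \<longlonglongrightarrow> 0"
  shows "(\<lambda>k. \<integral>x. (f k x)\<^sup>2 \<partial>M) \<longlonglongrightarrow> (\<integral>x. (g x)\<^sup>2 \<partial>M)"
proof -
  have ig: "integrable M (\<lambda>x. g x * (f k x - g x))" for k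
  proof (rule Bochner_Integration.integrable_bound[OF Bochner_Integration.integrable_add[OF int(1)[of k] int(2)]])
    show "AE x in M. norm (g x * (f k x - g x)) \<le> norm ((f k x - g x)\<^sup>2 + (g x)\<^sup>2)"
    proof (rule AE_I2)
      fix x
      have "2 * \<bar>g x * (f k x - g x)\<bar> \<le> (f k x - g x)\<^sup>2 + (g x)\<^sup>2"
        using sum_squares_bound[of "\<bar>g x\<bar>" "\<bar>f k x - g x\<bar>"] by (simp add: abs_mult)
      then show "norm (g x * (f k x - g x)) \<le> norm ((f k x - g x)\<^sup>2 + (g x)\<^sup>2)" by simp
    qed
  qed (use f g in measurable)
  define e where "e k = (\<integral>x. (f k x - g x)\<^sup>2 \<partial>M)" for k
  define G where "G = (\<integral>x. (g x)\<^sup>2 \<partial>M)"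
  define b where "b k = (\<integral>x. g x * (f k x - g x) \<partial>M)" for k
  have sq: "(\<integral>x. (f k x)\<^sup>2 \<partial>M) = G + 2 * b k + e k" for k
  proof -
    have "(\<integral>x. (f k x)\<^sup>2 \<partial>M) = (\<integral>x. (g x)\<^sup>2 + 2 * (g x * (f k x - g x)) + (f k x - g x)\<^sup>2 \<partial>M)"
      by (intro Bochner_Integration.integral_cong refl) (simp add: power2_eq_square algebra_simps)
    also have "\<dots> = G + 2 * b k + e k"
      using int(1)[of k] int(2) ig[of k] by (simp add: G_def b_def e_def)
    finally show ?thesis .
  qed
  have "\<bar>b k\<bar> \<le> sqrt (G * e k)" for k
    using Cauchy_Schwarz_integral[OF int(2) int(1)[of k] ig[of k]] unfolding b_def G_def e_def
    by (intro real_le_rsqrt) simp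
  moreover have "(\<lambda>k. sqrt (G * e k)) \<longlonglongrightarrow> sqrt (G * 0)"
    using lim unfolding e_def by (intro tendsto_intros)
  ultimately have "b \<longlonglongrightarrow> 0"
    by (intro Lim_null_comparison[of b "\<lambda>k. sqrt (G * e k)"]) (auto intro!: always_eventually)
  then have "(\<lambda>k. G + 2 * b k + e k) \<longlonglongrightarrow> G + 2 * 0 + 0"
    using lim unfolding e_def by (intro tendsto_intros)
  then show ?thesis unfolding sq G_def by simp
qed

lemma powr_le_one_plus:
  fixes x s :: real
  assumes "x \<ge> 0" "0 \<le> s" "s \<le> 1"
  shows "x powr s \<le> 1 + x"
proof (cases "x \<le> 1")
  case True
  then show ?thesis using assms powr_le1[of s x] by simp
next
  case False
  then have "x powr s \<le> x powr 1" using assms by (intro powr_mono) auto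
  then show ?thesis using assms by simp
qed

text \<open>The mean value theorem, with the derivative at \<xi> bounded by
  \<open>2 * (1 + \<xi>)\<close>: for \<open>p \<le> 2\<close> it grows at most linearly, so that
  Cauchy-Schwarz in L^2 will suffice.\<close>

lemma powr_diff_bound:
  fixes a b p :: real
  assumes ab: "a \<ge> 0" "b \<ge> 0" and p: "1 \<le> p" "p \<le> 2"
  shows "\<bar>a powr p - b powr p\<bar> \<le> 2 * (1 + a + b) * \<bar>a - b\<bar>"
proof -
  have *: "b powr p - a powr p \<le> 2 * (1 + a + b) * (b - a)" if ab: "0 \<le> a" "a < b" for a b
  proof -
    have der: "((\<lambda>x. x powr p) has_real_derivative p * x powr (p - 1)) (at x)" if "x > 0" for x
      using that by (auto intro!: derivative_eq_intros)
    have cont: "continuous_on {a..b} (\<lambda>x. x powr p)"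
      using p ab by (intro continuous_on_powr' continuous_intros) auto
    have "(\<lambda>x. x powr p) differentiable (at x)" if "a < x" for x
      using der[of x] ab that unfolding real_differentiable_def by (meson le_less_trans)
    then obtain l \<xi> where \<xi>: "a < \<xi>" "\<xi> < b" and l: "((\<lambda>x. x powr p) has_real_derivative l) (at \<xi>)" "b powr p - a powr p = (b - a) * l"
      using MVT[OF ab(2) cont] by blast
    have "l = p * \<xi> powr (p - 1)"
      using DERIV_unique[OF l(1) der] \<xi> ab by simp
    with l(2) have \<xi>3: "b powr p - a powr p = (b - a) * (p * \<xi> powr (p - 1))" by simp
    have "\<xi> powr (p - 1) \<le> 1 + \<xi>" using \<xi> ab p by (intro powr_le_one_plus) auto
    then have "p * \<xi> powr (p - 1) \<le> 2 * (1 + a + b)" using p \<xi> ab by (intro mult_mono) auto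
    then show ?thesis unfolding \<xi>3 using ab by (subst mult.commute) (intro mult_right_mono, auto)
  qed
  show ?thesis
  proof (cases a b rule: linorder_cases)
    case less
    then have "a powr p \<le> b powr p" using ab p by (intro powr_mono2) auto
    then show ?thesis using *[OF ab(1) less] less by (simp add: add_ac)
  next
    case greater
    then have "b powr p \<le> a powr p" using ab p by (intro powr_mono2) auto
    then show ?thesis using *[OF ab(2) greater] greater by (simp add: add_ac)
  qed simp
qed

text \<open>By \<open>powr_diff_bound\<close> and Cauchy-Schwarz the integrals differ by at most the
  L^2 distance times the L^2 norm of \<open>1 + w k + U\<close>, up to a constant; that norm stays
  bounded because the L^2 norms of \<open>w k\<close> converge.\<close>

lemma integral_powr_limit:
  fixes U :: "'a \<Rightarrow> real"
  assumes fin: "prob_space M" and w: "\<And>k. w k \<in> borel_measurable M" "\<And>k x. x \<in> space M \<Longrightarrow> w k x \<ge> 0"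
    and U: "U \<in> borel_measurable M" "\<And>x. U x \<ge> 0"
    and int: "\<And>k. integrable M (\<lambda>x. (w k x - U x)\<^sup>2)" "integrable M (\<lambda>x. (U x)\<^sup>2)"
    and lim: "(\<lambda>k. \<integral>x. (w k x - U x)\<^sup>2 \<partial>M) \<longlonglongrightarrow> 0" and p: "1 \<le> p" "p \<le> 2"
  shows "(\<lambda>k. \<integral>x. w k x powr p \<partial>M) \<longlonglongrightarrow> (\<integral>x. U x powr p \<partial>M)" "integrable M (\<lambda>x. U x powr p)"
proof -
  interpret prob_space M by fact
  have pw: "integrable M (\<lambda>x. f x powr p)" if f: "f \<in> borel_measurable M" "\<And>x. x \<in> space M \<Longrightarrow> f x \<ge> 0" "integrable M (\<lambda>x. (f x)\<^sup>2)" for f :: "'a \<Rightarrow> real"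
  proof (rule Bochner_Integration.integrable_bound[OF Bochner_Integration.integrable_add[OF integrable_const[of 1] f(3)]])
    show "AE x in M. norm (f x powr p) \<le> norm (1 + (f x)\<^sup>2)"
    proof (rule AE_I2)
      fix x assume "x \<in> space M"
      then have fx: "f x \<ge> 0" by (rule f(2))
      have "f x powr p \<le> 1 + (f x)\<^sup>2"
      proof (cases "f x \<le> 1")
        case True
        then show ?thesis using fx p powr_le1[of p "f x"] by (simp add: add_increasing2)
      next
        case False
        then have "f x powr p \<le> f x powr 2" using p by (intro powr_mono) auto
        then show ?thesis using False by simp
      qed
      then show "norm (f x powr p) \<le> norm (1 + (f x)\<^sup>2)" by simp
    qed
  qed (use f(1) in measurable)
  show iU: "integrable M (\<lambda>x. U x powr p)" using U int(2) by (intro pw) auto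
  have w2: "integrable M (\<lambda>x. (w k x)\<^sup>2)" for k
  proof (rule Bochner_Integration.integrable_bound[OF Bochner_Integration.integrable_add[OF
        integrable_mult_right[OF int(1)[of k], of 2] integrable_mult_right[OF int(2), of 2]]])
    show "AE x in M. norm ((w k x)\<^sup>2) \<le> norm (2 * (w k x - U x)\<^sup>2 + 2 * (U x)\<^sup>2)"
    proof (rule AE_I2)
      fix x
      have "0 \<le> (w k x - 2 * U x)\<^sup>2" by simp
      then have "(w k x)\<^sup>2 \<le> 2 * (w k x - U x)\<^sup>2 + 2 * (U x)\<^sup>2"
        by (simp add: power2_eq_square algebra_simps)
      then show "norm ((w k x)\<^sup>2) \<le> norm (2 * (w k x - U x)\<^sup>2 + 2 * (U x)\<^sup>2)" by simp
    qed
  qed (use w(1) in measurable)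
  have iw: "integrable M (\<lambda>x. w k x powr p)" for k using w w2 by (intro pw) auto
  define S where "S k x = 1 + w k x + U x" for k x
  have Sm: "S k \<in> borel_measurable M" for k unfolding S_def[abs_def] using w(1) U(1) by measurable
  have S2: "integrable M (\<lambda>x. (S k x)\<^sup>2)" and S2le: "(\<integral>x. (S k x)\<^sup>2 \<partial>M) \<le> 3 + 3 * (\<integral>x. (w k x)\<^sup>2 \<partial>M) + 3 * (\<integral>x. (U x)\<^sup>2 \<partial>M)" for k
  proof -
    have pt: "(S k x)\<^sup>2 \<le> 3 + 3 * (w k x)\<^sup>2 + 3 * (U x)\<^sup>2" for x
    proof -
      have "0 \<le> (1 - w k x)\<^sup>2 + (1 - U x)\<^sup>2 + (w k x - U x)\<^sup>2" by simp
      then show ?thesis by (simp add: S_def power2_eq_square algebra_simps)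
    qed
    have i: "integrable M (\<lambda>x. 3 + 3 * (w k x)\<^sup>2 + 3 * (U x)\<^sup>2)" using w2[of k] int(2) by simp
    show S2: "integrable M (\<lambda>x. (S k x)\<^sup>2)"
      by (rule Bochner_Integration.integrable_bound[OF i])
         (use Sm[of k] pt in \<open>auto intro!: AE_I2 borel_measurable_power abs_ge_self[THEN order_trans[rotated]] order_trans[OF pt]\<close>)
    have "(\<integral>x. (S k x)\<^sup>2 \<partial>M) \<le> (\<integral>x. 3 + 3 * (w k x)\<^sup>2 + 3 * (U x)\<^sup>2 \<partial>M)"
      using S2 i pt by (intro Bochner_Integration.integral_mono) auto
    then show "(\<integral>x. (S k x)\<^sup>2 \<partial>M) \<le> 3 + 3 * (\<integral>x. (w k x)\<^sup>2 \<partial>M) + 3 * (\<integral>x. (U x)\<^sup>2 \<partial>M)"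
      using w2[of k] int(2) prob_space by simp
  qed
  have wU: "w k \<in> borel_measurable M" "(\<lambda>x. \<bar>w k x - U x\<bar>) \<in> borel_measurable M" for k
    using w(1) U(1) by measurable
  have iS: "integrable M (\<lambda>x. S k x * \<bar>w k x - U x\<bar>)" for k
  proof (rule Bochner_Integration.integrable_bound[OF Bochner_Integration.integrable_add[OF S2[of k] int(1)[of k]]])
    show "AE x in M. norm (S k x * \<bar>w k x - U x\<bar>) \<le> norm ((S k x)\<^sup>2 + (w k x - U x)\<^sup>2)"
    proof (rule AE_I2)
      fix x
      have "2 * \<bar>S k x * \<bar>w k x - U x\<bar>\<bar> \<le> (S k x)\<^sup>2 + (w k x - U x)\<^sup>2"
        using sum_squares_bound[of "\<bar>S k x\<bar>" "\<bar>w k x - U x\<bar>"] by (simp add: abs_mult)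
      then show "norm (S k x * \<bar>w k x - U x\<bar>) \<le> norm ((S k x)\<^sup>2 + (w k x - U x)\<^sup>2)" by simp
    qed
  qed (use Sm wU in measurable)
  have le: "norm ((\<integral>x. w k x powr p \<partial>M) - (\<integral>x. U x powr p \<partial>M))
     \<le> 2 * sqrt ((3 + 3 * (\<integral>x. (w k x)\<^sup>2 \<partial>M) + 3 * (\<integral>x. (U x)\<^sup>2 \<partial>M)) * (\<integral>x. (w k x - U x)\<^sup>2 \<partial>M))" for k
  proof -
    have "(\<integral>x. w k x powr p \<partial>M) - (\<integral>x. U x powr p \<partial>M) = (\<integral>x. w k x powr p - U x powr p \<partial>M)"
      using iw iU by simp
    also have "\<bar>\<dots>\<bar> \<le> (\<integral>x. \<bar>w k x powr p - U x powr p\<bar> \<partial>M)" by (rule integral_abs_bound)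
    also have "\<dots> \<le> (\<integral>x. 2 * (S k x * \<bar>w k x - U x\<bar>) \<partial>M)"
    proof (intro Bochner_Integration.integral_mono integrable_abs Bochner_Integration.integrable_diff iw iU integrable_mult_right iS)
      fix x assume "x \<in> space M"
      from powr_diff_bound[OF w(2)[OF this, of k] U(2)[of x] p]
      show "\<bar>w k x powr p - U x powr p\<bar> \<le> 2 * (S k x * \<bar>w k x - U x\<bar>)"
        unfolding S_def by (simp only: mult.assoc)
    qed
    also have "\<dots> = 2 * (\<integral>x. S k x * \<bar>w k x - U x\<bar> \<partial>M)" by simp
    also have "(\<integral>x. S k x * \<bar>w k x - U x\<bar> \<partial>M) \<le> sqrt ((\<integral>x. (S k x)\<^sup>2 \<partial>M) * (\<integral>x. (w k x - U x)\<^sup>2 \<partial>M))"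
    proof -
      have "(\<integral>x. S k x * \<bar>w k x - U x\<bar> \<partial>M)\<^sup>2 \<le> (\<integral>x. (S k x)\<^sup>2 \<partial>M) * (\<integral>x. \<bar>w k x - U x\<bar>\<^sup>2 \<partial>M)"
        using S2[of k] int(1)[of k] iS[of k] by (intro Cauchy_Schwarz_integral) simp_all
      then show ?thesis by (intro real_le_rsqrt) simp
    qed
    also have "\<dots> \<le> sqrt ((3 + 3 * (\<integral>x. (w k x)\<^sup>2 \<partial>M) + 3 * (\<integral>x. (U x)\<^sup>2 \<partial>M)) * (\<integral>x. (w k x - U x)\<^sup>2 \<partial>M))"
      by (intro real_sqrt_le_mono mult_right_mono S2le Bochner_Integration.integral_nonneg) auto
    finally show ?thesis by simp
  qed
  have "(\<lambda>k. 2 * sqrt ((3 + 3 * (\<integral>x. (w k x)\<^sup>2 \<partial>M) + 3 * (\<integral>x. (U x)\<^sup>2 \<partial>M)) * (\<integral>x. (w k x - U x)\<^sup>2 \<partial>M)))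
    \<longlonglongrightarrow> 2 * sqrt ((3 + 3 * (\<integral>x. (U x)\<^sup>2 \<partial>M) + 3 * (\<integral>x. (U x)\<^sup>2 \<partial>M)) * 0)"
    by (intro tendsto_intros lim integral_square_limit w(1) U(1) int)
  then have "(\<lambda>k. (\<integral>x. w k x powr p \<partial>M) - (\<integral>x. U x powr p \<partial>M)) \<longlonglongrightarrow> 0"
    by (intro Lim_null_comparison[OF always_eventually[OF allI[OF le]]]) simp
  then show "(\<lambda>k. \<integral>x. w k x powr p \<partial>M) \<longlonglongrightarrow> (\<integral>x. U x powr p \<partial>M)"
    by (simp add: LIM_zero_iff)
qed

text \<open>This serves exponents above 2, which L^2 convergence does not control: it still gives a
  subsequence converging almost everywhere, and Fatou's lemma then bounds the limit.\<close>

lemma integral_powr_Fatou: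
  fixes U :: "'a \<Rightarrow> real"
  assumes w: "\<And>k. w k \<in> borel_measurable M" "\<And>k x. x \<in> space M \<Longrightarrow> w k x \<ge> 0" "\<And>k. integrable M (\<lambda>x. w k x powr p)"
    and U: "U \<in> borel_measurable M" "\<And>x. U x \<ge> 0"
    and int: "\<And>k. integrable M (\<lambda>x. (w k x - U x)\<^sup>2)"
    and lim: "(\<lambda>k. \<integral>x. (w k x - U x)\<^sup>2 \<partial>M) \<longlonglongrightarrow> 0" and p: "p > 0"
    and bound: "\<And>k. (\<integral>x. w k x powr p \<partial>M) \<le> b k" and b: "b \<longlonglongrightarrow> C"
  shows "(\<integral>x. U x powr p \<partial>M) \<le> C"
proof -
  obtain r where r: "strict_mono r" "AE x in M. (\<lambda>n. (w (r n) x - U x)\<^sup>2) \<longlonglongrightarrow> 0"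
    using tendsto_L1_AE_subseq[of M "\<lambda>k x. (w k x - U x)\<^sup>2"] int lim by auto
  have lims: "AE x in M. (\<lambda>n. w (r n) x powr p) \<longlonglongrightarrow> U x powr p"
    using r(2) AE_space
  proof (eventually_elim)
    case (elim x)
    then have "(\<lambda>n. sqrt ((w (r n) x - U x)\<^sup>2)) \<longlonglongrightarrow> sqrt 0" by (intro tendsto_intros)
    then have "(\<lambda>n. w (r n) x - U x) \<longlonglongrightarrow> 0" by (simp add: tendsto_rabs_zero_iff)
    then have "(\<lambda>n. w (r n) x) \<longlonglongrightarrow> U x" by (simp add: LIM_zero_iff)
    then show ?case using p w(2)[OF elim(2)] by (intro tendsto_powr2 tendsto_const always_eventually) auto
  qed
  have "(\<integral>\<^sup>+x. ennreal (U x powr p) \<partial>M) = (\<integral>\<^sup>+x. liminf (\<lambda>n. ennreal (w (r n) x powr p)) \<partial>M)"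
  proof (intro nn_integral_cong_AE)
    show "AE x in M. ennreal (U x powr p) = liminf (\<lambda>n. ennreal (w (r n) x powr p))"
      using lims
    proof eventually_elim
      case (elim x)
      then have "(\<lambda>n. ennreal (w (r n) x powr p)) \<longlonglongrightarrow> ennreal (U x powr p)" by (intro tendsto_ennrealI)
      from lim_imp_Liminf[OF _ this] show ?case by simp
    qed
  qed
  also have "\<dots> \<le> liminf (\<lambda>n. \<integral>\<^sup>+x. ennreal (w (r n) x powr p) \<partial>M)"
    by (intro nn_integral_liminf) (use w(1) in measurable)
  also have "\<dots> \<le> liminf (\<lambda>n. ennreal (b (r n)))"
  proof (intro Liminf_mono always_eventually allI)
    fix n
    have "(\<integral>\<^sup>+x. ennreal (w (r n) x powr p) \<partial>M) = ennreal (\<integral>x. w (r n) x powr p \<partial>M)"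
      by (intro nn_integral_eq_integral w(3)) auto
    then show "(\<integral>\<^sup>+x. ennreal (w (r n) x powr p) \<partial>M) \<le> ennreal (b (r n))"
      using bound[of "r n"] by (simp add: ennreal_leI)
  qed
  also have "\<dots> = ennreal C"
  proof -
    have "(\<lambda>n. ennreal (b (r n))) \<longlonglongrightarrow> ennreal C"
      using LIMSEQ_subseq_LIMSEQ[OF b r(1)] by (intro tendsto_ennrealI) (simp add: o_def)
    from lim_imp_Liminf[OF _ this] show ?thesis by simp
  qed
  finally have le: "(\<integral>\<^sup>+x. ennreal (U x powr p) \<partial>M) \<le> ennreal C" .
  have C: "C \<ge> 0"
  proof (rule LIMSEQ_le_const[OF b])
    have "0 \<le> b k" for k using bound[of k] by (rule order_trans[rotated]) (intro Bochner_Integration.integral_nonneg, simp)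
    then show "\<exists>N. \<forall>n\<ge>N. 0 \<le> b n" by blast
  qed
  \<comment> \<open>Integrability is secured before the integral is estimated: a nonintegrable power
    would have Bochner integral 0 by default, and the estimate would say nothing about it.\<close>
  have "integrable M (\<lambda>x. U x powr p)"
    using le U by (intro integrableI_bounded) (auto simp: less_top[symmetric] top_unique)
  then have "ennreal (\<integral>x. U x powr p \<partial>M) \<le> ennreal C"
    using le by (subst nn_integral_eq_integral[symmetric]) auto
  then show ?thesis using C by (simp add: ennreal_le_iff)
qed

lemma C1_on_sphere_imp_C1S:
  fixes v :: "real^'n::finite \<Rightarrow> real"
  assumes "C1_on_sphere v dv"
  shows "C1S v" and "\<And>x. x \<in> sphere 0 1 \<Longrightarrow> Gam v v x = (norm (tang_grad (dv x) x))\<^sup>2"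
proof -
  have der: "(v has_derivative (\<lambda>h. dv x \<bullet> h)) (at x)" if "x \<in> sphere 0 1" for x
    using assms that by (simp add: C1_on_sphere_def)
  have PDv: "PD i v x = dv x $ i" if "x \<in> sphere 0 1" for i x
    using PD_eqI[OF der[OF that], of i] by (simp add: inner_axis)
  show "C1S v"
    unfolding C1S_def
  proof (intro conjI ballI allI)
    fix x :: "real^'n" assume "x \<in> sphere 0 1"
    from der[OF this] show "v differentiable at x" unfolding differentiable_def by blast
  next
    fix a :: "'n \<times> 'n"
    have "continuous_on (sphere 0 1) dv" using assms by (simp add: C1_on_sphere_def)
    then have "continuous_on (sphere 0 1) (\<lambda>x. x $ fst a * dv x $ snd a - x $ snd a * dv x $ fst a)"
      by (intro continuous_intros)
    moreover have "LD a v x = x $ fst a * dv x $ snd a - x $ snd a * dv x $ fst a" if "x \<in> sphere 0 1" for x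
      by (simp only: LD_def PDv[OF that])
    ultimately show "continuous_on (sphere 0 1) (LD a v)"
      by (subst continuous_on_cong[OF refl]) auto
  qed
  fix x :: "real^'n" assume x: "x \<in> sphere 0 1"
  have "(\<chi> i. PD i v x) = dv x" by (simp add: vec_eq_iff PDv[OF x])
  then show "Gam v v x = (norm (tang_grad (dv x) x))\<^sup>2"
    using x by (simp add: Gam_eq_sphere tang_grad_def power2_norm_eq_inner)
qed

text \<open>The square root of \<open>v\<^sup>2 + e\<^sup>2\<close> is a strictly positive
  substitute for \<open>\<bar>v\<bar>\<close>, so its real powers are C1. It does not raise the
  Dirichlet integrand: differentiating its square gives \<open>w * LD a w = v * LD a v\<close>, and
  \<open>w\<close> is at least \<open>\<bar>v\<bar>\<close>.\<close>

lemma smoothed_abs: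
  fixes v :: "real^'n::finite \<Rightarrow> real"
  assumes v: "C1S v" and e: "e > 0"
  defines "w \<equiv> \<lambda>x. (v x * v x + e * e) powr (1 / 2)"
  shows "C1S w" "w x > 0" "\<bar>w x - \<bar>v x\<bar>\<bar> \<le> e"
    "x \<in> sphere 0 1 \<Longrightarrow> Gam w w x \<le> Gam v v x"
proof -
  have sp: "v x * v x + e * e > 0" for x using e by (intro add_nonneg_pos) auto
  have s: "C1S (\<lambda>x. v x * v x + e * e)" by (intro C1S_add C1S_mult v C1S_rpoly rpoly_const)
  show "C1S w" unfolding w_def by (intro C1S_powr s sp)
  show wpos: "w x > 0" unfolding w_def using sp[of x] e by simp
  have wsq: "w x * w x = v x * v x + e * e" for x
    unfolding w_def powr_add[symmetric] using sp[of x] by simp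
  have "\<bar>v x\<bar> \<le> w x"
  proof (rule power2_le_imp_le)
    show "\<bar>v x\<bar>\<^sup>2 \<le> (w x)\<^sup>2" using wsq[of x] by (simp add: power2_eq_square)
  qed (use wpos in simp)
  moreover have "w x \<le> \<bar>v x\<bar> + e"
  proof (rule power2_le_imp_le)
    have "(\<bar>v x\<bar> + e)\<^sup>2 = v x * v x + e * e + 2 * \<bar>v x\<bar> * e" by (simp add: power2_eq_square algebra_simps)
    then show "(w x)\<^sup>2 \<le> (\<bar>v x\<bar> + e)\<^sup>2" using wsq[of x] e by (simp add: power2_eq_square)
  qed (use e in simp)
  ultimately show "\<bar>w x - \<bar>v x\<bar>\<bar> \<le> e" by simp
  assume x: "x \<in> sphere 0 1"
  have LDw: "w x * LD a w x = v x * LD a v x" for a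
  proof -
    have "LD a (\<lambda>x. v x * v x + e * e) x = 2 * (v x * LD a v x)"
      using C1S_diff[OF v x] by (subst LD_add) (auto simp: LD_mult)
    moreover have "LD a (\<lambda>x. w x * w x) x = 2 * (w x * LD a w x)"
      using C1S_diff[OF \<open>C1S w\<close> x] by (simp add: LD_mult)
    ultimately show ?thesis unfolding wsq by simp
  qed
  have "(LD a w x)\<^sup>2 \<le> (LD a v x)\<^sup>2" for a
  proof -
    have "(w x)\<^sup>2 * (LD a w x)\<^sup>2 = (v x)\<^sup>2 * (LD a v x)\<^sup>2"
      unfolding power_mult_distrib[symmetric] LDw ..
    also have "\<dots> \<le> (w x)\<^sup>2 * (LD a v x)\<^sup>2"
      using wsq[of x] by (intro mult_right_mono) (auto simp: power2_eq_square)
    finally show ?thesis using wpos by simp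
  qed
  then show "Gam w w x \<le> Gam v v x"
    unfolding Gam_def power2_eq_square[symmetric] by (intro divide_right_mono sum_mono) auto
qed

section \<open>Passage to Sobolev functions\<close>

lemma borel_measurable_smeas [intro]:
  "f \<in> borel_measurable borel \<Longrightarrow> f \<in> borel_measurable (smeas :: (real^'n::finite) measure)"
  unfolding smeas_def by (intro measurable_restrict_space1) (simp add: measurable_cong_sets[OF sets_sphere_mu refl])

lemma nn_integral_limit_smeas:
  fixes h :: "nat \<Rightarrow> real^'n::finite \<Rightarrow> real"
  assumes h: "\<And>k. h k \<in> borel_measurable borel" "\<And>k x. h k x \<ge> 0" "\<And>k. integrable smeas (h k)"
    and lim: "(\<lambda>k. \<integral>\<^sup>+ x. ennreal (h k x) \<partial>sphere_mu) \<longlonglongrightarrow> 0"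
  shows "(\<lambda>k. \<integral>x. h k x \<partial>smeas) \<longlonglongrightarrow> 0"
proof -
  have "(\<integral>\<^sup>+ x. ennreal (h k x) \<partial>sphere_mu) = ennreal (\<integral>x. h k x \<partial>smeas)" for k
    using h(3)[of k] h(2) unfolding integral_smeas(1)[OF h(1)] integral_smeas(2)[OF h(1)]
    by (intro nn_integral_eq_integral) auto
  with lim have "(\<lambda>k. ennreal (\<integral>x. h k x \<partial>smeas)) \<longlonglongrightarrow> ennreal 0" by simp
  then show ?thesis
    by (subst (asm) tendsto_ennreal_iff) (auto intro!: always_eventually Bochner_Integration.integral_nonneg h(2))
qed

text \<open>The approximants \<open>v k\<close> of \<open>u\<close> are smoothed to positive
  functions \<open>w k\<close> that converge to \<open>\<bar>u\<bar>\<close> in L^2. Their Dirichlet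
  integrals do not exceed those of \<open>v k\<close>, and an upper bound is all that the inequality
  asks of them.\<close>

lemma interpolation_H1:
  fixes u :: "real^'n::finite \<Rightarrow> real" and G :: "real^'n \<Rightarrow> real^'n"
  defines "d \<equiv> real CARD('n) - 1" and "y \<equiv> \<integral>x. (u x)\<^sup>2 \<partial>smeas" and "j \<equiv> \<integral>x. (norm (G x))\<^sup>2 \<partial>smeas"
  assumes H1: "H1_sphere u G" and n: "CARD('n) \<ge> 2"
    and p: "p \<ge> 1" "p \<noteq> 2" and g: "g = BE_gamma d p" "g \<ge> 0" "g \<noteq> 2 - p"
    and \<kappa>: "\<kappa> = g / (p - 2)" and K: "K = d / (p - 2 + g)" and y: "y > 0"
  shows "K * ((\<integral>x. \<bar>u x\<bar> powr p \<partial>smeas) powr (2 / p)) powr (\<kappa> + 1) \<le> j * y powr \<kappa> + K * y powr (\<kappa> + 1)"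
proof -
  have u [measurable]: "u \<in> borel_measurable borel" and G [measurable]: "G \<in> borel_measurable borel"
    using H1 by (simp_all add: H1_sphere_def)
  have u2: "integrable smeas (\<lambda>x. (u x)\<^sup>2)" and G2: "integrable smeas (\<lambda>x. (norm (G x))\<^sup>2)"
    using H1 by (subst integral_smeas(2); simp add: H1_sphere_def)+
  obtain v dv where C1: "\<And>k. C1_on_sphere (v k) (dv k)"
    and lim_v: "(\<lambda>k. \<integral>\<^sup>+ x. ennreal ((v k x - u x)\<^sup>2) \<partial>sphere_mu) \<longlonglongrightarrow> 0"
    and lim_G: "(\<lambda>k. \<integral>\<^sup>+ x. ennreal ((norm (tang_grad (dv k x) x - G x))\<^sup>2) \<partial>sphere_mu) \<longlonglongrightarrow> 0"
    using H1 unfolding H1_sphere_def by blast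
  have v [measurable]: "v k \<in> borel_measurable borel" and dv [measurable]: "dv k \<in> borel_measurable borel" for k
    using C1[of k] by (simp_all add: C1_on_sphere_def)
  have vC: "C1S (v k)" and Gv: "x \<in> sphere 0 1 \<Longrightarrow> Gam (v k) (v k) x = (norm (tang_grad (dv k x) x))\<^sup>2" for k x
    using C1_on_sphere_imp_C1S[OF C1[of k]] by auto
  have T [measurable]: "(\<lambda>x. tang_grad (dv k x) x) \<in> borel_measurable borel" for k
    unfolding tang_grad_def by measurable
  have v2: "integrable smeas (\<lambda>x. (v k x)\<^sup>2)" for k
    by (intro integrable_smeas_continuous continuous_on_power C1S_cont vC)
  have T2: "integrable smeas (\<lambda>x. (norm (tang_grad (dv k x) x))\<^sup>2)" for k
  proof -
    have "integrable smeas (Gam (v k) (v k))" by (intro integrable_smeas_continuous continuous_Gam vC)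
    then show ?thesis
      by (subst Bochner_Integration.integrable_cong[OF refl, of _ _ "Gam (v k) (v k)"]) (simp_all add: Gv)
  qed
  have sq: "(a - b)\<^sup>2 \<le> 2 * a\<^sup>2 + 2 * b\<^sup>2" for a b :: real
  proof -
    have "0 \<le> (a + b)\<^sup>2" by simp
    then show ?thesis by (simp add: power2_eq_square algebra_simps)
  qed
  have vu2: "integrable smeas (\<lambda>x. (v k x - u x)\<^sup>2)" for k
    by (rule Bochner_Integration.integrable_bound[OF Bochner_Integration.integrable_add[OF
          integrable_mult_right[OF v2[of k], of 2] integrable_mult_right[OF u2, of 2]]])
       (auto intro!: AE_I2 borel_measurable_smeas simp: sq)
  have TG2: "integrable smeas (\<lambda>x. (norm (tang_grad (dv k x) x - G x))\<^sup>2)" for k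
  proof (rule Bochner_Integration.integrable_bound[OF Bochner_Integration.integrable_add[OF
          integrable_mult_right[OF T2[of k], of 2] integrable_mult_right[OF G2, of 2]]])
    show "AE x in smeas. norm ((norm (tang_grad (dv k x) x - G x))\<^sup>2)
       \<le> norm (2 * (norm (tang_grad (dv k x) x))\<^sup>2 + 2 * (norm (G x))\<^sup>2)"
    proof (rule AE_I2)
      fix x
      have "(norm (tang_grad (dv k x) x - G x))\<^sup>2 \<le> (norm (tang_grad (dv k x) x) - - norm (G x))\<^sup>2"
        using norm_triangle_ineq4[of "tang_grad (dv k x) x" "G x"] by (intro power_mono) auto
      also have "\<dots> \<le> 2 * (norm (tang_grad (dv k x) x))\<^sup>2 + 2 * (- norm (G x))\<^sup>2" by (rule sq)
      finally show "norm ((norm (tang_grad (dv k x) x - G x))\<^sup>2)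
       \<le> norm (2 * (norm (tang_grad (dv k x) x))\<^sup>2 + 2 * (norm (G x))\<^sup>2)" by simp
    qed
  qed (intro borel_measurable_smeas, measurable)
  have lv: "(\<lambda>k. \<integral>x. (v k x - u x)\<^sup>2 \<partial>smeas) \<longlonglongrightarrow> 0"
    by (rule nn_integral_limit_smeas[OF _ _ vu2 lim_v]) auto
  have lG: "(\<lambda>k. \<integral>x. (norm (tang_grad (dv k x) x - G x))\<^sup>2 \<partial>smeas) \<longlonglongrightarrow> 0"
    by (rule nn_integral_limit_smeas[OF _ _ TG2 lim_G]) auto

  define jj where "jj k = (\<integral>x. Gam (v k) (v k) x \<partial>smeas)" for k
  have jlim: "jj \<longlonglongrightarrow> j"
  proof -
    \<comment> \<open>The reverse triangle inequality passes from the vector fields to their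
      lengths, to which the scalar \<open>integral_square_limit\<close> applies.\<close>
    have tri: "(norm (tang_grad (dv k x) x) - norm (G x))\<^sup>2 \<le> (norm (tang_grad (dv k x) x - G x))\<^sup>2" for k x
      using norm_triangle_ineq3[of "tang_grad (dv k x) x" "G x"] by (simp add: abs_le_square_iff[symmetric])
    have i: "integrable smeas (\<lambda>x. (norm (tang_grad (dv k x) x) - norm (G x))\<^sup>2)" for k
      by (rule Bochner_Integration.integrable_bound[OF TG2[of k]])
         (auto intro!: AE_I2 borel_measurable_smeas simp: tri)
    have "(\<lambda>k. \<integral>x. (norm (tang_grad (dv k x) x) - norm (G x))\<^sup>2 \<partial>smeas) \<longlonglongrightarrow> 0"
    proof (rule tendsto_sandwich[OF _ _ tendsto_const lG])
      show "\<forall>\<^sub>F k in sequentially. (\<integral>x. (norm (tang_grad (dv k x) x) - norm (G x))\<^sup>2 \<partial>smeas) \<le> (\<integral>x. (norm (tang_grad (dv k x) x - G x))\<^sup>2 \<partial>smeas)"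
        by (intro always_eventually allI Bochner_Integration.integral_mono i TG2 tri)
    qed (auto intro!: always_eventually Bochner_Integration.integral_nonneg)
    then have "(\<lambda>k. \<integral>x. (norm (tang_grad (dv k x) x))\<^sup>2 \<partial>smeas) \<longlonglongrightarrow> (\<integral>x. (norm (G x))\<^sup>2 \<partial>smeas)"
      by (intro integral_square_limit i G2) (auto intro!: borel_measurable_smeas)
    moreover have "jj = (\<lambda>k. \<integral>x. (norm (tang_grad (dv k x) x))\<^sup>2 \<partial>smeas)"
      unfolding jj_def by (intro ext Bochner_Integration.integral_cong refl Gv) simp
    ultimately show ?thesis unfolding j_def by simp
  qed

  define e where "e k = 1 / (real k + 1)" for k :: nat
  have e: "e k > 0" for k by (simp add: e_def)
  have elim: "e \<longlonglongrightarrow> 0" unfolding e_def using LIMSEQ_inverse_real_of_nat by (simp add: inverse_eq_divide add.commute)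
  define w where "w k = (\<lambda>x. (v k x * v k x + e k * e k) powr (1 / 2))" for k
  have w: "C1S (w k)" "w k x > 0" "\<bar>w k x - \<bar>v k x\<bar>\<bar> \<le> e k"
    "x \<in> sphere 0 1 \<Longrightarrow> Gam (w k) (w k) x \<le> Gam (v k) (v k) x" for k x
    unfolding w_def using smoothed_abs[OF vC[of k] e[of k]] by blast+
  have wm: "w k \<in> borel_measurable smeas" for k by (intro measurable_smeas_continuous C1S_cont w)
  have um: "(\<lambda>x. \<bar>u x\<bar>) \<in> borel_measurable smeas" by (intro borel_measurable_smeas) measurable
  have wu: "(w k x - \<bar>u x\<bar>)\<^sup>2 \<le> 2 * (e k)\<^sup>2 + 2 * (v k x - u x)\<^sup>2" for k x
  proof -
    have "\<bar>w k x - \<bar>u x\<bar>\<bar> \<le> e k + \<bar>v k x - u x\<bar>" using w(3)[of k x] by linarith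
    then have "\<bar>w k x - \<bar>u x\<bar>\<bar>\<^sup>2 \<le> (e k - - \<bar>v k x - u x\<bar>)\<^sup>2" by (intro power_mono) auto
    also have "\<dots> \<le> 2 * (e k)\<^sup>2 + 2 * (- \<bar>v k x - u x\<bar>)\<^sup>2" by (rule sq)
    finally show ?thesis by simp
  qed
  have wu2: "integrable smeas (\<lambda>x. (w k x - \<bar>u x\<bar>)\<^sup>2)" for k
  proof (rule Bochner_Integration.integrable_bound[OF Bochner_Integration.integrable_add[OF
        smeas.integrable_const[of "2 * (e k)\<^sup>2"] integrable_mult_right[OF vu2[of k], of 2]]])
    show "(\<lambda>x. (w k x - \<bar>u x\<bar>)\<^sup>2) \<in> borel_measurable smeas" using wm um by measurable
  qed (auto intro!: AE_I2 wu)
  have lw: "(\<lambda>k. \<integral>x. (w k x - \<bar>u x\<bar>)\<^sup>2 \<partial>smeas) \<longlonglongrightarrow> 0"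
  proof (rule tendsto_sandwich[OF _ _ tendsto_const])
    show "\<forall>\<^sub>F k in sequentially. (\<integral>x. (w k x - \<bar>u x\<bar>)\<^sup>2 \<partial>smeas) \<le> 2 * (e k)\<^sup>2 + 2 * (\<integral>x. (v k x - u x)\<^sup>2 \<partial>smeas)"
    proof (intro always_eventually allI)
      fix k
      have "(\<integral>x. (w k x - \<bar>u x\<bar>)\<^sup>2 \<partial>smeas) \<le> (\<integral>x. 2 * (e k)\<^sup>2 + 2 * (v k x - u x)\<^sup>2 \<partial>smeas)"
        using vu2[of k] by (intro Bochner_Integration.integral_mono wu2 wu) auto
      also have "\<dots> = 2 * (e k)\<^sup>2 + 2 * (\<integral>x. (v k x - u x)\<^sup>2 \<partial>smeas)"
        using vu2[of k] by simp
      finally show "(\<integral>x. (w k x - \<bar>u x\<bar>)\<^sup>2 \<partial>smeas) \<le> 2 * (e k)\<^sup>2 + 2 * (\<integral>x. (v k x - u x)\<^sup>2 \<partial>smeas)" .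
    qed
    have "(\<lambda>k. 2 * (e k)\<^sup>2 + 2 * (\<integral>x. (v k x - u x)\<^sup>2 \<partial>smeas)) \<longlonglongrightarrow> 2 * 0\<^sup>2 + 2 * 0"
      by (intro tendsto_intros elim lv)
    then show "(\<lambda>k. 2 * (e k)\<^sup>2 + 2 * (\<integral>x. (v k x - u x)\<^sup>2 \<partial>smeas)) \<longlonglongrightarrow> 0" by simp
  qed (auto intro!: always_eventually Bochner_Integration.integral_nonneg)
  define yy where "yy k = (\<integral>x. (w k x)\<^sup>2 \<partial>smeas)" for k
  have au2: "integrable smeas (\<lambda>x. \<bar>u x\<bar>\<^sup>2)" using u2 by simp
  have ylim: "yy \<longlonglongrightarrow> y"
    using integral_square_limit[OF wm um wu2 au2 lw] by (simp add: yy_def[abs_def] y_def)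

  define PP where "PP k = (\<integral>x. w k x powr p \<partial>smeas)" for k
  define P where "P = (\<integral>x. \<bar>u x\<bar> powr p \<partial>smeas)"
  define R where "R k = jj k * yy k powr \<kappa> + K * yy k powr (\<kappa> + 1)" for k
  have Rlim: "R \<longlonglongrightarrow> j * y powr \<kappa> + K * y powr (\<kappa> + 1)"
    unfolding R_def[abs_def] using y by (intro tendsto_intros jlim ylim) auto
  have ineq: "K * (PP k powr (2 / p)) powr (\<kappa> + 1) \<le> R k" for k
  proof -
    have "K * (PP k powr (2 / p)) powr (\<kappa> + 1) \<le> (\<integral>x. Gam (w k) (w k) x \<partial>smeas) * yy k powr \<kappa> + K * yy k powr (\<kappa> + 1)"
      unfolding PP_def yy_def
      by (rule interpolation_C1S_pos[OF w(1) w(2) n p g[unfolded d_def] \<kappa> K[unfolded d_def]])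
    also have "(\<integral>x. Gam (w k) (w k) x \<partial>smeas) \<le> jj k"
      unfolding jj_def by (intro Bochner_Integration.integral_mono integrable_smeas_continuous continuous_Gam w vC) simp
    finally show ?thesis unfolding R_def by (simp add: mult_right_mono)
  qed
  have jnn: "j \<ge> 0" unfolding j_def by (intro Bochner_Integration.integral_nonneg) simp
  have "K * (P powr (2 / p)) powr (\<kappa> + 1) \<le> j * y powr \<kappa> + K * y powr (\<kappa> + 1)"
  \<comment> \<open>For \<open>p < 2\<close> the constant \<open>K\<close> may be negative, so the
    left side has to converge, which \<open>integral_powr_limit\<close> provides. For
    \<open>p > 2\<close> it is positive and an upper bound for \<open>P\<close> is enough.\<close>
  proof (cases "p < 2")
    case True
    have "PP \<longlonglongrightarrow> P" and iP: "integrable smeas (\<lambda>x. \<bar>u x\<bar> powr p)"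
      unfolding PP_def[abs_def] P_def using True p w(2)
      by (intro integral_powr_limit[OF smeas.prob_space_axioms wm _ um _ wu2 au2 lw]; simp add: less_imp_le)+
    \<comment> \<open>The exponent \<open>\<kappa> + 1\<close> may be negative, so the limit of the
      powers requires a nonzero base; \<open>y > 0\<close> guarantees it.\<close>
    have "P \<noteq> 0"
    proof
      assume "P = 0"
      then have "AE x in smeas. \<bar>u x\<bar> powr p = 0"
        using iP unfolding P_def by (subst (asm) integral_nonneg_eq_0_iff_AE) auto
      then have "AE x in smeas. (u x)\<^sup>2 = 0" by eventually_elim (auto simp: powr_eq_0_iff)
      then have "y = (\<integral>x. 0 \<partial>(smeas :: (real^'n) measure))"
        unfolding y_def by (intro integral_cong_AE) (auto intro!: borel_measurable_smeas)
      with y show False by simp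
    qed
    then have "(\<lambda>k. K * (PP k powr (2 / p)) powr (\<kappa> + 1)) \<longlonglongrightarrow> K * (P powr (2 / p)) powr (\<kappa> + 1)"
      using \<open>PP \<longlonglongrightarrow> P\<close> by (intro tendsto_intros) auto
    then show ?thesis using Rlim ineq by (intro LIMSEQ_le) auto
  next
    case False
    then have p2: "p > 2" using p by simp
    have d: "d > 0" using n by (simp add: d_def)
    have K0: "K > 0" unfolding K using p2 g(2) d by (intro divide_pos_pos) auto
    have \<kappa>0: "\<kappa> \<ge> 0" unfolding \<kappa> using p2 g(2) by simp
    \<comment> \<open>The total exponent of the integral on the left. Being positive it can be
      inverted, which bounds \<open>PP k\<close> itself as Fatou's lemma requires, and it is
      restored afterwards.\<close>
    define b where "b = 2 / p * (\<kappa> + 1)"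
    have b: "b > 0" unfolding b_def using p2 \<kappa>0 by (intro mult_pos_pos) auto
    have PPnn: "PP k \<ge> 0" for k unfolding PP_def by (intro Bochner_Integration.integral_nonneg) simp
    have Pb: "PP k powr b \<le> R k / K" for k
      using ineq[of k] K0 unfolding powr_powr b_def[symmetric] by (simp add: field_simps)
    have "PP k \<le> (R k / K) powr (1 / b)" for k
    proof -
      have "PP k = (PP k powr b) powr (1 / b)" using b PPnn[of k] by (simp add: powr_powr)
      also have "\<dots> \<le> (R k / K) powr (1 / b)" using b Pb[of k] by (intro powr_mono2) auto
      finally show ?thesis .
    qed
    moreover have "(\<lambda>k. (R k / K) powr (1 / b)) \<longlonglongrightarrow> ((j * y powr \<kappa> + K * y powr (\<kappa> + 1)) / K) powr (1 / b)"
    proof (intro tendsto_powr2 tendsto_divide Rlim tendsto_const always_eventually allI)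
      show "0 \<le> R k / K" for k using Pb[of k] by (rule order_trans[rotated]) simp
    qed (use K0 b in auto)
    ultimately have "P \<le> ((j * y powr \<kappa> + K * y powr (\<kappa> + 1)) / K) powr (1 / b)"
      unfolding P_def PP_def using p2 w(2)
      by (intro integral_powr_Fatou[OF wm _ _ um _ wu2 lw])
         (auto intro: less_imp_le integrable_smeas_continuous C1S_cont[OF C1S_powr[OF w(1) w(2)]])
    moreover have "P \<ge> 0" unfolding P_def by (intro Bochner_Integration.integral_nonneg) simp
    ultimately have "P powr b \<le> (((j * y powr \<kappa> + K * y powr (\<kappa> + 1)) / K) powr (1 / b)) powr b"
      using b by (intro powr_mono2) auto
    also have "\<dots> = (j * y powr \<kappa> + K * y powr (\<kappa> + 1)) / K"
      using b K0 jnn by (simp add: powr_powr)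
    finally show ?thesis using K0 unfolding powr_powr b_def[symmetric] by (simp add: field_simps)
  qed
  then show ?thesis unfolding P_def .
qed

text \<open>Young's inequality for \<open>(u x)\<^sup>2 / y\<close> and 1 with weights
  \<open>p / 2\<close> and \<open>1 - p / 2\<close>, where \<open>y\<close> is the integral of
  \<open>u\<^sup>2\<close>. This normalisation gives the quotient mean 1, so the integrated bound is
  exactly \<open>y powr (p / 2)\<close>.\<close>

lemma powr_mean_le:
  assumes "prob_space M" and u: "u \<in> borel_measurable M" and u2: "integrable M (\<lambda>x. (u x)\<^sup>2 :: real)"
    and p: "1 \<le> p" "p < 2" and y: "(\<integral>x. (u x)\<^sup>2 \<partial>M) > 0"
  shows "(\<integral>x. \<bar>u x\<bar> powr p \<partial>M) powr (2 / p) \<le> (\<integral>x. (u x)\<^sup>2 \<partial>M)"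
proof -
  interpret prob_space M by fact
  define y where "y = (\<integral>x. (u x)\<^sup>2 \<partial>M)"
  have y: "y > 0" using assms by (simp add: y_def)
  have u': "(\<lambda>x. \<bar>u x\<bar>) \<in> borel_measurable M" using u by measurable
  have i: "integrable M (\<lambda>x. \<bar>u x\<bar> powr p)"
    by (rule integral_powr_limit(2)[where w = "\<lambda>_ x. \<bar>u x\<bar>", OF prob_space_axioms u' _ u']) (use u2 p in simp_all)
  have pt: "\<bar>u x\<bar> powr p \<le> y powr (p / 2) * (p / 2 * ((u x)\<^sup>2 / y) + (1 - p / 2))" for x
  proof (cases "u x = 0")
    case True
    then show ?thesis using p by simp
  next
    case False
    have "((u x)\<^sup>2 / y) powr (p / 2) * 1 powr (1 - p / 2) \<le> p / 2 * ((u x)\<^sup>2 / y) + (1 - p / 2) * 1"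
      using p y False by (intro Youngs_inequality_0) auto
    then have "y powr (p / 2) * ((u x)\<^sup>2 / y) powr (p / 2) \<le> y powr (p / 2) * (p / 2 * ((u x)\<^sup>2 / y) + (1 - p / 2))"
      by (intro mult_left_mono) auto
    moreover have "y powr (p / 2) * ((u x)\<^sup>2 / y) powr (p / 2) = \<bar>u x\<bar> powr p"
    proof -
      have "y powr (p / 2) * ((u x)\<^sup>2 / y) powr (p / 2) = (\<bar>u x\<bar>\<^sup>2) powr (p / 2)"
        using y by (subst powr_mult[symmetric]) auto
      also have "\<dots> = (\<bar>u x\<bar> powr 2) powr (p / 2)" using False by simp
      finally show ?thesis unfolding powr_powr by simp
    qed
    ultimately show ?thesis by simp
  qed
  have "(\<integral>x. \<bar>u x\<bar> powr p \<partial>M) \<le> (\<integral>x. y powr (p / 2) * (p / 2 * ((u x)\<^sup>2 / y) + (1 - p / 2)) \<partial>M)"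
    using u2 by (intro Bochner_Integration.integral_mono i pt) auto
  also have "\<dots> = y powr (p / 2)"
    using u2 y prob_space by (simp add: y_def[symmetric])
  finally have "(\<integral>x. \<bar>u x\<bar> powr p \<partial>M) powr (2 / p) \<le> (y powr (p / 2)) powr (2 / p)"
    using p by (intro powr_mono2) (auto intro!: Bochner_Integration.integral_nonneg)
  also have "\<dots> = y" using p y by (simp add: powr_powr)
  finally show ?thesis by (simp add: y_def)
qed

theorem theorem2p1:
  fixes p :: real and u :: "real^'n::finite \<Rightarrow> real" and G :: "real^'n \<Rightarrow> real^'n"
  defines "d \<equiv> real (CARD('n) - 1)"
  defines "\<gamma> \<equiv> BE_gamma d p"
  assumes dim: "CARD('n) \<ge> 2"
    and p1: "p \<ge> 1" and p2: "p \<noteq> 2"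
    and pBE: "d \<ge> 2 \<longrightarrow> p \<le> BE_exp d"
    and H1: "H1_sphere u G"
  shows "(\<gamma> \<noteq> 2 - p \<longrightarrow>
           (\<integral>x. (norm (G x))\<^sup>2 \<partial>sphere_mu) \<ge>
             d / (2 - p - \<gamma>) *
               ((Lnorm sphere_mu 2 u)\<^sup>2
                 - Lnorm sphere_mu p u powr (2 - 2 * \<gamma> / (2 - p))
                   * Lnorm sphere_mu 2 u powr (2 * \<gamma> / (2 - p))))
       \<and> (\<gamma> = 2 - p \<longrightarrow>
           (\<integral>x. (norm (G x))\<^sup>2 \<partial>sphere_mu) \<ge>
             2 * d / (p - 2) * (Lnorm sphere_mu 2 u)\<^sup>2
               * ln ((Lnorm sphere_mu 2 u)\<^sup>2 / (Lnorm sphere_mu p u)\<^sup>2))"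
proof -
  have d: "d = real CARD('n) - 1" using dim by (simp add: d_def of_nat_diff)
  have dpos: "d > 0" using dim by (simp add: d_def)
  have \<gamma>0: "\<gamma> \<ge> 0" unfolding \<gamma>_def using p1 pBE by (rule BE_gamma_nonneg)
  have u [measurable]: "u \<in> borel_measurable borel" and G [measurable]: "G \<in> borel_measurable borel"
    using H1 by (simp_all add: H1_sphere_def)
  have u2: "integrable smeas (\<lambda>x. (u x)\<^sup>2)"
    using H1 by (subst integral_smeas(2)) (simp_all add: H1_sphere_def)
  define y where "y = (\<integral>x. (u x)\<^sup>2 \<partial>smeas)"
  define j where "j = (\<integral>x. (norm (G x))\<^sup>2 \<partial>smeas)"
  define P where "P = (\<integral>x. \<bar>u x\<bar> powr p \<partial>smeas)"
  have y0: "y \<ge> 0" and j0: "j \<ge> 0" and P0: "P \<ge> 0"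
    unfolding y_def j_def P_def by (auto intro!: Bochner_Integration.integral_nonneg)
  have jG: "(\<integral>x. (norm (G x))\<^sup>2 \<partial>sphere_mu) = j"
    unfolding j_def by (intro integral_smeas(1)[symmetric]) measurable
  have L2: "Lnorm sphere_mu 2 u = y powr (1 / 2)"
    unfolding Lnorm_def y_def by (subst integral_smeas(1)) (simp_all add: powr_numeral)
  have Lp: "Lnorm sphere_mu p u = P powr (1 / p)"
    unfolding Lnorm_def P_def by (subst integral_smeas(1)) simp_all
  have L2sq: "(y powr (1 / 2))\<^sup>2 = y"
    using y0 by (simp add: powr_half_sqrt)
  show ?thesis unfolding jG L2 Lp L2sq
  proof (intro conjI impI)
    assume ne: "\<gamma> \<noteq> 2 - p"
    show "j \<ge> d / (2 - p - \<gamma>) * (y - (P powr (1 / p)) powr (2 - 2 * \<gamma> / (2 - p)) * (y powr (1 / 2)) powr (2 * \<gamma> / (2 - p)))"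
    \<comment> \<open>For \<open>y = 0\<close> the right side is 0, since every \<open>powr\<close>
      with base 0 is 0 by convention.\<close>
    proof (cases "y = 0")
      case True
      then show ?thesis using j0 by simp
    next
      case False
      then have y: "y > 0" using y0 by simp
      define \<kappa> where "\<kappa> = \<gamma> / (p - 2)"
      define K where "K = d / (p - 2 + \<gamma>)"
      have main: "K * (P powr (2 / p)) powr (\<kappa> + 1) \<le> j * y powr \<kappa> + K * y powr (\<kappa> + 1)"
        unfolding P_def j_def y_def
        by (rule interpolation_H1[OF H1 dim p1 p2 _ \<gamma>0 ne \<kappa>_def K_def[unfolded d] y[unfolded y_def]])
           (simp add: \<gamma>_def d)
      have K': "d / (2 - p - \<gamma>) = - K"
        unfolding K_def by (simp add: minus_divide_right)
      have ex: "2 * \<gamma> / (2 - p) = - 2 * \<kappa>"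
        unfolding \<kappa>_def using p2 by (simp add: field_simps)
      have e1: "(P powr (1 / p)) powr (2 - 2 * \<gamma> / (2 - p)) = (P powr (2 / p)) powr (\<kappa> + 1)"
        unfolding ex powr_powr by (simp add: field_simps)
      have e2: "(y powr (1 / 2)) powr (2 * \<gamma> / (2 - p)) = y powr (- \<kappa>)"
        unfolding ex powr_powr by simp
      have "K * (P powr (2 / p)) powr (\<kappa> + 1) * y powr (- \<kappa>) \<le> (j * y powr \<kappa> + K * y powr (\<kappa> + 1)) * y powr (- \<kappa>)"
        by (intro mult_right_mono main) simp
      also have "\<dots> = j + K * y"
        using y by (simp add: distrib_right mult.assoc powr_add[symmetric])
      finally show ?thesis unfolding K' e1 e2 by (simp add: algebra_simps)
    qed
  next
    \<comment> \<open>As \<gamma> is nonnegative and \<open>p \<noteq> 2\<close>, this case forces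
      \<open>p < 2\<close>. The factor \<open>2 * d / (p - 2)\<close> is then negative, while
      monotonicity of the norms in the exponent makes the logarithm nonnegative, so the right side
      is at most 0.\<close>
    assume eq: "\<gamma> = 2 - p"
    then have p: "p < 2" using \<gamma>0 p2 by simp
    show "j \<ge> 2 * d / (p - 2) * y * ln (y / (P powr (1 / p))\<^sup>2)"
    \<comment> \<open>For \<open>y = 0\<close> the right side vanishes; for \<open>P = 0\<close> the
      quotient is 0 by the convention for division, and \<open>ln 0\<close> is 0 as well.\<close>
    proof (cases "y = 0 \<or> P = 0")
      case True
      then show ?thesis using j0 by auto
    next
      case False
      then have y: "y > 0" and P: "P > 0" using y0 P0 by auto
      have "P powr (2 / p) \<le> y"
        unfolding P_def y_def using p p1 y
        by (intro powr_mean_le smeas.prob_space_axioms borel_measurable_smeas u u2) (auto simp: y_def)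
      moreover have "(P powr (1 / p))\<^sup>2 = P powr (2 / p)"
        unfolding power2_eq_square powr_add[symmetric] by simp
      ultimately have "ln (y / (P powr (1 / p))\<^sup>2) \<ge> 0"
        using P by (intro ln_ge_zero) (simp add: field_simps)
      then have "2 * d / (p - 2) * y * ln (y / (P powr (1 / p))\<^sup>2) \<le> 0"
        using p dpos y by (intro mult_nonpos_nonneg) (auto simp: divide_nonneg_neg)
      then show ?thesis using j0 by linarith
    qed
  qed
qed

end
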